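(* Let $r\ge 1$ be an integer. For any convergent power series $F(w_1,\ldots,w_r)=\sum_{k\in\mathbb{N}^r} c_k w_1^{k_1}\cdots w_r^{k_r}\in\mathbb{C}\{w_1,\ldots,w_r\}$ and any resurgent series $\tilde\varphi_1,\ldots,\tilde\varphi_r\in\mathbb{C}[[z^{-1}]]$ without constant term, the formal series $$F(\tilde\varphi_1,\ldots,\tilde\varphi_r)\;=\;\sum_{k\in\mathbb{N}^r} c_k\,\tilde\varphi_1^{k_1}\cdots\tilde\varphi_r^{k_r}$$ is resurgent.
   Context: A convergent power series $\hat\varphi\in\mathbb{C}\{\zeta\}$ (identified with the holomorphic germ it defines at $0$) is called endlessly continuable if for every real $L>0$ there exists a finite subset $F_L\subset\mathbb{C}$ such that the germ $\hat\varphi$ can be analytically continued along every Lipschitz path $\gamma:[0,1]\to\mathbb{C}$ of length smaller than $L$ with $\gamma(0)=0$ and $\gamma((0,1])\subset\mathbb{C}\setminus F_L$. A formal series $\tilde\varphi(z)=\sum_{j\ge0}\varphi_j z^{-j}\in\mathbb{C}[[z^{-1}]]$ is called resurgent if $\hat\varphi(\zeta)=\sum_{j\ge1}\varphi_j\frac{\zeta^{j-1}}{(j-1)!}$ is endlessly continuable. The series $\sum_k c_k\tilde\varphi_1^{k_1}\cdots\tilde\varphi_r^{k_r}$ is well defined as a formal series since the $\tilde\varphi_i$ have no constant term. *)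

theory Defs
  imports "HOL-Analysis.Analysis"
begin

text \<open>Formal series in z^-1 are represented as complex fps in the variable z^-1;
  coefficient j of the fps is the coefficient of z^-j.\<close>

definition path_length :: "(real \<Rightarrow> complex) \<Rightarrow> real" where
  "path_length \<gamma> =
     (SUP p \<in> {(n, t). t 0 = 0 \<and> t n = 1 \<and> (\<forall>i<n. t i \<le> t (Suc i))}.
        (\<Sum>i<fst p. cmod (\<gamma> (snd p (Suc i)) - \<gamma> (snd p i))))"

definition continuable_along :: "complex fps \<Rightarrow> (real \<Rightarrow> complex) \<Rightarrow> bool" where
  "continuable_along a \<gamma> \<longleftrightarrow>
     (\<exists>f R. (\<forall>t\<in>{0..1}. R t > 0 \<and> f t holomorphic_on ball (\<gamma> t) (R t))
       \<and> (\<exists>\<rho>>0. \<forall>z\<in>ball 0 \<rho>. f 0 z = eval_fps a z)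
       \<and> (\<forall>t\<in>{0..1}. \<exists>\<delta>>0. \<forall>s\<in>{0..1}. \<bar>s - t\<bar> < \<delta> \<longrightarrow>
             \<gamma> s \<in> ball (\<gamma> t) (R t) \<and>
             (\<forall>z\<in>ball (\<gamma> s) (R s) \<inter> ball (\<gamma> t) (R t). f s z = f t z)))"

definition endlessly_continuable :: "complex fps \<Rightarrow> bool" where
  "endlessly_continuable a \<longleftrightarrow> fps_conv_radius a > 0 \<and>
     (\<forall>L>0. \<exists>F. finite F \<and>
        (\<forall>\<gamma>. (\<exists>C. C-lipschitz_on {0..1} \<gamma>) \<and> path_length \<gamma> < L \<and> \<gamma> 0 = 0 \<and>
              \<gamma> ` {0<..1} \<subseteq> - F \<longrightarrow> continuable_along a \<gamma>))"

definition borel :: "complex fps \<Rightarrow> complex fps" where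
  "borel \<phi> = Abs_fps (\<lambda>n. fps_nth \<phi> (Suc n) / fact n)"

definition resurgent :: "complex fps \<Rightarrow> bool" where
  "resurgent \<phi> \<longleftrightarrow> endlessly_continuable (borel \<phi>)"

definition multi_idx :: "nat \<Rightarrow> (nat \<Rightarrow> nat) set" where
  "multi_idx r = {k. \<forall>i\<ge>r. k i = 0}"

definition conv_multi_series :: "nat \<Rightarrow> ((nat \<Rightarrow> nat) \<Rightarrow> complex) \<Rightarrow> bool" where
  "conv_multi_series r c \<longleftrightarrow>
     (\<exists>\<rho>>0. (\<lambda>k. cmod (c k) * \<rho> ^ (\<Sum>i<r. k i)) summable_on multi_idx r)"

definition fps_subst_multi :: "nat \<Rightarrow> ((nat \<Rightarrow> nat) \<Rightarrow> complex) \<Rightarrow> (nat \<Rightarrow> complex fps) \<Rightarrow> complex fps" where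
  "fps_subst_multi r c \<phi> =
     Abs_fps (\<lambda>n. \<Sum>\<^sub>\<infinity>k\<in>multi_idx r. c k * fps_nth (\<Prod>i<r. \<phi> i ^ k i) n)"

end

theory Submission
  imports Defs "HOL-Complex_Analysis.Complex_Analysis"
begin

text \<open>
  Write \<open>V w\<close> for the Borel transform of the product of the series listed by a word \<open>w\<close>. Since
  \<open>V (i # w)\<close> is the convolution of \<open>V [i]\<close> and \<open>V w\<close>, it is enough to continue all \<open>V w\<close> along a
  given path with a bound \<open>C \<theta>^|w|\<close>, for the \<open>\<theta>\<close> provided by the convergence of \<open>F\<close>, where \<open>C\<close> may
  depend on the path but not on \<open>w\<close>; the series over all monomials then converges uniformly near the path.

  Fix the length \<open>L\<close>, a finite set \<open>F \<ni> 0\<close> of possible singularities of the given germs on paths of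
  that length, and \<open>\<rho>\<close> such that the germs are holomorphic near the disc of radius \<open>4 \<rho>\<close>. The claim is
  shown, by induction on \<open>k\<close>, for paths of length less than \<open>k \<rho>\<close> that avoid the \<open>k\<close>-fold sumset of \<open>F\<close>.
  Replace the path by a fine polygon with vertices \<open>z j\<close>. The integration contour of the convolution at
  \<open>z j\<close> runs through points \<open>Y i j\<close>, where \<open>Y i\<close> is born at \<open>z i\<close>, and \<open>X i j = z j - Y i j\<close> is the
  argument of the other factor. Each displacement of \<open>z\<close> is shared between \<open>X i\<close> and \<open>Y i\<close>: normally
  \<open>X i\<close> takes all of it, but \<open>X i\<close> is held back, and \<open>Y i\<close> moves instead, when \<open>X i\<close> has length more
  than \<open>\<rho>\<close> and is close to \<open>F\<close>. As \<open>z\<close> avoids \<open>F + \<Omega>\<close>, with \<open>\<Omega>\<close> the \<open>(k-1)\<close>-fold sumset, \<open>Y i\<close> is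
  then far from \<open>\<Omega>\<close>. The lengths of \<open>X i\<close> and \<open>Y i\<close> add up to that of \<open>z\<close>, so a \<open>Y i\<close> that has moved
  is shorter than \<open>(k-1) \<rho>\<close> and is covered by the induction hypothesis, while a \<open>Y i\<close> that has not moved
  only follows \<open>z\<close> itself. What remains is a linear Volterra inequality along \<open>z\<close>, and the weight
  \<open>exp (\<nu> * chain_length z j)\<close> with large \<open>\<nu>\<close> gives the factor \<open>\<theta>\<close> per convolution.
\<close>

section \<open>Convolution of germs at the origin\<close>

text \<open>The intersection of two discs is convex, hence connected, so the identity theorem
  spreads equality from any nonempty open subset \<open>U\<close>. Later gluing of germs rests on
  this.\<close>

lemma holomorphic_agree_Int_balls:
  assumes "f holomorphic_on ball a R" "g holomorphic_on ball b S"
    and "open U" "U \<noteq> {}" "U \<subseteq> ball a R \<inter> ball b S" "\<And>x. x \<in> U \<Longrightarrow> f x = g x"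
    and "x \<in> ball a R \<inter> ball b S"
  shows "f x = g x"
proof -
  have op: "open (ball a R \<inter> ball b S)" and conn: "connected (ball a R \<inter> ball b S)"
    by (simp_all add: convex_connected convex_Int open_Int)
  have hol: "f holomorphic_on ball a R \<inter> ball b S" "g holomorphic_on ball a R \<inter> ball b S"
    using holomorphic_on_subset[OF assms(1)] holomorphic_on_subset[OF assms(2)] by simp_all
  show ?thesis
    by (rule analytic_continuation_open[OF assms(3) op assms(4) conn assms(5) hol assms(6,7)])
qed

lemma contour_integral_linepath_integral:
  "contour_integral (linepath a b) f = integral {0..1} (\<lambda>t. f (linepath a b t) * (b - a))"
  by (simp add: contour_integral_integral)

lemma linepath_primitive:
  assumes "f holomorphic_on S" "convex S" "open S"
  obtains P where "\<And>a b. a \<in> S \<Longrightarrow> b \<in> S \<Longrightarrow> contour_integral (linepath a b) f = P b - P a"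
proof -
  obtain P where P: "\<And>x. x \<in> S \<Longrightarrow> (P has_field_derivative f x) (at x within S)"
    using holomorphic_convex_primitive'[OF assms(2,3,1)] by blast
  have "contour_integral (linepath a b) f = P b - P a" if "a \<in> S" "b \<in> S" for a b
    using contour_integral_primitive[OF P, of "linepath a b"] that assms(2)
    by (simp add: closed_segment_subset contour_integral_unique)
  then show ?thesis by (rule that)
qed

lemma linepath_integral_bound:
  assumes "f holomorphic_on S" "convex S" "open S" "a \<in> S" "b \<in> S"
    and "0 \<le> B" "\<And>y. y \<in> closed_segment a b \<Longrightarrow> cmod (f y) \<le> B"
  shows "cmod (contour_integral (linepath a b) f) \<le> B * cmod (b - a)"
proof (rule contour_integral_bound_linepath)
  have "closed_segment a b \<subseteq> S" using assms by (simp add: closed_segment_subset)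
  then show "f contour_integrable_on linepath a b"
    using assms(1) holomorphic_on_imp_continuous_on continuous_on_subset
    by (blast intro: contour_integrable_continuous_linepath)
qed (use assms in auto)

text \<open>Only the factor \<open>p\<close> depends on the parameter, so the Leibniz rule needs
  nothing of \<open>q\<close> beyond continuity on the segment.\<close>

lemma linepath_convolution_deriv:
  assumes p: "p holomorphic_on ball x R" and q: "continuous_on (closed_segment a b) q"
    and sub: "\<And>y \<zeta>. y \<in> closed_segment a b \<Longrightarrow> \<zeta> \<in> ball z S \<Longrightarrow> \<zeta> - y \<in> ball x R"
    and \<zeta>: "\<zeta> \<in> ball z S"
  shows "((\<lambda>\<zeta>. contour_integral (linepath a b) (\<lambda>y. p (\<zeta> - y) * q y)) has_field_derivative
          contour_integral (linepath a b) (\<lambda>y. deriv p (\<zeta> - y) * q y)) (at \<zeta>)"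
proof -
  let ?l = "linepath a b"
  have l: "?l t \<in> closed_segment a b" if "t \<in> {0..1}" for t
    using that linepath_in_path by blast
  have cl: "continuous_on {0..1} (\<lambda>t. q (?l t))"
    by (rule continuous_on_compose2[OF q continuous_on_linepath]) (use l in auto)
  have cp: "continuous_on (ball x R) p"
    using p holomorphic_on_imp_continuous_on by blast
  have "deriv p holomorphic_on ball x R"
    using p by (intro holomorphic_deriv) auto
  then have cdp: "continuous_on (ball x R) (deriv p)"
    using holomorphic_on_imp_continuous_on by blast
  have d: "((\<lambda>x. p (x - ?l t) * q (?l t) * (b - a)) has_field_derivative
              deriv p (\<zeta> - ?l t) * q (?l t) * (b - a)) (at \<zeta> within ball z S)"
    if "\<zeta> \<in> ball z S" "t \<in> cbox 0 1" for \<zeta> t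
  proof -
    have "(p has_field_derivative deriv p (\<zeta> - ?l t)) (at (\<zeta> - ?l t))"
      using p sub[OF l that(1), of t] that(2)
      by (auto intro!: holomorphic_derivI[where S = "ball x R"])
    then have "((\<lambda>x. p (x - ?l t)) has_field_derivative deriv p (\<zeta> - ?l t) * 1) (at \<zeta> within ball z S)"
      by (intro DERIV_chain2[where f = p]) (auto intro!: derivative_eq_intros)
    then show ?thesis by (auto intro!: derivative_eq_intros)
  qed
  have "((\<lambda>\<zeta>. integral (cbox 0 1) (\<lambda>t. p (\<zeta> - ?l t) * q (?l t) * (b - a))) has_field_derivative
         integral (cbox 0 1) (\<lambda>t. deriv p (\<zeta> - ?l t) * q (?l t) * (b - a))) (at \<zeta> within ball z S)"
  proof (rule leibniz_rule_field_derivative[OF d _ _ \<zeta> convex_ball])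
    show "(\<lambda>t. p (\<zeta> - ?l t) * q (?l t) * (b - a)) integrable_on cbox 0 1"
      if "\<zeta> \<in> ball z S" for \<zeta>
      unfolding cbox_interval
      by (intro integrable_continuous_interval continuous_intros cl
          continuous_on_compose2[OF cp]) (use that sub l in \<open>auto simp del: mem_ball\<close>)
    have "continuous_on (ball z S \<times> {0..1}) (\<lambda>w. deriv p (fst w - ?l (snd w)))"
      by (rule continuous_on_compose2[OF cdp])
         (use sub l in \<open>auto intro!: continuous_intros simp del: mem_ball simp: linepath_def\<close>)
    moreover have "continuous_on (ball z S \<times> {0..1}) (\<lambda>w. q (?l (snd w)))"
      by (rule continuous_on_compose2[OF cl]) (auto intro!: continuous_intros)
    ultimately show "continuous_on (ball z S \<times> cbox 0 1)
        (\<lambda>(x, t). deriv p (x - ?l t) * q (?l t) * (b - a))"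
      unfolding cbox_interval case_prod_unfold by (intro continuous_intros)
  qed
  then show ?thesis
    using \<zeta> at_within_open[of \<zeta> "ball z S"] by (simp add: contour_integral_linepath_integral)
qed

definition conv :: "(complex \<Rightarrow> complex) \<Rightarrow> (complex \<Rightarrow> complex) \<Rightarrow> complex \<Rightarrow> complex" where
  "conv f g \<zeta> = contour_integral (linepath 0 \<zeta>) (\<lambda>y. f (\<zeta> - y) * g y)"

lemma conv_integrand_holomorphic:
  assumes "f holomorphic_on ball 0 r" "g holomorphic_on ball 0 r"
  shows "(\<lambda>y. f (\<zeta> - y) * g y) holomorphic_on ball 0 r \<inter> ball \<zeta> r"
proof -
  have "(\<lambda>y. f (\<zeta> - y)) holomorphic_on ball 0 r \<inter> ball \<zeta> r"
    by (rule holomorphic_on_compose_gen[OF _ assms(1), unfolded o_def])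
       (auto simp: dist_norm norm_minus_commute intro!: holomorphic_intros)
  then show ?thesis
    by (intro holomorphic_on_mult) (auto intro: holomorphic_on_subset[OF assms(2)])
qed

text \<open>Near \<open>z\<close> the contour is split at \<open>z\<close>: the fixed segment from 0
  to \<open>z\<close> gives \<open>conv (deriv f) g z\<close> by differentiation under the integral,
  and the short segment from \<open>z\<close> to the moving endpoint gives the boundary term
  \<open>f 0 * g z\<close>.\<close>

lemma conv_has_field_derivative:
  assumes f: "f holomorphic_on ball 0 r" and g: "g holomorphic_on ball 0 r" and z: "z \<in> ball 0 r"
  shows "(conv f g has_field_derivative f 0 * g z + conv (deriv f) g z) (at z)"
proof -
  define e where "e = r - cmod z"
  have e: "e > 0" "e \<le> r" using z by (auto simp: e_def)
  have "r > 0" using e by simp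
  let ?A = "\<lambda>\<zeta>. contour_integral (linepath 0 z) (\<lambda>y. f (\<zeta> - y) * g y)"
  let ?J = "\<lambda>\<zeta>. contour_integral (linepath z \<zeta>) (\<lambda>y. f (\<zeta> - y) * g y)"
  have seg: "cmod y \<le> cmod z \<and> cmod (z - y) \<le> cmod z" if "y \<in> closed_segment 0 z" for y
    using segment_bound[OF that] by (auto simp: norm_minus_commute)
  have A: "(?A has_field_derivative contour_integral (linepath 0 z) (\<lambda>y. deriv f (z - y) * g y)) (at z)"
  proof (rule linepath_convolution_deriv[OF f])
    have "closed_segment 0 z \<subseteq> ball 0 r" using z \<open>r > 0\<close> by (intro closed_segment_subset) auto
    then show "continuous_on (closed_segment 0 z) g"
      using g holomorphic_on_imp_continuous_on continuous_on_subset by blast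
    show "\<zeta> - y \<in> ball 0 r" if "y \<in> closed_segment 0 z" "\<zeta> \<in> ball z e" for y \<zeta>
    proof -
      have "cmod (\<zeta> - y) \<le> cmod (\<zeta> - z) + cmod (z - y)"
        using norm_triangle_ineq[of "\<zeta> - z" "z - y"] by simp
      then show ?thesis using that(2) seg[OF that(1)] by (simp add: e_def dist_norm norm_minus_commute)
    qed
  qed (use e in auto)
  have J: "(?J has_field_derivative f 0 * g z) (at z)"
    unfolding has_field_derivative_iff
  proof (rule LIM_I)
    fix \<epsilon> :: real assume "\<epsilon> > 0"
    have "isCont (\<lambda>w. f (fst w) * g (snd w)) (0, z)"
    proof (rule continuous_on_interior[where S = "ball 0 r \<times> ball 0 r"])
      have "continuous_on (ball 0 r \<times> ball 0 r) (\<lambda>w. f (fst w))"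
           "continuous_on (ball 0 r \<times> ball 0 r) (\<lambda>w. g (snd w))"
        by (auto intro!: continuous_on_compose2[OF holomorphic_on_imp_continuous_on[OF f]]
              continuous_on_compose2[OF holomorphic_on_imp_continuous_on[OF g]] continuous_intros)
      then show "continuous_on (ball 0 r \<times> ball 0 r) (\<lambda>w. f (fst w) * g (snd w))"
        by (intro continuous_intros)
      show "(0, z) \<in> interior (ball 0 r \<times> ball 0 r)"
        using z \<open>r > 0\<close> by (simp add: interior_open open_Times)
    qed
    then obtain d where d: "d > 0"
      "\<And>w. dist w (0, z) < d \<Longrightarrow> dist (f (fst w) * g (snd w)) (f 0 * g z) < \<epsilon> / 2"
      unfolding continuous_at_eps_delta using \<open>\<epsilon> > 0\<close> half_gt_zero fst_conv snd_conv by metis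
    show "\<exists>s>0. \<forall>\<zeta>. \<zeta> \<noteq> z \<and> norm (\<zeta> - z) < s \<longrightarrow>
            norm ((?J \<zeta> - ?J z) / (\<zeta> - z) - f 0 * g z) < \<epsilon>"
    \<comment> \<open>\<open>d/2\<close> because \<open>(\<zeta> - y, y)\<close> is at distance at
      most \<open>2 * cmod (\<zeta> - z)\<close> from \<open>(0, z)\<close>.\<close>
    proof (intro exI[of _ "min e (d/2)"] conjI allI impI)
      fix \<zeta> assume \<zeta>: "\<zeta> \<noteq> z \<and> norm (\<zeta> - z) < min e (d/2)"
      have "cmod \<zeta> \<le> cmod (\<zeta> - z) + cmod z" using norm_triangle_ineq[of "\<zeta> - z" z] by simp
      then have in_S: "z \<in> ball 0 r \<inter> ball \<zeta> r" "\<zeta> \<in> ball 0 r \<inter> ball \<zeta> r"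
        using \<zeta> z e \<open>r > 0\<close> norm_ge_zero[of z] by (auto simp: dist_norm e_def simp del: norm_ge_zero)
      let ?G = "\<lambda>y. f (\<zeta> - y) * g y"
      have G: "?G holomorphic_on ball 0 r \<inter> ball \<zeta> r"
        by (rule conv_integrand_holomorphic[OF f g])
      have ci: "?G contour_integrable_on linepath z \<zeta>"
      proof (rule contour_integrable_holomorphic_simple[OF G])
        show "path_image (linepath z \<zeta>) \<subseteq> ball 0 r \<inter> ball \<zeta> r"
          unfolding path_image_linepath using in_S by (intro closed_segment_subset convex_Int) auto
      qed auto
      have "((\<lambda>y. ?G y - f 0 * g z) has_contour_integral (?J \<zeta> - f 0 * g z * (\<zeta> - z))) (linepath z \<zeta>)"
        by (intro has_contour_integral_diff has_contour_integral_integral[OF ci]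
             has_contour_integral_const_linepath)
      then have "cmod (?J \<zeta> - f 0 * g z * (\<zeta> - z)) \<le> \<epsilon> / 2 * cmod (\<zeta> - z)"
      proof (rule has_contour_integral_bound_linepath)
        fix y assume y: "y \<in> closed_segment z \<zeta>"
        have "dist (\<zeta> - y, y) (0, z) \<le> cmod (\<zeta> - y) + cmod (y - z)"
          unfolding dist_Pair_Pair using sqrt_sum_squares_le_sum[of "cmod (\<zeta> - y)" "cmod (y - z)"]
          by (simp add: dist_norm)
        also have "\<dots> < d" using segment_bound[OF y] \<zeta> by (auto simp: norm_minus_commute)
        finally show "cmod (?G y - f 0 * g z) \<le> \<epsilon> / 2"
          using d(2)[of "(\<zeta> - y, y)"] by (simp add: dist_norm)
      qed (use \<open>\<epsilon> > 0\<close> in auto)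
      moreover have "(?J \<zeta> - ?J z) / (\<zeta> - z) - f 0 * g z = (?J \<zeta> - f 0 * g z * (\<zeta> - z)) / (\<zeta> - z)"
        using \<zeta> by (simp add: field_simps)
      ultimately have "cmod ((?J \<zeta> - ?J z) / (\<zeta> - z) - f 0 * g z) \<le> \<epsilon> / 2"
        using \<zeta> by (simp add: norm_divide divide_simps)
      then show "norm ((?J \<zeta> - ?J z) / (\<zeta> - z) - f 0 * g z) < \<epsilon>" using \<open>\<epsilon> > 0\<close> by linarith
    qed (use e d in auto)
  qed
  have "((\<lambda>\<zeta>. ?A \<zeta> + ?J \<zeta>) has_field_derivative f 0 * g z + conv (deriv f) g z) (at z)"
    using DERIV_add[OF A J] by (simp add: conv_def add.commute)
  \<comment> \<open>The contour may be split at \<open>z\<close> since 0, \<open>z\<close> and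
    \<open>\<zeta>\<close> lie in a convex lens on which the integrand has a primitive.\<close>
  moreover have "eventually (\<lambda>\<zeta>. \<zeta> \<in> ball z e) (nhds z)"
    using e by (intro eventually_nhds_in_open) auto
  then have "eventually (\<lambda>\<zeta>. conv f g \<zeta> = ?A \<zeta> + ?J \<zeta>) (nhds z)"
  proof eventually_elim
    case (elim \<zeta>)
    have "cmod \<zeta> \<le> cmod (\<zeta> - z) + cmod z" using norm_triangle_ineq[of "\<zeta> - z" z] by simp
    then have "z \<in> ball 0 r \<inter> ball \<zeta> r" "\<zeta> \<in> ball 0 r \<inter> ball \<zeta> r" "0 \<in> ball 0 r \<inter> ball \<zeta> r"
      using elim z e \<open>r > 0\<close> norm_ge_zero[of z]
      by (auto simp: dist_norm e_def norm_minus_commute simp del: norm_ge_zero)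
    moreover obtain P where "\<And>a b. a \<in> ball 0 r \<inter> ball \<zeta> r \<Longrightarrow> b \<in> ball 0 r \<inter> ball \<zeta> r \<Longrightarrow>
        contour_integral (linepath a b) (\<lambda>y. f (\<zeta> - y) * g y) = P b - P a"
      by (rule linepath_primitive[OF conv_integrand_holomorphic[OF f g, of \<zeta>]
            convex_Int[OF convex_ball convex_ball] open_Int[OF open_ball open_ball]]) blast
    ultimately show ?case by (simp add: conv_def)
  qed
  ultimately show ?thesis by (subst DERIV_cong_ev[OF refl _ refl])
qed

lemma conv_holomorphic:
  assumes "f holomorphic_on ball 0 r" "g holomorphic_on ball 0 r"
  shows "conv f g holomorphic_on ball 0 r"
  unfolding holomorphic_on_open[OF open_ball] using conv_has_field_derivative[OF assms] by blast

text \<open>Each differentiation moves one derivative onto \<open>f\<close> inside the convolution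
  and leaves one boundary term. At 0 the integral vanishes, so what remains there is a Cauchy
  product.\<close>

lemma higher_deriv_conv:
  assumes f: "f holomorphic_on ball 0 r" and g: "g holomorphic_on ball 0 r" and z: "z \<in> ball 0 r"
  shows "(deriv ^^ n) (conv f g) z =
    (\<Sum>i<n. (deriv ^^ i) f 0 * (deriv ^^ (n - 1 - i)) g z) + conv ((deriv ^^ n) f) g z"
  using z
proof (induction n arbitrary: z)
  case (Suc n)
  have ev: "eventually (\<lambda>w. w \<in> ball 0 r) (nhds z)"
    using Suc.prems by (intro eventually_nhds_in_open) auto
  have "(deriv ^^ Suc n) (conv f g) z = deriv (\<lambda>w. (\<Sum>i<n. (deriv ^^ i) f 0 * (deriv ^^ (n - 1 - i)) g w)
        + conv ((deriv ^^ n) f) g w) z"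
    by (simp, rule deriv_cong_ev[OF eventually_mono[OF ev]]) (use Suc.IH in auto)
  also have "\<dots> = (\<Sum>i<n. (deriv ^^ i) f 0 * deriv ((deriv ^^ (n - 1 - i)) g) z)
        + ((deriv ^^ n) f 0 * g z + conv (deriv ((deriv ^^ n) f)) g z)"
  proof (intro DERIV_imp_deriv DERIV_add DERIV_sum DERIV_cmult)
    show "(conv ((deriv ^^ n) f) g has_field_derivative
        (deriv ^^ n) f 0 * g z + conv (deriv ((deriv ^^ n) f)) g z) (at z)"
      by (rule conv_has_field_derivative[OF _ g Suc.prems]) (use f in \<open>auto intro: holomorphic_higher_deriv\<close>)
    fix i
    have "(deriv ^^ (n - 1 - i)) g holomorphic_on ball 0 r"
      using g by (intro holomorphic_higher_deriv) auto
    then show "((deriv ^^ (n - 1 - i)) g has_field_derivative deriv ((deriv ^^ (n - 1 - i)) g) z) (at z)"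
      using Suc.prems by (intro holomorphic_derivI) auto
  qed
  also have "(\<Sum>i<n. (deriv ^^ i) f 0 * deriv ((deriv ^^ (n - 1 - i)) g) z)
           = (\<Sum>i<n. (deriv ^^ i) f 0 * (deriv ^^ (n - i)) g z)"
  proof (intro sum.cong refl arg_cong2[where f = "(*)"])
    fix i assume "i \<in> {..<n}"
    then have "n - i = Suc (n - 1 - i)" by auto
    then show "deriv ((deriv ^^ (n - 1 - i)) g) z = (deriv ^^ (n - i)) g z" by simp
  qed
  finally show ?case by (simp add: algebra_simps)
qed simp

lemma conv_0 [simp]: "conv f g 0 = 0"
  by (simp add: conv_def)

section \<open>Borel transforms of products\<close>

lemma eval_fps_holomorphic_ball:
  fixes a :: "complex fps"
  assumes "ereal r \<le> fps_conv_radius a"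
  shows "eval_fps a holomorphic_on ball 0 r"
proof (rule holomorphic_on_eval_fps)
  have "ereal (cmod x) < fps_conv_radius a" if "cmod x < r" for x
    using less_le_trans[OF _ assms, of "ereal (cmod x)"] that by simp
  then show "ball (0::complex) r \<subseteq> eball 0 (fps_conv_radius a)"
    by (simp add: subset_iff)
qed

lemma fps_nth_0_prod_list:
  fixes fs :: "complex fps list"
  assumes "fs \<noteq> []" "\<And>f. f \<in> set fs \<Longrightarrow> fps_nth f 0 = 0"
  shows "fps_nth (prod_list fs) 0 = 0"
  using assms by (cases fs) (auto simp: fps_mult_nth_0)

text \<open>By \<open>higher_deriv_conv\<close> the derivatives of the convolution at 0 are
  \<open>fact n\<close> times the coefficients of the Borel transform of \<open>f * g\<close>.
  Holomorphy of the convolution on the disc then gives both the radius and the value.\<close>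

lemma borel_mult:
  assumes f: "fps_conv_radius (Defs.borel f) \<ge> ereal r" and g: "fps_conv_radius (Defs.borel g) \<ge> ereal r"
    and "r > 0" and f0: "fps_nth f 0 = 0" and g0: "fps_nth g 0 = 0"
  shows "fps_conv_radius (Defs.borel (f * g)) \<ge> ereal r"
    and "\<And>\<zeta>. \<zeta> \<in> ball 0 r \<Longrightarrow> eval_fps (Defs.borel (f * g)) \<zeta>
           = conv (eval_fps (Defs.borel f)) (eval_fps (Defs.borel g)) \<zeta>"
proof -
  let ?f = "eval_fps (Defs.borel f)" and ?g = "eval_fps (Defs.borel g)"
  have hol: "?f holomorphic_on ball 0 r" "?g holomorphic_on ball 0 r"
    using f g by (simp_all add: eval_fps_holomorphic_ball)
  have pos: "fps_conv_radius (Defs.borel f) > 0" "fps_conv_radius (Defs.borel g) > 0"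
    using less_le_trans[OF _ f, of 0] less_le_trans[OF _ g, of 0] \<open>r > 0\<close> by simp_all
  have df: "(deriv ^^ i) ?f 0 = fps_nth f (Suc i)" for i
  proof -
    have "?f has_fps_expansion Defs.borel f"
      using pos by (intro eval_fps_has_fps_expansion)
    from fps_nth_fps_expansion[OF this, of i]
    have "fps_nth f (Suc i) / fact i = (deriv ^^ i) ?f 0 / fact i"
      unfolding borel_def[of f] fps_nth_Abs_fps .
    then show ?thesis by (simp only: divide_cancel_right fact_nonzero) simp
  qed
  have dg: "(deriv ^^ i) ?g 0 = fps_nth g (Suc i)" for i
  proof -
    have "?g has_fps_expansion Defs.borel g"
      using pos by (intro eval_fps_has_fps_expansion)
    from fps_nth_fps_expansion[OF this, of i]
    have "fps_nth g (Suc i) / fact i = (deriv ^^ i) ?g 0 / fact i"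
      unfolding borel_def[of g] fps_nth_Abs_fps .
    then show ?thesis by (simp only: divide_cancel_right fact_nonzero) simp
  qed
  have "(deriv ^^ n) (conv ?f ?g) 0 = fps_nth (f * g) (Suc n)" for n
  proof -
    have "(deriv ^^ n) (conv ?f ?g) 0 = (\<Sum>i<n. fps_nth f (Suc i) * fps_nth g (Suc (n - 1 - i)))"
      using higher_deriv_conv[OF hol, of 0 n] \<open>r > 0\<close> by (simp only: df dg conv_0 add_0_right centre_in_ball)
    also have "\<dots> = (\<Sum>i<n. fps_nth f (Suc i) * fps_nth g (n - i))"
      by (intro sum.cong refl) (simp add: Suc_diff_Suc)
    also have "\<dots> = (\<Sum>i=1..n. fps_nth f i * fps_nth g (Suc n - i))"
      by (rule sum.reindex_bij_witness[of _ "\<lambda>i. i - 1" Suc]) auto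
    \<comment> \<open>The added terms \<open>i = 0\<close> and \<open>i = Suc n\<close> vanish
      because \<open>f\<close> and \<open>g\<close> have no constant term.\<close>
    also have "\<dots> = (\<Sum>i=0..Suc n. fps_nth f i * fps_nth g (Suc n - i))"
    proof (intro sum.mono_neutral_left ballI)
      fix i assume "i \<in> {0..Suc n} - {1..n}"
      then have "i = 0 \<or> i = Suc n" by auto
      then show "fps_nth f i * fps_nth g (Suc n - i) = 0" using f0 g0 by auto
    qed auto
    finally show ?thesis by (simp add: fps_mult_nth)
  qed
  then have exp: "fps_expansion (conv ?f ?g) 0 = Defs.borel (f * g)"
    by (intro fps_ext) (simp add: fps_expansion_def borel_def[of "f * g"])
  have H: "conv ?f ?g holomorphic_on eball 0 (ereal r)"
    using conv_holomorphic[OF hol] by simp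
  show "fps_conv_radius (Defs.borel (f * g)) \<ge> ereal r"
    using conv_radius_fps_expansion[OF H] unfolding exp .
  show "eval_fps (Defs.borel (f * g)) \<zeta> = conv ?f ?g \<zeta>" if "\<zeta> \<in> ball 0 r" for \<zeta>
    using eval_fps_expansion'[OF H, of \<zeta>, unfolded exp] that by (simp only: add_0 mem_ball dist_0_norm less_ereal.simps)
qed

section \<open>Continuation along chains and deformation of contours\<close>

definition chain_length :: "(nat \<Rightarrow> complex) \<Rightarrow> nat \<Rightarrow> real" where
  "chain_length z j = (\<Sum>i<j. cmod (z (Suc i) - z i))"

text \<open>One radius \<open>R\<close> serves all vertices. Steps are not bounded here, so their
  smallness against \<open>R\<close>, which makes neighbouring discs overlap, is always a separate
  assumption.\<close>

definition chain_cont ::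
  "(complex \<Rightarrow> complex) \<Rightarrow> (nat \<Rightarrow> complex) \<Rightarrow> nat \<Rightarrow> real \<Rightarrow> (nat \<Rightarrow> complex \<Rightarrow> complex) \<Rightarrow> bool" where
  "chain_cont u z K R f \<longleftrightarrow>
     (\<forall>j\<le>K. f j holomorphic_on ball (z j) R) \<and>
     (\<forall>j<K. \<forall>w\<in>ball (z j) R \<inter> ball (z (Suc j)) R. f j w = f (Suc j) w) \<and>
     (\<forall>w\<in>ball (z 0) R. f 0 w = u w)"

lemma chain_length_0 [simp]: "chain_length z 0 = 0"
  by (simp add: chain_length_def)

lemma chain_length_Suc [simp]: "chain_length z (Suc j) = chain_length z j + cmod (z (Suc j) - z j)"
  by (simp add: chain_length_def)

lemma chain_length_mono: "i \<le> j \<Longrightarrow> chain_length z i \<le> chain_length z j"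
  unfolding chain_length_def by (intro sum_mono2) auto

lemma chain_length_nonneg [simp]: "0 \<le> chain_length z j"
  unfolding chain_length_def by (intro sum_nonneg) auto

lemma norm_le_chain_length: "cmod (z j - z 0) \<le> chain_length z j"
proof (induction j)
  case (Suc j)
  then show ?case using norm_triangle_ineq[of "z (Suc j) - z j" "z j - z 0"] by simp
qed simp

lemma chain_cont_subset:
  assumes "chain_cont u z K R f" "S \<le> R"
  shows "chain_cont u z K S f"
proof -
  have sub: "ball x S \<subseteq> ball x R" for x :: complex using assms(2) by (intro subset_ball)
  have "f j holomorphic_on ball (z j) S" if "j \<le> K" for j
    using assms(1) that holomorphic_on_subset[OF _ sub[of "z j"]] by (auto simp: chain_cont_def)
  then show ?thesis
    using assms unfolding chain_cont_def by auto
qed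

lemma chain_cont_const:
  assumes "chain_cont u z K R f" "j \<le> K" "\<And>i. i \<le> j \<Longrightarrow> z i = c" "w \<in> ball c R"
  shows "f j w = u w"
  using assms(2,3)
proof (induction j)
  case 0
  then show ?case using assms(1,4) by (auto simp: chain_cont_def)
next
  case (Suc j)
  then have "f j w = f (Suc j) w"
    using assms(1,4) unfolding chain_cont_def by (metis IntI Suc_le_lessD le_Suc_eq order_refl)
  then show ?case using Suc by simp
qed

text \<open>Monodromy for neighbouring chains: with steps and mutual distance small against
  \<open>R\<close>, the four discs at stages \<open>j\<close> and \<open>Suc j\<close> share a
  point, and the identity theorem carries agreement to the next stage.\<close>

lemma chain_cont_close:
  assumes f: "chain_cont u z K R f" and g: "chain_cont u z' K R g" and "R > 0" and "z 0 = z' 0"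
    and st: "\<And>j. j < K \<Longrightarrow> cmod (z (Suc j) - z j) \<le> R / 8"
    and st': "\<And>j. j < K \<Longrightarrow> cmod (z' (Suc j) - z' j) \<le> R / 8"
    and cl: "\<And>j. j \<le> K \<Longrightarrow> cmod (z' j - z j) \<le> R / 8"
    and "j \<le> K" "w \<in> ball (z j) R \<inter> ball (z' j) R"
  shows "f j w = g j w"
  using assms(8,9)
proof (induction j arbitrary: w)
  case 0
  then show ?case using f g \<open>z 0 = z' 0\<close> by (auto simp: chain_cont_def)
next
  case (Suc j)
  let ?U = "ball (z j) R \<inter> ball (z' j) R \<inter> ball (z (Suc j)) R \<inter> ball (z' (Suc j)) R"
  have j: "j < K" using Suc.prems by simp
  show ?case
  proof (rule holomorphic_agree_Int_balls[where U = ?U and f = "f (Suc j)" and g = "g (Suc j)"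
        and a = "z (Suc j)" and b = "z' (Suc j)" and R = R and S = R and x = w])
    show "f (Suc j) holomorphic_on ball (z (Suc j)) R" "g (Suc j) holomorphic_on ball (z' (Suc j)) R"
      using f g Suc.prems(1) by (auto simp: chain_cont_def)
    have "cmod (z' (Suc j) - z j) \<le> cmod (z' (Suc j) - z' j) + cmod (z' j - z j)"
      using norm_triangle_ineq[of "z' (Suc j) - z' j" "z' j - z j"] by simp
    then have "z j \<in> ?U"
      using st[OF j] st'[OF j] cl[of j] j \<open>R > 0\<close> by (auto simp: dist_norm)
    then show "?U \<noteq> {}" by blast
    show "f (Suc j) x = g (Suc j) x" if "x \<in> ?U" for x
    proof -
      have "f j x = f (Suc j) x" "g j x = g (Suc j) x"
        using f g that j unfolding chain_cont_def by auto
      then show ?thesis using Suc.IH[of x] that j by simp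
    qed
  qed (use Suc.prems in auto)
qed

lemma closed_segment_subset_ball:
  fixes a :: complex
  shows "a \<in> ball c R \<Longrightarrow> b \<in> ball c R \<Longrightarrow> closed_segment a b \<subseteq> ball c R"
  by (rule closed_segment_subset[OF _ _ convex_ball])

text \<open>
  The contour at stage \<open>j\<close> is the polygon \<open>Y 0 j = 0, Y 1 j, ..., Y j j = z j\<close>. Along it, \<open>p i j\<close> and
  \<open>q i j\<close> are the germs of \<open>\<phi>\<close> at \<open>X i j\<close> and of \<open>u\<close> at \<open>Y i j\<close>.
\<close>

locale convolution_contours =
  fixes z :: "nat \<Rightarrow> complex" and K :: nat and R :: real
    and X Y :: "nat \<Rightarrow> nat \<Rightarrow> complex"
    and \<phi> u :: "complex \<Rightarrow> complex"
    and p q :: "nat \<Rightarrow> nat \<Rightarrow> complex \<Rightarrow> complex"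
  assumes R: "R > 0" and z0: "z 0 = 0"
    and phi: "\<phi> holomorphic_on ball 0 (2 * R)"
    and XY: "\<And>i j. i \<le> K \<Longrightarrow> j \<le> K \<Longrightarrow> X i j + Y i j = z j"
    and X0: "\<And>i j. j \<le> i \<Longrightarrow> X i j = 0"
    and Y_Suc: "\<And>j. j < K \<Longrightarrow> Y j (Suc j) = z j"
    and Y0: "\<And>j. j \<le> K \<Longrightarrow> Y 0 j = 0"
    and p: "\<And>i. i \<le> K \<Longrightarrow> chain_cont \<phi> (X i) K (2 * R) (p i)"
    and q: "\<And>i. i \<le> K \<Longrightarrow> chain_cont u (Y i) K R (q i)"
    and stz: "\<And>j. j < K \<Longrightarrow> cmod (z (Suc j) - z j) \<le> R / 8"
    and stX: "\<And>i j. i \<le> K \<Longrightarrow> j < K \<Longrightarrow> cmod (X i (Suc j) - X i j) \<le> R / 8"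
    and stY: "\<And>i j. i \<le> K \<Longrightarrow> j < K \<Longrightarrow> cmod (Y i (Suc j) - Y i j) \<le> R / 8"
    and adj: "\<And>i j. i < K \<Longrightarrow> j \<le> K \<Longrightarrow> cmod (Y (Suc i) j - Y i j) \<le> R / 8"
begin

text \<open>After the polygon comes a last leg from \<open>z j\<close> to the moving point. There
  the argument of the first factor is near 0, so \<open>\<phi>\<close> itself is used.\<close>

definition h :: "nat \<Rightarrow> complex \<Rightarrow> complex" where
  "h j \<zeta> = (\<Sum>i<j. contour_integral (linepath (Y i j) (Y (Suc i) j)) (\<lambda>y. p i j (\<zeta> - y) * q i j y))
     + contour_integral (linepath (z j) \<zeta>) (\<lambda>y. \<phi> (\<zeta> - y) * q j j y)"

lemma Y_diag: "j \<le> K \<Longrightarrow> Y j j = z j"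
  using XY[of j j] X0[of j j] by simp

lemma q_hol: "i \<le> K \<Longrightarrow> j \<le> K \<Longrightarrow> q i j holomorphic_on ball (Y i j) R"
  using q by (simp add: chain_cont_def)

lemma p_hol: "i \<le> K \<Longrightarrow> j \<le> K \<Longrightarrow> p i j holomorphic_on ball (X i j) (2 * R)"
  using p by (simp add: chain_cont_def)

text \<open>The deviations of \<open>\<zeta>\<close> from \<open>z j\<close> and of \<open>y\<close>
  from \<open>Y i j\<close> add up, which is why the germs \<open>p\<close> need discs of radius
  \<open>2 * R\<close>.\<close>

lemma diff_in_ball:
  assumes "i \<le> K" "j \<le> K" "\<zeta> \<in> ball (z j) R" "y \<in> ball (Y i j) R"
  shows "\<zeta> - y \<in> ball (X i j) (2 * R)"
proof -
  have "X i j - (\<zeta> - y) = (z j - \<zeta>) + (y - Y i j)" using XY[OF assms(1,2)] by (simp add: algebra_simps)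
  then have "cmod (X i j - (\<zeta> - y)) \<le> cmod (z j - \<zeta>) + cmod (y - Y i j)"
    by (metis norm_triangle_ineq)
  then show ?thesis using assms by (auto simp: dist_norm norm_minus_commute)
qed

lemma G_hol:
  assumes "i \<le> K" "j \<le> K" "\<zeta> \<in> ball (z j) R"
  shows "(\<lambda>y. p i j (\<zeta> - y) * q i j y) holomorphic_on ball (Y i j) R"
proof (intro holomorphic_on_mult q_hol[OF assms(1,2)])
  show "(\<lambda>y. p i j (\<zeta> - y)) holomorphic_on ball (Y i j) R"
    by (rule holomorphic_on_compose_gen[OF _ p_hol[OF assms(1,2)], unfolded o_def])
       (use diff_in_ball[OF assms] in \<open>auto intro!: holomorphic_intros\<close>)
qed

lemma p_diag: "j \<le> K \<Longrightarrow> w \<in> ball 0 (2 * R) \<Longrightarrow> p j j w = \<phi> w"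
  by (rule chain_cont_const[OF p]) (use X0 in auto)

text \<open>The edges of the polygon are fixed, so they are differentiated under the integral. The
  last leg is, after translation by \<open>z j\<close>, a convolution of germs at the
  origin.\<close>

lemma h_holomorphic:
  assumes j: "j \<le> K"
  shows "h j holomorphic_on ball (z j) R"
  unfolding h_def
proof (intro holomorphic_on_add holomorphic_on_sum)
  fix i assume "i \<in> {..<j}"
  then have i: "i \<le> K" "i < K" using j by auto
  let ?s = "closed_segment (Y i j) (Y (Suc i) j)"
  have s: "?s \<subseteq> ball (Y i j) R"
    using R adj[OF i(2) j] by (intro closed_segment_subset_ball) (auto simp: dist_norm norm_minus_commute)
  have c: "continuous_on ?s (q i j)"
    using continuous_on_subset[OF holomorphic_on_imp_continuous_on[OF q_hol[OF i(1) j]] s] .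
  show "(\<lambda>\<zeta>. contour_integral (linepath (Y i j) (Y (Suc i) j)) (\<lambda>y. p i j (\<zeta> - y) * q i j y))
      holomorphic_on ball (z j) R"
    unfolding holomorphic_on_open[OF open_ball]
  proof (intro ballI exI)
    fix \<zeta> assume \<zeta>: "\<zeta> \<in> ball (z j) R"
    show "((\<lambda>\<zeta>. contour_integral (linepath (Y i j) (Y (Suc i) j)) (\<lambda>y. p i j (\<zeta> - y) * q i j y))
       has_field_derivative contour_integral (linepath (Y i j) (Y (Suc i) j))
         (\<lambda>y. deriv (p i j) (\<zeta> - y) * q i j y)) (at \<zeta>)"
      by (rule linepath_convolution_deriv[OF p_hol[OF i(1) j] c _ \<zeta>])
         (use diff_in_ball[OF i(1) j] s in blast)
  qed
next
  let ?q = "\<lambda>y. q j j (z j + y)"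
  have "?q holomorphic_on ball 0 R"
    by (rule holomorphic_on_compose_gen[OF _ q_hol[OF j j], unfolded o_def])
       (auto simp: Y_diag[OF j] dist_norm intro!: holomorphic_intros)
  moreover have "\<phi> holomorphic_on ball 0 R"
    using phi by (rule holomorphic_on_subset) (use R in auto)
  ultimately have conv: "conv \<phi> ?q holomorphic_on ball 0 R" by (intro conv_holomorphic)
  have "(\<lambda>\<zeta>. conv \<phi> ?q (\<zeta> - z j)) holomorphic_on ball (z j) R"
    by (rule holomorphic_on_compose_gen[OF _ conv, unfolded o_def])
       (auto simp: dist_norm norm_minus_commute intro!: holomorphic_intros)
  moreover have "contour_integral (linepath (z j) \<zeta>) (\<lambda>y. \<phi> (\<zeta> - y) * q j j y) = conv \<phi> ?q (\<zeta> - z j)" for \<zeta>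
    unfolding conv_def contour_integral_linepath_integral
    by (intro Henstock_Kurzweil_Integration.integral_cong) (simp add: linepath_def algebra_simps scaleR_conv_of_real)
  ultimately show "(\<lambda>\<zeta>. contour_integral (linepath (z j) \<zeta>) (\<lambda>y. \<phi> (\<zeta> - y) * q j j y))
      holomorphic_on ball (z j) R" by simp
qed

lemma p_step:
  assumes "i \<le> K" "j < K" "w \<in> ball (X i j) (2 * R)" "w \<in> ball (X i (Suc j)) (2 * R)"
  shows "p i j w = p i (Suc j) w"
  using p[OF assms(1)] assms(2-4) unfolding chain_cont_def by blast

lemma q_step:
  assumes "i \<le> K" "j < K" "w \<in> ball (Y i j) R" "w \<in> ball (Y i (Suc j)) R"
  shows "q i j w = q i (Suc j) w"
  using q[OF assms(1)] assms(2-4) unfolding chain_cont_def by blast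

lemma X_0_0: "X i 0 = 0" using X0 by simp

lemma Y_0_0: "i \<le> K \<Longrightarrow> Y i 0 = 0" using XY[of i 0] X_0_0[of i] z0 by simp

lemma adjX: "i < K \<Longrightarrow> j \<le> K \<Longrightarrow> cmod (X (Suc i) j - X i j) \<le> R / 8"
proof -
  assume "i < K" "j \<le> K"
  moreover from this have "X (Suc i) j - X i j = Y i j - Y (Suc i) j"
    using XY[of i j] XY[of "Suc i" j] by (simp add: algebra_simps)
  ultimately show ?thesis using adj[of i j] by (simp add: norm_minus_commute)
qed

text \<open>The chains of \<open>Y i\<close> and \<open>Y (Suc i)\<close> start together at 0 and
  stay close, so by monodromy their germs fit together along the contour edge between them.\<close>

lemma q_adj:
  assumes "i < K" "j \<le> K" "w \<in> ball (Y i j) R" "w \<in> ball (Y (Suc i) j) R"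
  shows "q i j w = q (Suc i) j w"
  by (rule chain_cont_close[OF q q])
     (use assms R Y_0_0 stY adj in \<open>auto simp: Suc_le_eq\<close>)

lemma p_adj:
  assumes "i < K" "j \<le> K" "w \<in> ball (X i j) (2 * R)" "w \<in> ball (X (Suc i) j) (2 * R)"
  shows "p i j w = p (Suc i) j w"
proof (rule chain_cont_close[OF p p])
  show "cmod (X i (Suc j) - X i j) \<le> 2 * R / 8" "cmod (X (Suc i) (Suc j) - X (Suc i) j) \<le> 2 * R / 8"
    if "j < K" for j
    using stX[of i j] stX[of "Suc i" j] that assms(1) R by auto
  show "cmod (X (Suc i) j - X i j) \<le> 2 * R / 8" if "j \<le> K" for j
    using adjX[of i j] that assms(1) R by auto
qed (use assms R X_0_0 in auto)

text \<open>The contour of stage \<open>j\<close> is deformed into that of stage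
  \<open>Suc j\<close>. Cauchy's theorem on each quadrilateral between consecutive contour points
  leaves differences of transversal integrals \<open>s i\<close>, which telescope.\<close>

lemma h_step:
  assumes j: "j < K" and \<zeta>: "\<zeta> \<in> ball (z j) R" "\<zeta> \<in> ball (z (Suc j)) R"
  shows "h j \<zeta> = h (Suc j) \<zeta>"
proof -
  let ?G = "\<lambda>i j y. p i j (\<zeta> - y) * q i j y"
  let ?I = "\<lambda>a b f. contour_integral (linepath a b) f"
  have jK: "j \<le> K" "Suc j \<le> K" using j by auto
  have sub: "?I a b f = ?I a b g"
    if eq: "\<And>y. y \<in> ball c R \<inter> ball d R \<Longrightarrow> f y = g y" and "a \<in> ball c R" "b \<in> ball c R" "a \<in> ball d R" "b \<in> ball d R"
    for a b c d :: complex and f g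
  proof (rule contour_integral_cong)
    have "closed_segment a b \<subseteq> ball c R \<inter> ball d R"
      using that by (simp add: closed_segment_subset_ball)
    then show "f y = g y" if "y \<in> path_image (linepath a b)" for y
      using that by (intro eq) auto
  qed simp
  have G_step: "?G i j y = ?G i (Suc j) y" if "i \<le> K" "y \<in> ball (Y i j) R \<inter> ball (Y i (Suc j)) R" for i y
    using p_step[OF that(1) j diff_in_ball[OF that(1) jK(1) \<zeta>(1)] diff_in_ball[OF that(1) jK(2) \<zeta>(2)], of y]
          q_step[OF that(1) j] that(2) by auto
  have G_adj: "?G i j y = ?G (Suc i) j y" if "i < K" "y \<in> ball (Y i j) R \<inter> ball (Y (Suc i) j) R" for i y
    using p_adj[OF that(1) jK(1) diff_in_ball[OF _ jK(1) \<zeta>(1)] diff_in_ball[OF _ jK(1) \<zeta>(1)], of y]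
          q_adj[OF that(1) jK(1)] that by auto
  have near: "Y i j \<in> ball (Y i j) R" "Y i (Suc j) \<in> ball (Y i j) R" "Y i j \<in> ball (Y i (Suc j)) R"
    "Y i (Suc j) \<in> ball (Y i (Suc j)) R" if "i \<le> K" for i
    using stY[OF that j] R by (auto simp: dist_norm norm_minus_commute)
  have near2: "Y (Suc i) j \<in> ball (Y i j) R" "Y i j \<in> ball (Y (Suc i) j) R"
      "Y (Suc i) (Suc j) \<in> ball (Y i (Suc j)) R" "Y (Suc i) (Suc j) \<in> ball (Y i j) R" if "i < K" for i
  proof -
    have "cmod (Y (Suc i) (Suc j) - Y i j) \<le> cmod (Y (Suc i) (Suc j) - Y i (Suc j)) + cmod (Y i (Suc j) - Y i j)"
      using norm_triangle_ineq[of "Y (Suc i) (Suc j) - Y i (Suc j)" "Y i (Suc j) - Y i j"] by simp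
    then show "Y (Suc i) j \<in> ball (Y i j) R" "Y i j \<in> ball (Y (Suc i) j) R"
      "Y (Suc i) (Suc j) \<in> ball (Y i (Suc j)) R" "Y (Suc i) (Suc j) \<in> ball (Y i j) R"
      using adj[OF that jK(1)] adj[OF that jK(2)] stY[of i j] j that R
      by (auto simp: dist_norm norm_minus_commute)
  qed
  define s where "s i = ?I (Y i j) (Y i (Suc j)) (?G i j)" for i
  have quad: "?I (Y i (Suc j)) (Y (Suc i) (Suc j)) (?G i (Suc j))
      = ?I (Y i j) (Y (Suc i) j) (?G i j) + (s (Suc i) - s i)" if i: "i < K" for i
  proof -
    have i': "i \<le> K" "Suc i \<le> K" using i by auto
    obtain P where P: "\<And>a b. a \<in> ball (Y i j) R \<Longrightarrow> b \<in> ball (Y i j) R \<Longrightarrow> ?I a b (?G i j) = P b - P a"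
      using linepath_primitive[OF G_hol[OF i'(1) jK(1) \<zeta>(1)] convex_ball open_ball] by blast
    have "?I (Y i (Suc j)) (Y (Suc i) (Suc j)) (?G i (Suc j)) = ?I (Y i (Suc j)) (Y (Suc i) (Suc j)) (?G i j)"
      by (rule sub[of "Y i j" "Y i (Suc j)"])
         (use G_step[OF i'(1)] near[OF i'(1)] near2[OF i] in auto)
    moreover have "s (Suc i) = ?I (Y (Suc i) j) (Y (Suc i) (Suc j)) (?G i j)"
      unfolding s_def by (rule sub[of "Y i j" "Y (Suc i) j"])
         (use G_adj[OF i] near[OF i'(2)] near2[OF i] in auto)
    ultimately show ?thesis
      using near[OF i'(1)] near2[OF i] by (simp add: P s_def)
  qed
  \<comment> \<open>Both ends stay put: \<open>Y 0\<close> rests at 0, and the point born at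
    \<open>z j\<close> still rests there at stage \<open>Suc j\<close>.\<close>
  have s0: "s 0 = 0" "s j = 0"
    using j Y0[of j] Y0[of "Suc j"] Y_diag[of j] Y_Suc[OF j] by (auto simp: s_def)
  have "(\<Sum>i<j. ?I (Y i (Suc j)) (Y (Suc i) (Suc j)) (?G i (Suc j)))
      = (\<Sum>i<j. ?I (Y i j) (Y (Suc i) j) (?G i j) + (s (Suc i) - s i))"
    using quad j by (intro sum.cong refl) auto
  also have "\<dots> = (\<Sum>i<j. ?I (Y i j) (Y (Suc i) j) (?G i j))"
    by (simp add: sum.distrib sum_lessThan_telescope s0)
  finally have 1: "(\<Sum>i<j. ?I (Y i (Suc j)) (Y (Suc i) (Suc j)) (?G i (Suc j)))
      = (\<Sum>i<j. ?I (Y i j) (Y (Suc i) j) (?G i j))" .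
  \<comment> \<open>The edge that is new at stage \<open>Suc j\<close> runs from \<open>z j\<close>
    to \<open>z (Suc j)\<close>. Joined with the new last leg it replaces the old last leg.\<close>
  have 2: "?I (Y j (Suc j)) (Y (Suc j) (Suc j)) (?G j (Suc j)) = ?I (z j) (z (Suc j)) (?G j j)"
  proof -
    have "?I (Y j (Suc j)) (Y (Suc j) (Suc j)) (?G j (Suc j)) = ?I (Y j (Suc j)) (Y (Suc j) (Suc j)) (?G j j)"
      by (rule sub[of "Y j j" "Y j (Suc j)"])
         (use G_step[OF jK(1)] near[OF jK(1)] near2[OF j] in auto)
    then show ?thesis using Y_diag[OF jK(2)] Y_Suc[OF j] by simp
  qed
  have pd: "\<phi> (\<zeta> - y) = p m m (\<zeta> - y)" if "m \<le> K" "\<zeta> \<in> ball (z m) R" "y \<in> ball (z m) R" for m y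
    using p_diag[OF that(1), of "\<zeta> - y"] diff_in_ball[OF that(1,1,2), of y] Y_diag[OF that(1)] X0[of m m] that
    by simp
  have z_near: "z j \<in> ball (z (Suc j)) R" "z (Suc j) \<in> ball (z j) R" "z j \<in> ball (z j) R" "z (Suc j) \<in> ball (z (Suc j)) R"
    using stz[OF j] R by (auto simp: dist_norm norm_minus_commute)
  have 3: "?I (z (Suc j)) \<zeta> (\<lambda>y. \<phi> (\<zeta> - y) * q (Suc j) (Suc j) y) = ?I (z (Suc j)) \<zeta> (?G j j)"
  proof (rule sub[of "z (Suc j)" "z j"])
    fix y assume y: "y \<in> ball (z (Suc j)) R \<inter> ball (z j) R"
    have "q j j y = q j (Suc j) y"
      using q_step[OF jK(1) j, of y] y Y_diag[OF jK(1)] Y_Suc[OF j] by simp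
    also have "\<dots> = q (Suc j) (Suc j) y"
      using q_adj[OF j jK(2), of y] y Y_diag[OF jK(2)] Y_Suc[OF j] by simp
    finally show "\<phi> (\<zeta> - y) * q (Suc j) (Suc j) y = ?G j j y"
      using pd[OF jK(1) \<zeta>(1)] y by simp
  qed (use z_near \<zeta> in auto)
  have 4: "?I (z j) \<zeta> (\<lambda>y. \<phi> (\<zeta> - y) * q j j y) = ?I (z j) \<zeta> (?G j j)"
    by (rule sub[of "z j" "z j"]) (use pd[OF jK(1) \<zeta>(1)] z_near \<zeta> in auto)
  obtain P where P: "\<And>a b. a \<in> ball (z j) R \<Longrightarrow> b \<in> ball (z j) R \<Longrightarrow> ?I a b (?G j j) = P b - P a"
    using linepath_primitive[OF G_hol[OF jK(1) jK(1) \<zeta>(1)] convex_ball open_ball] Y_diag[OF jK(1)] by metis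
  show ?thesis
    unfolding h_def sum.lessThan_Suc 1 2 3 4 using z_near \<zeta> by (simp add: P)
qed

theorem chain_cont_conv: "chain_cont (conv \<phi> u) z K R h"
  unfolding chain_cont_def
proof (intro conjI allI impI ballI)
  show "h j holomorphic_on ball (z j) R" if "j \<le> K" for j using h_holomorphic[OF that] .
  show "h j w = h (Suc j) w" if "j < K" "w \<in> ball (z j) R \<inter> ball (z (Suc j)) R" for j w
    using h_step that by auto
  show "h 0 w = conv \<phi> u w" if "w \<in> ball (z 0) R" for w
  proof -
    have "closed_segment 0 w \<subseteq> ball 0 R" using that R z0 by (intro closed_segment_subset_ball) auto
    moreover have "q 0 0 y = u y" if "y \<in> ball 0 R" for y
      using q[of 0] Y0[of 0] that by (simp add: chain_cont_def)
    ultimately show ?thesis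
      unfolding h_def conv_def by (auto simp: z0 intro!: contour_integral_cong)
  qed
qed

text \<open>\<open>B\<close> depends only on the birth index, so the estimate at stage
  \<open>j\<close> is a discrete Volterra inequality. Only the last leg, of length at most
  \<open>R\<close>, involves \<open>B j\<close>.\<close>

lemma h_bound:
  assumes j: "j \<le> K" and \<zeta>: "\<zeta> \<in> ball (z j) R" and "A \<ge> 0" "A0 \<ge> 0" "\<And>i. B i \<ge> 0"
    and pA: "\<And>i w. i \<le> j \<Longrightarrow> w \<in> ball (X i j) (2 * R) \<Longrightarrow> cmod (p i j w) \<le> A"
    and phiA: "\<And>w. w \<in> ball 0 (2 * R) \<Longrightarrow> cmod (\<phi> w) \<le> A0"
    and qB: "\<And>i w. i \<le> j \<Longrightarrow> w \<in> ball (Y i j) R \<Longrightarrow> cmod (q i j w) \<le> B i"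
  shows "cmod (h j \<zeta>) \<le> (\<Sum>i<j. A * B i * cmod (Y (Suc i) j - Y i j)) + A0 * B j * R"
proof -
  have "cmod (contour_integral (linepath (Y i j) (Y (Suc i) j)) (\<lambda>y. p i j (\<zeta> - y) * q i j y))
      \<le> A * B i * cmod (Y (Suc i) j - Y i j)" if "i < j" for i
  proof (rule linepath_integral_bound)
    have i: "i \<le> K" "i < K" using that j by auto
    show "(\<lambda>y. p i j (\<zeta> - y) * q i j y) holomorphic_on ball (Y i j) R"
      using G_hol[OF i(1) j \<zeta>] .
    show in_b: "Y i j \<in> ball (Y i j) R" "Y (Suc i) j \<in> ball (Y i j) R"
      using adj[OF i(2) j] R by (auto simp: dist_norm norm_minus_commute)
    fix y assume "y \<in> closed_segment (Y i j) (Y (Suc i) j)"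
    then have y: "y \<in> ball (Y i j) R" using closed_segment_subset_ball[OF in_b] by blast
    show "cmod (p i j (\<zeta> - y) * q i j y) \<le> A * B i"
      unfolding norm_mult using pA[of i "\<zeta> - y"] qB[of i y] diff_in_ball[OF i(1) j \<zeta> y] y that assms(3)
      by (intro mult_mono) auto
  qed (use assms in auto)
  moreover have "cmod (contour_integral (linepath (z j) \<zeta>) (\<lambda>y. \<phi> (\<zeta> - y) * q j j y)) \<le> A0 * B j * cmod (\<zeta> - z j)"
  proof (rule linepath_integral_bound)
    have sub: "\<zeta> - y \<in> ball 0 (2 * R)" if "y \<in> ball (z j) R" for y
      using diff_in_ball[OF j j \<zeta>, of y] that Y_diag[OF j] X0[of j j] by simp
    have "(\<lambda>y. \<phi> (\<zeta> - y)) holomorphic_on ball (z j) R"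
      by (rule holomorphic_on_compose_gen[OF _ phi, unfolded o_def])
         (use sub in \<open>auto intro!: holomorphic_intros\<close>)
    then show "(\<lambda>y. \<phi> (\<zeta> - y) * q j j y) holomorphic_on ball (z j) R"
      using q_hol[OF j j] Y_diag[OF j] by (intro holomorphic_on_mult) auto
    show in_b: "z j \<in> ball (z j) R" "\<zeta> \<in> ball (z j) R" using R \<zeta> by auto
    fix y assume "y \<in> closed_segment (z j) \<zeta>"
    then have y: "y \<in> ball (z j) R" using closed_segment_subset_ball[OF in_b] by blast
    show "cmod (\<phi> (\<zeta> - y) * q j j y) \<le> A0 * B j"
      unfolding norm_mult using phiA[OF sub[OF y]] qB[of j y] y Y_diag[OF j] assms(4)
      by (intro mult_mono) auto
  qed (use assms in auto)
  moreover have "A0 * B j * cmod (\<zeta> - z j) \<le> A0 * B j * R"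
    using \<zeta> assms(4,5) by (intro mult_left_mono) (auto simp: dist_norm norm_minus_commute)
  ultimately show ?thesis
    unfolding h_def
    by (intro order_trans[OF norm_triangle_ineq] add_mono order_trans[OF norm_sum] sum_mono) auto
qed

end

section \<open>The flow that moves the contours\<close>

text \<open>The chain starts at 0, which belongs to the singular sets considered, so distance from
  them can be demanded only after length \<open>\<rho>\<close>. Before that the chain stays within
  \<open>\<rho>\<close> of the origin.\<close>

definition clear_chain :: "complex set \<Rightarrow> real \<Rightarrow> real \<Rightarrow> (nat \<Rightarrow> complex) \<Rightarrow> nat \<Rightarrow> bool" where
  "clear_chain F \<rho> \<delta> z K \<longleftrightarrow>
     z 0 = 0 \<and> (\<forall>j\<le>K. \<rho> \<le> chain_length z j \<longrightarrow> (\<forall>w\<in>F. \<delta> \<le> cmod (z j - w)))"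

lemma clear_chain_mono:
  assumes "clear_chain F \<rho> \<delta> z K" "F' \<subseteq> F" "\<rho> \<le> \<rho>'" "\<delta>' \<le> \<delta>"
  shows "clear_chain F' \<rho>' \<delta>' z K"
  using assms unfolding clear_chain_def by (meson order_trans subsetD)

text \<open>
  The fraction of the next displacement that goes to \<open>Y\<close>, given the length \<open>fst ax\<close> travelled by \<open>X\<close> and
  its position \<open>snd ax\<close>. Lipschitz continuity keeps neighbouring contour points close to each other.
\<close>
definition hold :: "complex set \<Rightarrow> real \<Rightarrow> real \<Rightarrow> real \<times> complex \<Rightarrow> real" where
  "hold F \<rho> \<delta> ax = max 0 (min 1 (min (2 * (fst ax - \<rho>) / \<rho>) (2 - 3 * infdist (snd ax) F / \<delta>)))"

lemma hold_nonneg: "0 \<le> hold F \<rho> \<delta> ax" and hold_le_1: "hold F \<rho> \<delta> ax \<le> 1"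
  by (simp_all add: hold_def)

lemma hold_pos:
  assumes "\<rho> > 0" "\<delta> > 0" "hold F \<rho> \<delta> (a, x) > 0"
  shows "a > \<rho>" "infdist x F < 2 * \<delta> / 3"
proof -
  have "2 * (a - \<rho>) / \<rho> > 0" "2 - 3 * infdist x F / \<delta> > 0"
    using assms(3) by (auto simp: hold_def split: if_splits)
  then show "a > \<rho>" "infdist x F < 2 * \<delta> / 3"
    using assms(1,2) by (auto simp: field_simps zero_less_divide_iff)
qed

text \<open>From length \<open>3 * \<rho> / 2\<close> on, the ramp in the length is saturated, so a
  value below 1 must come from the ramp in the distance, which reaches 1 at
  \<open>\<delta> / 3\<close>.\<close>

lemma hold_less_1:
  assumes "\<rho> > 0" "\<delta> > 0" "hold F \<rho> \<delta> (a, x) < 1" "a \<ge> 3 * \<rho> / 2"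
  shows "infdist x F > \<delta> / 3"
proof (rule ccontr)
  assume "\<not> infdist x F > \<delta> / 3"
  then have "2 - 3 * infdist x F / \<delta> \<ge> 1" "2 * (a - \<rho>) / \<rho> \<ge> 1"
    using assms by (auto simp: field_simps)
  then show False using assms(3) by (auto simp: hold_def)
qed

lemma hold_small: "\<rho> > 0 \<Longrightarrow> a \<le> \<rho> \<Longrightarrow> hold F \<rho> \<delta> (a, x) = 0"
proof -
  assume "\<rho> > 0" "a \<le> \<rho>"
  then have "2 * (a - \<rho>) / \<rho> \<le> 0" by (intro divide_nonpos_pos) auto
  then show ?thesis unfolding hold_def fst_conv by linarith
qed

lemma clamp_diff_le: "\<bar>max 0 (min 1 (min s t)) - max 0 (min 1 (min s' t'))\<bar> \<le> \<bar>s - s'\<bar> + \<bar>t - t'\<bar>"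
  for s :: real
  by (auto simp: max_def min_def abs_if)

lemma hold_lipschitz:
  assumes "\<rho> > 0" "\<delta> > 0"
  shows "\<bar>hold F \<rho> \<delta> (a, x) - hold F \<rho> \<delta> (a', x')\<bar> \<le> (2 / \<rho> + 3 / \<delta>) * (cmod (x - x') + \<bar>a - a'\<bar>)"
proof -
  have "\<bar>hold F \<rho> \<delta> (a, x) - hold F \<rho> \<delta> (a', x')\<bar>
     \<le> \<bar>2 * (a - \<rho>) / \<rho> - 2 * (a' - \<rho>) / \<rho>\<bar> + \<bar>(2 - 3 * infdist x F / \<delta>) - (2 - 3 * infdist x' F / \<delta>)\<bar>"
    unfolding hold_def fst_conv snd_conv by (rule clamp_diff_le)
  also have "2 * (a - \<rho>) / \<rho> - 2 * (a' - \<rho>) / \<rho> = 2 / \<rho> * (a - a')"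
    using assms by (simp add: field_simps)
  also have "(2 - 3 * infdist x F / \<delta>) - (2 - 3 * infdist x' F / \<delta>) = 3 / \<delta> * (infdist x' F - infdist x F)"
    using assms by (simp add: field_simps)
  also have "\<bar>2 / \<rho> * (a - a')\<bar> + \<bar>3 / \<delta> * (infdist x' F - infdist x F)\<bar>
     \<le> 2 / \<rho> * \<bar>a - a'\<bar> + 3 / \<delta> * cmod (x - x')"
  proof -
    have "\<bar>infdist x' F - infdist x F\<bar> \<le> cmod (x - x')"
      using infdist_triangle_abs[of x' F x] by (simp add: dist_norm norm_minus_commute)
    then have "3 / \<delta> * \<bar>infdist x' F - infdist x F\<bar> \<le> 3 / \<delta> * cmod (x - x')"
      using assms by (intro mult_left_mono) auto
    moreover have "\<bar>2 / \<rho> * (a - a')\<bar> = 2 / \<rho> * \<bar>a - a'\<bar>"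
      "\<bar>3 / \<delta> * (infdist x' F - infdist x F)\<bar> = 3 / \<delta> * \<bar>infdist x' F - infdist x F\<bar>"
      using assms by (simp_all only: abs_mult) simp_all
    ultimately show ?thesis by linarith
  qed
  also have "\<dots> \<le> (2 / \<rho> + 3 / \<delta>) * (cmod (x - x') + \<bar>a - a'\<bar>)"
    using assms by (simp add: algebra_simps)
  finally show ?thesis .
qed

text \<open>An explicit Euler scheme for \<open>X i\<close>. Length and position are carried
  together because \<open>hold\<close> depends on both; before its birth at stage \<open>i\<close>
  the point rests at 0.\<close>

primrec flow :: "complex set \<Rightarrow> real \<Rightarrow> real \<Rightarrow> (nat \<Rightarrow> complex) \<Rightarrow> nat \<Rightarrow> nat \<Rightarrow> real \<times> complex" where
  "flow F \<rho> \<delta> z i 0 = (0, 0)"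
| "flow F \<rho> \<delta> z i (Suc j) =
     (if j < i then (0, 0)
      else (fst (flow F \<rho> \<delta> z i j) + (1 - hold F \<rho> \<delta> (flow F \<rho> \<delta> z i j)) * cmod (z (Suc j) - z j),
            snd (flow F \<rho> \<delta> z i j) + (1 - hold F \<rho> \<delta> (flow F \<rho> \<delta> z i j)) *\<^sub>R (z (Suc j) - z j)))"

text \<open>In the application \<open>\<Omega>\<close> is the sumset of the previous induction
  stage. The bounds on \<open>\<sigma>\<close> are the margins one step may use up:
  \<open>\<rho> / 2\<close> from \<open>2 * \<rho>\<close> down to \<open>3 * \<rho> / 2\<close>,
  and \<open>\<delta> / 12\<close> from \<open>\<delta> / 3\<close> down to
  \<open>\<delta> / 4\<close>.\<close>

locale contour_flow =
  fixes F \<Omega> :: "complex set" and \<rho> \<delta> \<sigma> :: real and z :: "nat \<Rightarrow> complex" and K :: nat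
  assumes \<rho>: "\<rho> > 0" and \<delta>: "\<delta> > 0" and F: "finite F" "0 \<in> F" and \<Omega>: "0 \<in> \<Omega>"
    and clear: "clear_chain {f + w |f w. f \<in> F \<and> w \<in> \<Omega>} \<rho> \<delta> z K"
    and step: "\<And>j. j < K \<Longrightarrow> cmod (z (Suc j) - z j) \<le> \<sigma>"
    and \<sigma>: "\<sigma> \<le> \<rho> / 2" "\<sigma> \<le> \<delta> / 12"
begin

definition X :: "nat \<Rightarrow> nat \<Rightarrow> complex" where "X i j = snd (flow F \<rho> \<delta> z i j)"
definition Y :: "nat \<Rightarrow> nat \<Rightarrow> complex" where "Y i j = z j - X i j"
definition \<psi> :: "nat \<Rightarrow> nat \<Rightarrow> real" where "\<psi> i j = hold F \<rho> \<delta> (chain_length (X i) j, X i j)"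

lemma z_0: "z 0 = 0" using clear by (simp add: clear_chain_def)

lemma psi_nonneg: "0 \<le> \<psi> i j" and psi_le_1: "\<psi> i j \<le> 1"
  by (simp_all add: \<psi>_def hold_nonneg hold_le_1)

lemma fst_flow: "fst (flow F \<rho> \<delta> z i j) = chain_length (X i) j"
proof (induction j)
  case (Suc j)
  show ?case
  proof (cases "j < i")
    case True
    have zero: "X i m = 0" if "m \<le> Suc j" for m
      using that True by (cases m) (auto simp: X_def)
    have "chain_length (X i) (Suc j) = 0"
      unfolding chain_length_def by (intro sum.neutral) (auto simp: zero)
    then show ?thesis using True by simp
  next
    case False
    then have "X i (Suc j) - X i j = (1 - hold F \<rho> \<delta> (flow F \<rho> \<delta> z i j)) *\<^sub>R (z (Suc j) - z j)"
      by (simp add: X_def)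
    then show ?thesis using False Suc hold_le_1[of F \<rho> \<delta> "flow F \<rho> \<delta> z i j"] by simp
  qed
qed simp

lemma flow_eq: "flow F \<rho> \<delta> z i j = (chain_length (X i) j, X i j)"
  by (metis X_def fst_flow prod.collapse)

lemma X_le: "j \<le> i \<Longrightarrow> X i j = 0"
  by (cases j) (auto simp: X_def)

lemma X_Suc: "i \<le> j \<Longrightarrow> X i (Suc j) = X i j + (1 - \<psi> i j) *\<^sub>R (z (Suc j) - z j)"
  using flow_eq[of i j] by (simp add: X_def \<psi>_def)

lemma Y_le: "j \<le> i \<Longrightarrow> Y i j = z j"
  by (simp add: Y_def X_le)

lemma Y_Suc: "i \<le> j \<Longrightarrow> Y i (Suc j) = Y i j + \<psi> i j *\<^sub>R (z (Suc j) - z j)"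
  by (simp add: Y_def X_Suc algebra_simps)

lemma length_X_le: "j \<le> i \<Longrightarrow> chain_length (X i) j = 0"
  unfolding chain_length_def by (intro sum.neutral) (auto simp: X_le)

lemma psi_birth: "\<psi> i i = 0"
  using \<rho> by (simp add: \<psi>_def length_X_le hold_small)

lemma Y_diag_Suc: "Y i (Suc i) = z i"
  using Y_Suc[of i i] by (simp add: psi_birth Y_le)

text \<open>Each displacement is split into two nonnegative multiples of itself, so no length is
  created or lost. The induction on the length depends on this.\<close>

lemma length_X_plus_Y: "chain_length (X i) j + chain_length (Y i) j = chain_length z j"
proof (induction j)
  case (Suc j)
  show ?case
  proof (cases "j < i")
    case True
    then show ?thesis using Suc by (simp add: X_le Y_le)
  next
    case False
    then have "X i (Suc j) - X i j = (1 - \<psi> i j) *\<^sub>R (z (Suc j) - z j)"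
      "Y i (Suc j) - Y i j = \<psi> i j *\<^sub>R (z (Suc j) - z j)"
      by (simp_all add: X_Suc Y_Suc)
    then have "cmod (X i (Suc j) - X i j) + cmod (Y i (Suc j) - Y i j) = cmod (z (Suc j) - z j)"
      using psi_nonneg[of i j] psi_le_1[of i j] by (simp only: norm_scaleR) (simp add: algebra_simps)
    then show ?thesis using Suc by simp
  qed
qed simp

lemma step_X: "j < K \<Longrightarrow> cmod (X i (Suc j) - X i j) \<le> \<sigma>"
  and step_Y: "j < K \<Longrightarrow> cmod (Y i (Suc j) - Y i j) \<le> \<sigma>"
proof -
  assume j: "j < K"
  have "cmod (X i (Suc j) - X i j) + cmod (Y i (Suc j) - Y i j) = cmod (z (Suc j) - z j)"
    using length_X_plus_Y[of i j] length_X_plus_Y[of i "Suc j"] by simp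
  then show "cmod (X i (Suc j) - X i j) \<le> \<sigma>" "cmod (Y i (Suc j) - Y i j) \<le> \<sigma>"
    using step[OF j] norm_ge_zero[of "X i (Suc j) - X i j"] norm_ge_zero[of "Y i (Suc j) - Y i j"] by linarith+
qed

text \<open>If \<open>Y i\<close> is about to move, \<open>X i\<close> is near some \<open>f\<close>
  in \<open>F\<close>. Since \<open>z j\<close> keeps distance \<open>\<delta>\<close> from
  \<open>f + w\<close>, the remaining part \<open>Y i j - w\<close> cannot be small.\<close>

lemma psi_pos:
  assumes "\<psi> i j > 0" "j \<le> K"
  shows "chain_length (X i) j > \<rho>" "\<And>w. w \<in> \<Omega> \<Longrightarrow> \<delta> / 3 < cmod (Y i j - w)"
proof -
  show len: "chain_length (X i) j > \<rho>"
    using hold_pos(1)[OF \<rho> \<delta>] assms(1) by (simp add: \<psi>_def)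
  have "infdist (X i j) F < 2 * \<delta> / 3"
    using hold_pos(2)[OF \<rho> \<delta>] assms(1) by (simp add: \<psi>_def)
  moreover obtain f where f: "f \<in> F" "infdist (X i j) F = dist (X i j) f"
    using infdist_attains_inf[of F "X i j"] F finite_imp_closed by blast
  ultimately have Xf: "cmod (X i j - f) < 2 * \<delta> / 3" by (simp add: dist_norm)
  fix w assume w: "w \<in> \<Omega>"
  have "chain_length z j \<ge> \<rho>" using len length_X_plus_Y[of i j] chain_length_nonneg[of "Y i" j] by linarith
  then have "\<delta> \<le> cmod (z j - (f + w))"
    using clear assms(2) f w unfolding clear_chain_def by blast
  also have "z j - (f + w) = (X i j - f) + (Y i j - w)" by (simp add: Y_def)
  also have "cmod \<dots> \<le> cmod (X i j - f) + cmod (Y i j - w)" by (rule norm_triangle_ineq)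
  finally show "\<delta> / 3 < cmod (Y i j - w)" using Xf by linarith
qed

text \<open>A fully held \<open>X i\<close> keeps its position and length, so the induction
  hypothesis applies. Otherwise it was farther than \<open>\<delta> / 3\<close> from
  \<open>F\<close> before the step, and a step costs at most \<open>\<delta> / 12\<close>.\<close>

lemma clear_X: "clear_chain F (2 * \<rho>) (\<delta> / 4) (X i) K"
proof -
  have "infdist (X i j) F \<ge> \<delta> / 4" if "j \<le> K" "2 * \<rho> \<le> chain_length (X i) j" for j
    using that
  proof (induction j)
    case 0
    then show ?case using \<rho> by simp
  next
    case (Suc j)
    have j: "i \<le> j"
      using Suc.prems(2) length_X_le[of "Suc j" i] \<rho> by (cases "i \<le> j") auto
    show ?case
    proof (cases "\<psi> i j = 1")
      case True
      then show ?thesis using Suc j by (simp add: X_Suc)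
    next
      case False
      have "chain_length (X i) j \<ge> 3 * \<rho> / 2"
        using Suc.prems step_X[of j i] \<sigma>(1) by simp
      then have "infdist (X i j) F > \<delta> / 3"
        using hold_less_1[OF \<rho> \<delta>] False psi_le_1[of i j] by (force simp: \<psi>_def)
      moreover have "\<bar>infdist (X i j) F - infdist (X i (Suc j)) F\<bar> \<le> \<sigma>"
        using infdist_triangle_abs[of "X i j" F "X i (Suc j)"] step_X[of j i] Suc.prems(1)
        by (simp add: dist_norm norm_minus_commute)
      ultimately show ?thesis using \<sigma>(2) by linarith
    qed
  qed
  moreover have "infdist (X i j) F \<le> cmod (X i j - w)" if "w \<in> F" for j w
    using infdist_le[OF that, of "X i j"] by (simp add: dist_norm)
  ultimately show ?thesis
    unfolding clear_chain_def using X_le[of 0 i] by (meson le0 order_trans)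
qed

text \<open>\<open>Y i\<close> is released only after \<open>X i\<close> has travelled more than
  \<open>\<rho>\<close>. By this amount a moved \<open>Y i\<close> is shorter than
  \<open>z\<close>.\<close>

lemma unmoved_or_long:
  assumes "j \<le> K"
  shows "(\<forall>m\<le>j. Y i m = z (min i m)) \<or> chain_length (X i) j > \<rho>"
  using assms
proof (induction j)
  case 0
  then show ?case by (simp add: Y_le)
next
  case (Suc j)
  show ?case
  proof (cases "chain_length (X i) (Suc j) > \<rho>")
    case False
    have mono: "chain_length (X i) j \<le> chain_length (X i) (Suc j)" by (rule chain_length_mono) simp
    then have "\<not> chain_length (X i) j > \<rho>" using False by linarith
    then have IH: "\<forall>m\<le>j. Y i m = z (min i m)" using Suc by simp
    have "Y i (Suc j) = z (min i (Suc j))"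
    proof (cases "i \<le> j")
      case True
      have "\<psi> i j = 0"
        using psi_pos(1)[of i j] Suc.prems False mono psi_nonneg[of i j] by force
      then show ?thesis using True IH by (simp add: Y_Suc min_def)
    next
      case False
      then have "min i (Suc j) = Suc j" by simp
      then show ?thesis using False by (simp add: Y_le)
    qed
    then show ?thesis using IH by (auto simp: le_Suc_eq)
  qed auto
qed

text \<open>Either \<open>Y i\<close> sits on a vertex of \<open>z\<close>, with the length that
  \<open>z\<close> had there, and inherits its clearance because \<open>0 \<in> F\<close>; or its
  last move left it at least \<open>\<delta> / 4\<close> away from \<open>\<Omega>\<close>.\<close>

lemma clear_Y: "clear_chain \<Omega> \<rho> (\<delta> / 4) (Y i) K"
proof -
  have "(Y i j = z (min i j) \<and> chain_length (Y i) j = chain_length z (min i j)) \<or>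
        (\<forall>w\<in>\<Omega>. \<delta> / 4 \<le> cmod (Y i j - w))" if "j \<le> K" for j
    using that
  proof (induction j)
    case 0
    then show ?case by (simp add: Y_le)
  next
    case (Suc j)
    show ?case
    proof (cases "i \<le> j")
      case i: True
      show ?thesis
      proof (cases "\<psi> i j > 0")
        case True
        have "\<delta> / 4 \<le> cmod (Y i (Suc j) - w)" if "w \<in> \<Omega>" for w
        proof -
          have "cmod (Y i j - w) \<le> cmod (Y i j - Y i (Suc j)) + cmod (Y i (Suc j) - w)"
            using norm_triangle_ineq[of "Y i j - Y i (Suc j)" "Y i (Suc j) - w"] by simp
          then show ?thesis
            using psi_pos(2)[OF True _ that] step_Y[of j i] Suc.prems \<sigma>(2) by (simp add: norm_minus_commute)
        qed
        then show ?thesis by blast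
      next
        case False
        then have "\<psi> i j = 0" using psi_nonneg[of i j] by linarith
        then show ?thesis using Suc i by (simp add: Y_Suc min_def)
      qed
    next
      case False
      then have "chain_length (Y i) (Suc j) = chain_length z (Suc j)"
        using length_X_plus_Y[of i "Suc j"] length_X_le[of "Suc j" i] False by simp
      moreover have "min i (Suc j) = Suc j" using False by simp
      ultimately show ?thesis using False by (simp add: Y_le)
    qed
  qed
  moreover have "\<delta> / 4 \<le> cmod (z j - w)" if "j \<le> K" "\<rho> \<le> chain_length z j" "w \<in> \<Omega>" for j w
  proof -
    have "w \<in> {f + w |f w. f \<in> F \<and> w \<in> \<Omega>}" using F(2) that(3) by force
    then have "\<delta> \<le> cmod (z j - w)" using clear that unfolding clear_chain_def by blast
    then show ?thesis using \<delta> by linarith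
  qed
  ultimately show ?thesis
    unfolding clear_chain_def using Y_le[of 0 i] z_0 by (metis le0 min.coboundedI2)
qed

text \<open>Since \<open>0 \<in> \<Omega>\<close>, a contour point at 0 cannot be released: by
  \<open>psi_pos\<close> it would have to be farther than \<open>\<delta> / 3\<close> from 0. Thus
  the contour keeps its endpoint 0.\<close>

lemma Y_0: "j \<le> K \<Longrightarrow> Y 0 j = 0"
proof (induction j)
  case (Suc j)
  have "\<psi> 0 j = 0"
    using psi_pos(2)[of 0 j 0] Suc \<Omega> \<delta> psi_nonneg[of 0 j] by force
  then show ?case using Suc by (simp add: Y_Suc)
qed (simp add: Y_le z_0)

text \<open>A discrete Gronwall estimate, for position and length jointly since \<open>hold\<close>
  is Lipschitz in the pair; the two contributions give the outer 2 in the exponent. When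
  \<open>Suc i\<close> is born, \<open>X i\<close> has made one full step, which counts once in
  position and once in length.\<close>

lemma flow_spacing:
  assumes "Suc i \<le> j"
  shows "cmod (X i j - X (Suc i) j) + \<bar>chain_length (X i) j - chain_length (X (Suc i)) j\<bar>
    \<le> 2 * cmod (z (Suc i) - z i) * exp (2 * (2 / \<rho> + 3 / \<delta>) * (chain_length z j - chain_length z (Suc i)))"
  using assms
proof (induction j rule: dec_induct)
  case base
  have "X i (Suc i) = z (Suc i) - z i" using X_Suc[of i i] by (simp add: psi_birth X_le)
  then show ?case by (simp add: X_le length_X_le)
next
  case (step j)
  define \<kappa> where "\<kappa> = 2 / \<rho> + 3 / \<delta>"
  have "\<kappa> \<ge> 0" using \<rho> \<delta> by (simp add: \<kappa>_def)
  let ?d = "z (Suc j) - z j"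
  let ?D = "cmod (X i j - X (Suc i) j) + \<bar>chain_length (X i) j - chain_length (X (Suc i)) j\<bar>"
  have ij: "i \<le> j" "Suc i \<le> j" using step by auto
  have psi: "\<bar>\<psi> (Suc i) j - \<psi> i j\<bar> \<le> \<kappa> * ?D"
    using hold_lipschitz[OF \<rho> \<delta>, of F "chain_length (X i) j" "X i j" "chain_length (X (Suc i)) j" "X (Suc i) j"]
    unfolding \<psi>_def \<kappa>_def by (simp add: abs_minus_commute)
  have "X i (Suc j) - X (Suc i) (Suc j) = (X i j - X (Suc i) j) + (\<psi> (Suc i) j - \<psi> i j) *\<^sub>R ?d"
    by (simp add: X_Suc[OF ij(1)] X_Suc[OF ij(2)] algebra_simps)
  then have 1: "cmod (X i (Suc j) - X (Suc i) (Suc j)) \<le> cmod (X i j - X (Suc i) j) + \<bar>\<psi> (Suc i) j - \<psi> i j\<bar> * cmod ?d"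
    by (metis norm_scaleR norm_triangle_ineq)
  have cl: "chain_length (X i') (Suc j) = chain_length (X i') j + (1 - \<psi> i' j) * cmod ?d" if "i' \<le> j" for i'
    using X_Suc[OF that] psi_le_1[of i' j] by simp
  have "chain_length (X i) (Suc j) - chain_length (X (Suc i)) (Suc j)
      = (chain_length (X i) j - chain_length (X (Suc i)) j) + (\<psi> (Suc i) j - \<psi> i j) * cmod ?d"
    unfolding cl[OF ij(1)] cl[OF ij(2)] by (simp add: algebra_simps)
  then have 2: "\<bar>chain_length (X i) (Suc j) - chain_length (X (Suc i)) (Suc j)\<bar>
      \<le> \<bar>chain_length (X i) j - chain_length (X (Suc i)) j\<bar> + \<bar>\<psi> (Suc i) j - \<psi> i j\<bar> * cmod ?d"
    by (metis abs_triangle_ineq abs_mult abs_norm_cancel)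
  have 3: "\<bar>\<psi> (Suc i) j - \<psi> i j\<bar> * cmod ?d \<le> \<kappa> * ?D * cmod ?d"
    using psi by (intro mult_right_mono) auto
  have "cmod (X i (Suc j) - X (Suc i) (Suc j)) + \<bar>chain_length (X i) (Suc j) - chain_length (X (Suc i)) (Suc j)\<bar>
      \<le> ?D * (1 + 2 * \<kappa> * cmod ?d)"
    using 1 2 3 by (simp add: algebra_simps)
  also have "\<dots> \<le> ?D * exp (2 * \<kappa> * cmod ?d)"
    using \<open>\<kappa> \<ge> 0\<close> by (intro mult_left_mono exp_ge_add_one_self) auto
  also have "\<dots> \<le> (2 * cmod (z (Suc i) - z i) * exp (2 * \<kappa> * (chain_length z j - chain_length z (Suc i))))
      * exp (2 * \<kappa> * cmod ?d)"
    using step.IH unfolding \<kappa>_def by (intro mult_right_mono) auto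
  also have "\<dots> = 2 * cmod (z (Suc i) - z i) * exp (2 * \<kappa> * (chain_length z (Suc j) - chain_length z (Suc i)))"
    by (simp add: algebra_simps flip: exp_add)
  finally show ?case unfolding \<kappa>_def .
qed

text \<open>The factor depends neither on the mesh nor on the indices. It keeps contour edges short
  on fine meshes and turns sums over contour edges into sums over the steps of
  \<open>z\<close>.\<close>

lemma Y_spacing:
  assumes "j \<le> K" "chain_length z K \<le> L"
  shows "cmod (Y (Suc i) j - Y i j) \<le> 2 * exp (2 * (2 / \<rho> + 3 / \<delta>) * L) * cmod (z (Suc i) - z i)"
proof (cases "Suc i \<le> j")
  case True
  have "cmod (Y (Suc i) j - Y i j) = cmod (X i j - X (Suc i) j)" by (simp add: Y_def)
  also have "\<dots> \<le> 2 * cmod (z (Suc i) - z i) *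
      exp (2 * (2 / \<rho> + 3 / \<delta>) * (chain_length z j - chain_length z (Suc i)))"
    using flow_spacing[OF True] by linarith
  also have "\<dots> \<le> 2 * cmod (z (Suc i) - z i) * exp (2 * (2 / \<rho> + 3 / \<delta>) * L)"
  proof -
    have "chain_length z j - chain_length z (Suc i) \<le> L"
      using chain_length_mono[OF assms(1), of z] assms(2) chain_length_nonneg[of z "Suc i"] by linarith
    then have "2 * (2 / \<rho> + 3 / \<delta>) * (chain_length z j - chain_length z (Suc i)) \<le> 2 * (2 / \<rho> + 3 / \<delta>) * L"
      using \<rho> \<delta> by (intro mult_left_mono) auto
    then show ?thesis by (intro mult_left_mono) auto
  qed
  finally show ?thesis by (simp add: algebra_simps)
next
  case False
  then show ?thesis by (simp add: Y_le)
qed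

end

section \<open>Continuation of all iterated convolutions\<close>

lemma chain_cont_cong:
  assumes "chain_cont u z K R f" "\<And>w. w \<in> ball (z 0) R \<Longrightarrow> u w = v w"
  shows "chain_cont v z K R f"
  using assms by (simp add: chain_cont_def)

text \<open>Meant for contour points that never move after birth: they follow \<open>z\<close> up to
  stage \<open>i\<close> and then rest, keeping the germ of that stage.\<close>

lemma chain_cont_stop:
  assumes "chain_cont u z K R f" "i \<le> K" "\<And>m. m \<le> K \<Longrightarrow> z' m = z (min i m)"
  shows "chain_cont u z' K R (\<lambda>j. f (min i j))"
  unfolding chain_cont_def
proof (intro conjI allI impI ballI)
  show "f (min i j) holomorphic_on ball (z' j) R" if "j \<le> K" for j
    using assms that by (auto simp: chain_cont_def)
  show "f (min i j) w = f (min i (Suc j)) w" if "j < K" "w \<in> ball (z' j) R \<inter> ball (z' (Suc j)) R" for j w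
  proof (cases "j < i")
    case True
    then have "min i j = j" "min i (Suc j) = Suc j" by auto
    then show ?thesis using assms that True by (simp add: chain_cont_def)
  next
    case False
    then have "min i j = i" "min i (Suc j) = i" by auto
    then show ?thesis by simp
  qed
  show "f (min i 0) w = u w" if "w \<in> ball (z' 0) R" for w
    using assms that by (simp add: chain_cont_def)
qed

text \<open>A left Riemann sum of an increasing exponential of the length is bounded by the
  integral. The gain \<open>1 / \<nu>\<close> absorbs the constants in the contour part of the
  Volterra inequality.\<close>

lemma sum_exp_chain_length_le:
  assumes "\<nu> > 0"
  shows "(\<Sum>i<j. exp (\<nu> * chain_length z i) * cmod (z (Suc i) - z i)) \<le> exp (\<nu> * chain_length z j) / \<nu>"
proof (induction j)
  case 0
  then show ?case using assms by simp
next
  case (Suc j)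
  let ?d = "cmod (z (Suc j) - z j)" and ?e = "exp (\<nu> * chain_length z j)"
  have "?e * (1 + \<nu> * ?d) \<le> ?e * exp (\<nu> * ?d)"
    by (intro mult_left_mono exp_ge_add_one_self) auto
  then have "?e * (1 + \<nu> * ?d) / \<nu> \<le> exp (\<nu> * chain_length z (Suc j)) / \<nu>"
    using assms by (intro divide_right_mono) (auto simp: distrib_left exp_add)
  moreover have "?e * (1 + \<nu> * ?d) / \<nu> = ?e / \<nu> + ?e * ?d"
    using assms by (simp add: field_simps)
  ultimately show ?case using Suc by simp
qed

text \<open>In \<open>V_cont\<close> the step size and the radius depend on \<open>\<delta>\<close>
  only, while \<open>A\<close> may depend on the chain. So one mesh, fixed in advance, suits all
  chains produced by the flow.\<close>

locale continuable_words =
  fixes I :: "nat set" and V :: "nat list \<Rightarrow> complex \<Rightarrow> complex" and F :: "complex set" and \<rho> L \<theta> :: real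
  assumes I: "finite I" and F: "finite F" "0 \<in> F" and pos: "\<rho> > 0" "\<theta> > 0"
    and V_hol: "\<And>i. i \<in> I \<Longrightarrow> V [i] holomorphic_on ball 0 (2 * \<rho>)"
    and V_Cons: "\<And>i w \<zeta>. i \<in> I \<Longrightarrow> set w \<subseteq> I \<Longrightarrow> w \<noteq> [] \<Longrightarrow> \<zeta> \<in> ball 0 \<rho> \<Longrightarrow>
        V (i # w) \<zeta> = conv (V [i]) (V w) \<zeta>"
    and V_cont: "\<And>\<delta>. \<delta> > 0 \<Longrightarrow> \<exists>s>0. \<exists>R>0. \<forall>x K. clear_chain F (2 * \<rho>) \<delta> x K \<and>
        (\<forall>j<K. cmod (x (Suc j) - x j) \<le> s) \<and> chain_length x K < L \<longrightarrow>
        (\<exists>A. \<forall>i\<in>I. \<exists>p. chain_cont (V [i]) x K R p \<and> (\<forall>j\<le>K. \<forall>w\<in>ball (x j) R. cmod (p j w) \<le> A))"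
begin

primrec sumset :: "nat \<Rightarrow> complex set" where
  "sumset 0 = {0}"
| "sumset (Suc k) = {f + w |f w. f \<in> F \<and> w \<in> sumset k}"

lemma zero_in_sumset: "0 \<in> sumset k"
proof (induction k)
  case (Suc k)
  then show ?case using F(2) by (auto intro!: exI[of _ 0])
qed simp

lemma finite_sumset: "finite (sumset k)"
proof (induction k)
  case (Suc k)
  have "sumset (Suc k) = (\<lambda>(f, w). f + w) ` (F \<times> sumset k)" by auto
  then show ?case using Suc F(1) by simp
qed simp

lemma F_subset_sumset: "F \<subseteq> sumset (Suc k)"
  using zero_in_sumset[of k] by force

text \<open>The order of quantifiers matters: \<open>s\<close> and \<open>R\<close> come before the
  chain, and \<open>C\<close> after the chain but before the word.\<close>

definition bounded_continuation :: "nat \<Rightarrow> bool" where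
  "bounded_continuation k \<longleftrightarrow> (\<forall>\<delta>>0. \<exists>s>0. \<exists>R>0. \<forall>z K. clear_chain (sumset k) \<rho> \<delta> z K \<and>
     (\<forall>j<K. cmod (z (Suc j) - z j) \<le> s) \<and> chain_length z K < min (real k * \<rho>) L \<longrightarrow>
     (\<exists>C. \<forall>w. w \<noteq> [] \<and> set w \<subseteq> I \<longrightarrow> (\<exists>f. chain_cont (V w) z K R f \<and>
        (\<forall>j\<le>K. \<forall>\<zeta>\<in>ball (z j) R. cmod (f j \<zeta>) \<le> C * \<theta> ^ length w))))"

lemma bounded_continuation_0: "bounded_continuation 0"
proof -
  have "\<not> chain_length z K < 0" for z K using chain_length_nonneg[of z K] by linarith
  then show ?thesis unfolding bounded_continuation_def
    by (intro allI impI exI[of _ 1] conjI) auto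
qed

lemma V_bounded: "\<exists>A>0. \<forall>i\<in>I. \<forall>w\<in>ball 0 \<rho>. cmod (V [i] w) \<le> A"
proof -
  have "\<exists>A. \<forall>w\<in>ball 0 \<rho>. cmod (V [i] w) \<le> A" if "i \<in> I" for i
  proof -
    have "continuous_on (cball 0 \<rho>) (V [i])"
      using V_hol[OF that] pos by (intro holomorphic_on_imp_continuous_on[OF holomorphic_on_subset]) auto
    then have "bounded (V [i] ` cball 0 \<rho>)"
      by (intro compact_imp_bounded compact_continuous_image) auto
    then obtain A where "\<forall>x\<in>V [i] ` cball 0 \<rho>. cmod x \<le> A"
      by (auto simp: bounded_iff)
    then show ?thesis by (intro exI[of _ A]) auto
  qed
  then obtain A where A: "\<And>i w. i \<in> I \<Longrightarrow> w \<in> ball 0 \<rho> \<Longrightarrow> cmod (V [i] w) \<le> A i" by metis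
  have "cmod (V [i] w) \<le> 1 + (\<Sum>i\<in>I. \<bar>A i\<bar>)" if "i \<in> I" "w \<in> ball 0 \<rho>" for i w
    using A[OF that] member_le_sum[of i I "\<lambda>i. \<bar>A i\<bar>"] that I by force
  moreover have "1 + (\<Sum>i\<in>I. \<bar>A i\<bar>) > 0" by (smt (verit) sum_nonneg abs_ge_zero)
  ultimately show ?thesis by blast
qed

lemma bounded_continuation_Suc:
  assumes "bounded_continuation k"
  shows "bounded_continuation (Suc k)"
  unfolding bounded_continuation_def
proof (intro allI impI)
  fix \<delta> :: real assume \<delta>: "\<delta> > 0"
  then have "\<delta> / 4 > 0" by simp
  obtain s1 R1 where s1: "s1 > 0" "R1 > 0" and V1': "\<forall>x K. clear_chain F (2 * \<rho>) (\<delta> / 4) x K \<and>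
      (\<forall>j<K. cmod (x (Suc j) - x j) \<le> s1) \<and> chain_length x K < L \<longrightarrow>
      (\<exists>A. \<forall>i\<in>I. \<exists>p. chain_cont (V [i]) x K R1 p \<and> (\<forall>j\<le>K. \<forall>w\<in>ball (x j) R1. cmod (p j w) \<le> A))"
    using V_cont[OF \<open>\<delta> / 4 > 0\<close>] by (elim exE conjE) (rule that)
  have V1: "\<exists>A. \<forall>i\<in>I. \<exists>p. chain_cont (V [i]) x K R1 p \<and> (\<forall>j\<le>K. \<forall>w\<in>ball (x j) R1. cmod (p j w) \<le> A)"
    if "clear_chain F (2 * \<rho>) (\<delta> / 4) x K" "\<And>j. j < K \<Longrightarrow> cmod (x (Suc j) - x j) \<le> s1" "chain_length x K < L"
    for x K
    by (intro V1'[THEN spec, THEN spec, THEN mp] conjI allI impI that)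
  obtain s2 R2 where s2: "s2 > 0" "R2 > 0" and V2': "\<forall>z K. clear_chain (sumset k) \<rho> (\<delta> / 4) z K \<and>
      (\<forall>j<K. cmod (z (Suc j) - z j) \<le> s2) \<and> chain_length z K < min (real k * \<rho>) L \<longrightarrow>
      (\<exists>C. \<forall>w. w \<noteq> [] \<and> set w \<subseteq> I \<longrightarrow> (\<exists>f. chain_cont (V w) z K R2 f \<and>
        (\<forall>j\<le>K. \<forall>\<zeta>\<in>ball (z j) R2. cmod (f j \<zeta>) \<le> C * \<theta> ^ length w)))"
    using assms[unfolded bounded_continuation_def, THEN spec, THEN mp, OF \<open>\<delta> / 4 > 0\<close>]
    by (elim exE conjE) (rule that)
  have V2: "\<exists>C. \<forall>w. w \<noteq> [] \<and> set w \<subseteq> I \<longrightarrow> (\<exists>f. chain_cont (V w) z K R2 f \<and>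
        (\<forall>j\<le>K. \<forall>\<zeta>\<in>ball (z j) R2. cmod (f j \<zeta>) \<le> C * \<theta> ^ length w))"
    if "clear_chain (sumset k) \<rho> (\<delta> / 4) z K" "\<And>j. j < K \<Longrightarrow> cmod (z (Suc j) - z j) \<le> s2"
      "chain_length z K < min (real k * \<rho>) L" for z K
    by (intro V2'[THEN spec, THEN spec, THEN mp] conjI allI impI that)
  obtain A0 where A0: "A0 > 0" "\<And>i w. i \<in> I \<Longrightarrow> w \<in> ball 0 \<rho> \<Longrightarrow> cmod (V [i] w) \<le> A0"
    using V_bounded by blast
  \<comment> \<open>\<open>R1 / 2\<close> because the germs along \<open>X\<close> are used on discs
    of radius \<open>2 * R\<close>; \<open>\<rho> / 2\<close> keeps \<open>2 * R\<close> within the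
    disc where \<open>A0\<close> is a bound; the last entry limits the share of the last leg to half
    of \<open>\<theta>\<close>.\<close>
  define R where "R = min (min (R1 / 2) R2) (min (\<rho> / 2) (\<theta> / (2 * A0)))"
  define E where "E = 2 * exp (2 * (2 / \<rho> + 3 / \<delta>) * \<bar>L\<bar>)"
  \<comment> \<open>The steps must suit both given continuations, keep contour edges below
    \<open>R / 8\<close> even after stretching by \<open>E\<close>, and satisfy the bounds on
    \<open>\<sigma>\<close> in \<open>contour_flow\<close>.\<close>
  define s where "s = min (min s1 s2) (min (R / (8 * E)) (min (\<rho> / 2) (\<delta> / 12)))"
  have "\<theta> / (2 * A0) > 0" using pos A0(1) by simp
  then have R_le: "R > 0" "2 * R \<le> R1" "R \<le> R2" "R \<le> R1" "2 * R \<le> \<rho>" "R \<le> \<theta> / (2 * A0)"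
    using s1 s2 pos unfolding R_def by linarith+
  have A0R: "A0 * R \<le> \<theta> / 2" using R_le(6) A0(1) by (simp add: field_simps)
  have E: "E \<ge> 1"
  proof -
    have "exp (2 * (2 / \<rho> + 3 / \<delta>) * \<bar>L\<bar>) \<ge> 1" using pos \<delta> by simp
    then show ?thesis unfolding E_def by linarith
  qed
  have "R / (8 * E) > 0" using R_le(1) E by simp
  then have s: "s > 0" "s \<le> s1" "s \<le> s2" "s \<le> R / (8 * E)" "s \<le> \<rho> / 2" "s \<le> \<delta> / 12"
    using s1 s2 pos \<delta> unfolding s_def by linarith+
  have sE: "s * E \<le> R / 8" using s(4) E by (simp add: field_simps)
  have s8: "s \<le> R / 8" using s(1) sE E mult_left_mono[of 1 E s] by linarith
  show "\<exists>s>0. \<exists>R>0. \<forall>z K. clear_chain (sumset (Suc k)) \<rho> \<delta> z K \<and>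
     (\<forall>j<K. cmod (z (Suc j) - z j) \<le> s) \<and> chain_length z K < min (real (Suc k) * \<rho>) L \<longrightarrow>
     (\<exists>C. \<forall>w. w \<noteq> [] \<and> set w \<subseteq> I \<longrightarrow> (\<exists>f. chain_cont (V w) z K R f \<and>
        (\<forall>j\<le>K. \<forall>\<zeta>\<in>ball (z j) R. cmod (f j \<zeta>) \<le> C * \<theta> ^ length w)))"
  proof (rule exI[of _ s], rule conjI[OF s(1)], rule exI[of _ R], rule conjI[OF R_le(1)],
      intro allI impI, elim conjE)
    fix z K
    assume z_clear: "clear_chain (sumset (Suc k)) \<rho> \<delta> z K" and stz: "\<forall>j<K. cmod (z (Suc j) - z j) \<le> s"
      and len: "chain_length z K < min (real (Suc k) * \<rho>) L"
    interpret contour_flow F "sumset k" \<rho> \<delta> s z K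
      by unfold_locales (use pos \<delta> F z_clear stz s zero_in_sumset in auto)
    have lenX: "chain_length (X i) j \<le> chain_length z K" and lenY: "chain_length (Y i) j \<le> chain_length z K"
      if "j \<le> K" for i j
      using length_X_plus_Y[of i j] chain_length_mono[OF that, of z]
        chain_length_nonneg[of "X i" j] chain_length_nonneg[of "Y i" j] by linarith+
    have "\<exists>A. \<forall>\<iota>\<in>I. \<exists>p. chain_cont (V [\<iota>]) (X i) K R1 p \<and>
        (\<forall>j\<le>K. \<forall>w\<in>ball (X i j) R1. cmod (p j w) \<le> A)" for i
      by (rule V1[OF clear_X]) (use step_X[of _ i] s lenX[of K i] len in force)+
    then obtain A' where A': "\<And>i \<iota>. \<iota> \<in> I \<Longrightarrow> \<exists>p. chain_cont (V [\<iota>]) (X i) K R1 p \<and>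
        (\<forall>j\<le>K. \<forall>w\<in>ball (X i j) R1. cmod (p j w) \<le> A' i)" by metis
    define A where "A = (\<Sum>i\<le>K. \<bar>A' i\<bar>)"
    have A_nonneg: "A \<ge> 0" unfolding A_def by (intro sum_nonneg) auto
    have A: "\<exists>p. chain_cont (V [\<iota>]) (X i) K (2 * R) p \<and>
        (\<forall>j\<le>K. \<forall>w\<in>ball (X i j) (2 * R). cmod (p j w) \<le> A)" if i: "i \<le> K" and \<iota>: "\<iota> \<in> I" for i \<iota>
    proof -
      obtain p where p: "chain_cont (V [\<iota>]) (X i) K R1 p"
        "\<And>j w. j \<le> K \<Longrightarrow> w \<in> ball (X i j) R1 \<Longrightarrow> cmod (p j w) \<le> A' i" using A'[OF \<iota>, of i] by blast
      have "A' i \<le> A"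
        using member_le_sum[of i "{..K}" "\<lambda>i. \<bar>A' i\<bar>"] i unfolding A_def by force
      then have "cmod (p j w) \<le> A" if "j \<le> K" "w \<in> ball (X i j) (2 * R)" for j w
        using p(2)[of j w] that R_le(2) by force
      then show ?thesis using chain_cont_subset[OF p(1) R_le(2)] by blast
    qed
    \<comment> \<open>One-letter words are continued along \<open>z\<close> itself, which
      \<open>V_cont\<close> covers because \<open>F\<close> lies in the sumset.\<close>
    have "clear_chain F (2 * \<rho>) (\<delta> / 4) z K"
      by (rule clear_chain_mono[OF z_clear F_subset_sumset]) (use pos \<delta> in auto)
    from V1[OF this] obtain Az where Az: "\<And>\<iota>. \<iota> \<in> I \<Longrightarrow> \<exists>p. chain_cont (V [\<iota>]) z K R1 p \<and>
        (\<forall>j\<le>K. \<forall>w\<in>ball (z j) R1. cmod (p j w) \<le> Az)"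
      using stz s len by fastforce
    \<comment> \<open>The induction on \<open>k\<close> handles contour points that have moved. An
      unmoved one retraces \<open>z\<close> and takes its germs from the induction on the
      word.\<close>
    define still where "still i \<longleftrightarrow> (\<forall>m\<le>K. Y i m = z (min i m))" for i
    have "\<exists>C. \<forall>w. w \<noteq> [] \<and> set w \<subseteq> I \<longrightarrow> (\<exists>f. chain_cont (V w) (Y i) K R2 f \<and>
        (\<forall>j\<le>K. \<forall>\<zeta>\<in>ball (Y i j) R2. cmod (f j \<zeta>) \<le> C * \<theta> ^ length w))" if "\<not> still i" for i
    proof (rule V2[OF clear_Y])
      have "chain_length (X i) K > \<rho>"
        using unmoved_or_long[of K i] that by (auto simp: still_def)
      then have "chain_length (Y i) K < real k * \<rho>"
        using length_X_plus_Y[of i K] len by (simp add: algebra_simps)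
      then show "chain_length (Y i) K < min (real k * \<rho>) L"
        using lenY[of K i] len by simp
    qed (use step_Y[of _ i] s in force)
    then obtain C' where C': "\<And>i w. \<not> still i \<Longrightarrow> w \<noteq> [] \<Longrightarrow> set w \<subseteq> I \<Longrightarrow> \<exists>f. chain_cont (V w) (Y i) K R2 f \<and>
        (\<forall>j\<le>K. \<forall>\<zeta>\<in>ball (Y i j) R2. cmod (f j \<zeta>) \<le> C' i * \<theta> ^ length w)" by metis
    \<comment> \<open>The sum dominates the bounds along all moved contour points; the middle term
      gives \<open>Az \<le> C * \<theta>\<close> for one-letter words.\<close>
    define C where "C = (\<Sum>i\<le>K. \<bar>C' i\<bar>) + \<bar>Az\<bar> / \<theta> + 1"
    have C: "C \<ge> 0" "Az \<le> C * \<theta>"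
    proof -
      show "C \<ge> 0" unfolding C_def using pos by (intro add_nonneg_nonneg sum_nonneg) auto
      have "\<bar>Az\<bar> / \<theta> \<le> C" unfolding C_def using sum_nonneg[of "{..K}" "\<lambda>i. \<bar>C' i\<bar>"] by simp
      then show "Az \<le> C * \<theta>" using pos by (simp add: field_simps)
    qed
    have C'_le: "C' i \<le> C" if "i \<le> K" for i
    proof -
      have "\<bar>C' i\<bar> \<le> (\<Sum>i\<le>K. \<bar>C' i\<bar>)" using that by (intro member_le_sum) auto
      moreover have "\<bar>Az\<bar> / \<theta> \<ge> 0" using pos by simp
      ultimately show ?thesis unfolding C_def by linarith
    qed
    \<comment> \<open>Large enough for the integral over the polygon to contribute at most half of
      \<open>\<theta>\<close>. Like \<open>C\<close>, it is fixed before the word.\<close>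
    define \<nu> where "\<nu> = 2 * A * E / \<theta> + 1"
    have \<nu>: "\<nu> > 0" "A * E / \<nu> \<le> \<theta> / 2"
    proof -
      have "2 * A * E / \<theta> \<ge> 0" using A_nonneg E pos by simp
      then show "\<nu> > 0" unfolding \<nu>_def by linarith
      then show "A * E / \<nu> \<le> \<theta> / 2"
        using pos by (simp add: pos_divide_le_eq) (simp add: \<nu>_def field_simps)
    qed
    have main: "\<exists>f. chain_cont (V w) z K R f \<and> (\<forall>j\<le>K. \<forall>\<zeta>\<in>ball (z j) R.
        cmod (f j \<zeta>) \<le> C * \<theta> ^ length w * exp (\<nu> * chain_length z j))" if "w \<noteq> []" "set w \<subseteq> I" for w
      using that
    proof (induction w rule: list_nonempty_induct)
      case (single \<iota>)
      then obtain p where p: "chain_cont (V [\<iota>]) z K R1 p"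
        "\<And>j w. j \<le> K \<Longrightarrow> w \<in> ball (z j) R1 \<Longrightarrow> cmod (p j w) \<le> Az" using Az[of \<iota>] by auto
      have "cmod (p j w) \<le> C * \<theta> ^ length [\<iota>] * exp (\<nu> * chain_length z j)"
        if "j \<le> K" "w \<in> ball (z j) R" for j w
      proof -
        have "cmod (p j w) \<le> C * \<theta> * 1" using p(2)[of j w] that R_le(4) C(2) by force
        also have "\<dots> \<le> C * \<theta> * exp (\<nu> * chain_length z j)"
          using C(1) pos \<nu>(1) by (intro mult_left_mono) auto
        finally show ?thesis by simp
      qed
      then show ?case using chain_cont_subset[OF p(1) R_le(4)] by blast
    next
      case (cons \<iota> w)
      then obtain f where f: "chain_cont (V w) z K R f"
        "\<And>j \<zeta>. j \<le> K \<Longrightarrow> \<zeta> \<in> ball (z j) R \<Longrightarrow> cmod (f j \<zeta>) \<le> C * \<theta> ^ length w * exp (\<nu> * chain_length z j)"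
        by auto
      have \<iota>: "\<iota> \<in> I" and w: "w \<noteq> []" "set w \<subseteq> I" using cons by auto
      define B where "B i = C * \<theta> ^ length w * exp (\<nu> * chain_length z i)" for i
      have B: "B i \<ge> 0" for i unfolding B_def using C(1) pos by auto
      obtain p where p_cont: "\<And>i. i \<le> K \<Longrightarrow> chain_cont (V [\<iota>]) (X i) K (2 * R) (p i)"
        "\<And>i j w. i \<le> K \<Longrightarrow> j \<le> K \<Longrightarrow> w \<in> ball (X i j) (2 * R) \<Longrightarrow> cmod (p i j w) \<le> A"
        using A[OF _ \<iota>] by metis
      \<comment> \<open>The bound at \<open>Y i\<close> is the weight at its birth stage. It is
        claimed for \<open>i \<le> j\<close>, when the point belongs to the contour and, if unmoved,
        carries the germ of stage \<open>i\<close>.\<close>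
      have "\<exists>q. chain_cont (V w) (Y i) K R q \<and>
          (\<forall>j\<le>K. \<forall>\<zeta>\<in>ball (Y i j) R. i \<le> j \<longrightarrow> cmod (q j \<zeta>) \<le> B i)" if i: "i \<le> K" for i
      proof (cases "still i")
        case True
        have "chain_cont (V w) (Y i) K R (\<lambda>j. f (min i j))"
          by (rule chain_cont_stop[OF f(1) i]) (use True in \<open>auto simp: still_def\<close>)
        moreover have "cmod (f (min i j) \<zeta>) \<le> B i" if "j \<le> K" "\<zeta> \<in> ball (Y i j) R" "i \<le> j" for j \<zeta>
          using f(2)[OF i, of \<zeta>] True that by (auto simp: still_def B_def min_def)
        ultimately show ?thesis by blast
      next
        case False
        from C'[OF this w] obtain q where q: "chain_cont (V w) (Y i) K R2 q"
          "\<And>j \<zeta>. j \<le> K \<Longrightarrow> \<zeta> \<in> ball (Y i j) R2 \<Longrightarrow> cmod (q j \<zeta>) \<le> C' i * \<theta> ^ length w" by blast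
        have "cmod (q j \<zeta>) \<le> B i" if "j \<le> K" "\<zeta> \<in> ball (Y i j) R" for j \<zeta>
        proof -
          have "cmod (q j \<zeta>) \<le> C' i * \<theta> ^ length w" using q(2)[of j \<zeta>] that R_le(3) by force
          also have "\<dots> \<le> C * \<theta> ^ length w * 1"
            using C'_le[OF i] pos by (simp add: mult_right_mono)
          also have "\<dots> \<le> B i"
            unfolding B_def using C(1) pos \<nu>(1) by (intro mult_left_mono) auto
          finally show ?thesis .
        qed
        then show ?thesis using chain_cont_subset[OF q(1) R_le(3)] by blast
      qed
      then obtain q where q_cont: "\<And>i. i \<le> K \<Longrightarrow> chain_cont (V w) (Y i) K R (q i)"
        "\<And>i j \<zeta>. i \<le> K \<Longrightarrow> j \<le> K \<Longrightarrow> \<zeta> \<in> ball (Y i j) R \<Longrightarrow> i \<le> j \<Longrightarrow> cmod (q i j \<zeta>) \<le> B i"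
        by metis
      have spacing: "cmod (Y (Suc i) j - Y i j) \<le> E * cmod (z (Suc i) - z i)" if "j \<le> K" for i j
        unfolding E_def by (rule Y_spacing[OF that]) (use len in auto)
      interpret convolution_contours z K R X Y "V [\<iota>]" "V w" p q
      proof unfold_locales
        show "V [\<iota>] holomorphic_on ball 0 (2 * R)"
          using V_hol[OF \<iota>] by (rule holomorphic_on_subset) (use R_le pos in auto)
        show "cmod (Y (Suc i) j - Y i j) \<le> R / 8" if "i < K" "j \<le> K" for i j
        proof -
          have "E * cmod (z (Suc i) - z i) \<le> E * s" using stz that E by (intro mult_left_mono) auto
          then show ?thesis using spacing[OF that(2), of i] sE by (simp add: mult.commute)
        qed
        show "cmod (z (Suc j) - z j) \<le> R / 8" if "j < K" for j using stz that s8 by force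
        show "cmod (X i (Suc j) - X i j) \<le> R / 8" "cmod (Y i (Suc j) - Y i j) \<le> R / 8" if "j < K" for i j
          using step_X[OF that, of i] step_Y[OF that, of i] s8 by auto
      qed (use R_le z_0 p_cont(1) q_cont(1) in \<open>auto simp: Y_def X_le Y_diag_Suc[unfolded Y_def] Y_0[unfolded Y_def]\<close>)
      have "chain_cont (V (\<iota> # w)) z K R h"
      proof (rule chain_cont_cong[OF chain_cont_conv])
        fix \<zeta> assume "\<zeta> \<in> ball (z 0) R"
        then have "\<zeta> \<in> ball 0 \<rho>" using R_le(1,5) z_0 by simp
        then show "conv (V [\<iota>]) (V w) \<zeta> = V (\<iota> # w) \<zeta>" using V_Cons[OF \<iota> w(2,1)] by simp
      qed
      moreover have "cmod (h j \<zeta>) \<le> C * \<theta> ^ length (\<iota> # w) * exp (\<nu> * chain_length z j)"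
        if j: "j \<le> K" and \<zeta>: "\<zeta> \<in> ball (z j) R" for j \<zeta>
      proof -
        have "cmod (h j \<zeta>) \<le> (\<Sum>i<j. A * B i * cmod (Y (Suc i) j - Y i j)) + A0 * B j * R"
          by (rule h_bound[OF j \<zeta>]) (use A_nonneg A0 B p_cont q_cont j \<iota> R_le in auto)
        also have "(\<Sum>i<j. A * B i * cmod (Y (Suc i) j - Y i j)) \<le> (\<Sum>i<j. A * B i * (E * cmod (z (Suc i) - z i)))"
          using A_nonneg B spacing[OF j] by (intro sum_mono mult_left_mono) auto
        also have "\<dots> = A * E * (C * \<theta> ^ length w) * (\<Sum>i<j. exp (\<nu> * chain_length z i) * cmod (z (Suc i) - z i))"
          unfolding B_def sum_distrib_left by (intro sum.cong refl) (simp add: algebra_simps)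
        also have "\<dots> \<le> A * E * (C * \<theta> ^ length w) * (exp (\<nu> * chain_length z j) / \<nu>)"
          using A_nonneg E C(1) pos by (intro mult_left_mono sum_exp_chain_length_le \<nu>(1)) auto
        also have "\<dots> = A * E / \<nu> * B j" by (simp add: B_def)
        also have "\<dots> \<le> \<theta> / 2 * B j" using \<nu>(2) B by (intro mult_right_mono) auto
        finally have "cmod (h j \<zeta>) \<le> \<theta> / 2 * B j + A0 * B j * R" by simp
        also have "A0 * B j * R \<le> \<theta> / 2 * B j"
          using mult_right_mono[OF A0R B[of j]] by (simp add: algebra_simps)
        finally show ?thesis by (simp add: B_def algebra_simps)
      qed
      ultimately show ?case by blast
    qed
    show "\<exists>C. \<forall>w. w \<noteq> [] \<and> set w \<subseteq> I \<longrightarrow> (\<exists>f. chain_cont (V w) z K R f \<and>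
        (\<forall>j\<le>K. \<forall>\<zeta>\<in>ball (z j) R. cmod (f j \<zeta>) \<le> C * \<theta> ^ length w))"
    proof (intro exI[of _ "C * exp (\<nu> * chain_length z K)"] allI impI, elim conjE)
      fix w assume w: "w \<noteq> []" "set w \<subseteq> I"
      from main[OF w] obtain f where f: "chain_cont (V w) z K R f" "\<And>j \<zeta>. j \<le> K \<Longrightarrow> \<zeta> \<in> ball (z j) R \<Longrightarrow>
          cmod (f j \<zeta>) \<le> C * \<theta> ^ length w * exp (\<nu> * chain_length z j)" by blast
      have "cmod (f j \<zeta>) \<le> C * exp (\<nu> * chain_length z K) * \<theta> ^ length w"
        if "j \<le> K" "\<zeta> \<in> ball (z j) R" for j \<zeta>
      proof -
        have "C * \<theta> ^ length w * exp (\<nu> * chain_length z j) \<le> C * \<theta> ^ length w * exp (\<nu> * chain_length z K)"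
          using C(1) pos \<nu>(1) chain_length_mono[OF that(1), of z] by (intro mult_left_mono) auto
        then show ?thesis using f(2)[OF that] by (simp add: algebra_simps)
      qed
      then show "\<exists>f. chain_cont (V w) z K R f \<and>
        (\<forall>j\<le>K. \<forall>\<zeta>\<in>ball (z j) R. cmod (f j \<zeta>) \<le> C * exp (\<nu> * chain_length z K) * \<theta> ^ length w)"
        using f(1) by blast
    qed
  qed
qed

theorem bounded_continuation: "bounded_continuation k"
  by (induction k) (auto intro: bounded_continuation_0 bounded_continuation_Suc)

end

section \<open>From paths to chains\<close>

lemma eventually_agree_imp_agree_ball:
  assumes "f holomorphic_on ball c r" "g holomorphic_on ball c r" "x \<in> ball c r"
    and "eventually (\<lambda>w. f w = g w) (nhds x)" "w \<in> ball c r"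
  shows "f w = g w"
proof -
  obtain U where U: "open U" "x \<in> U" "\<And>w. w \<in> U \<Longrightarrow> f w = g w"
    using assms(4) by (auto simp: eventually_nhds)
  show ?thesis
    by (rule holomorphic_agree_Int_balls[OF assms(1,2), of "U \<inter> ball c r"])
       (use U assms in auto)
qed

text \<open>The condition in \<open>continuable_along\<close> on an arbitrary parameter interval and
  without the initial germ, so that continuations can be restricted and rescaled.\<close>

definition cont_data ::
  "(real \<Rightarrow> complex) \<Rightarrow> real \<Rightarrow> real \<Rightarrow> (real \<Rightarrow> complex \<Rightarrow> complex) \<Rightarrow> (real \<Rightarrow> real) \<Rightarrow> bool" where
  "cont_data \<gamma> a b f R \<longleftrightarrow>
     (\<forall>t\<in>{a..b}. R t > 0 \<and> f t holomorphic_on ball (\<gamma> t) (R t)) \<and>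
     (\<forall>t\<in>{a..b}. \<exists>d>0. \<forall>s\<in>{a..b}. \<bar>s - t\<bar> < d \<longrightarrow> \<gamma> s \<in> ball (\<gamma> t) (R t) \<and>
        (\<forall>z\<in>ball (\<gamma> s) (R s) \<inter> ball (\<gamma> t) (R t). f s z = f t z))"

lemma cont_data_subset:
  assumes "cont_data \<gamma> a b f R" "{c..d} \<subseteq> {a..b}" "\<And>t. t \<in> {c..d} \<Longrightarrow> \<gamma>' t = \<gamma> t"
  shows "cont_data \<gamma>' c d f R"
  unfolding cont_data_def
proof (intro conjI ballI)
  fix t assume t: "t \<in> {c..d}"
  then show "R t > 0" "f t holomorphic_on ball (\<gamma>' t) (R t)"
    using assms by (auto simp: cont_data_def)
  obtain e where e: "e > 0" "\<And>s. s \<in> {a..b} \<Longrightarrow> \<bar>s - t\<bar> < e \<Longrightarrow> \<gamma> s \<in> ball (\<gamma> t) (R t) \<and>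
        (\<forall>z\<in>ball (\<gamma> s) (R s) \<inter> ball (\<gamma> t) (R t). f s z = f t z)"
    using assms(1,2) t unfolding cont_data_def by blast
  show "\<exists>e>0. \<forall>s\<in>{c..d}. \<bar>s - t\<bar> < e \<longrightarrow> \<gamma>' s \<in> ball (\<gamma>' t) (R t) \<and>
        (\<forall>z\<in>ball (\<gamma>' s) (R s) \<inter> ball (\<gamma>' t) (R t). f s z = f t z)"
  proof (intro exI[of _ e] conjI e(1) ballI impI)
    fix s assume s: "s \<in> {c..d}" "\<bar>s - t\<bar> < e"
    then have "s \<in> {a..b}" using assms(2) by blast
    from e(2)[OF this s(2)] show "\<gamma>' s \<in> ball (\<gamma>' t) (R t)"
      using assms(3) s(1) t by simp
    show "f s z = f t z" if "z \<in> ball (\<gamma>' s) (R s) \<inter> ball (\<gamma>' t) (R t)" for z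
      using e(2)[OF \<open>s \<in> {a..b}\<close> s(2)] assms(3) s(1) t that by auto
  qed
qed

text \<open>Equality of the two germs is a locally constant property of the parameter, by the
  identity theorem on the smaller of the two discs, and an interval is connected.\<close>

lemma cont_data_unique:
  assumes f: "cont_data \<gamma> a b f R" and g: "cont_data \<gamma> a b g Q"
    and "t \<in> {a..b}" "u \<in> {a..b}" and eq: "eventually (\<lambda>w. f t w = g t w) (nhds (\<gamma> t))"
  shows "eventually (\<lambda>w. f u w = g u w) (nhds (\<gamma> u))"
proof -
  define P where "P t \<longleftrightarrow> eventually (\<lambda>w. f t w = g t w) (nhds (\<gamma> t))" for t
  have "eventually (\<lambda>s. P t = P s) (at t within {a..b})" if t: "t \<in> {a..b}" for t
  proof -
    obtain d where d: "d > 0" "\<And>s. s \<in> {a..b} \<Longrightarrow> \<bar>s - t\<bar> < d \<Longrightarrow> \<gamma> s \<in> ball (\<gamma> t) (R t) \<and>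
        (\<forall>z\<in>ball (\<gamma> s) (R s) \<inter> ball (\<gamma> t) (R t). f s z = f t z)"
      using f t unfolding cont_data_def by blast
    obtain e where e: "e > 0" "\<And>s. s \<in> {a..b} \<Longrightarrow> \<bar>s - t\<bar> < e \<Longrightarrow> \<gamma> s \<in> ball (\<gamma> t) (Q t) \<and>
        (\<forall>z\<in>ball (\<gamma> s) (Q s) \<inter> ball (\<gamma> t) (Q t). g s z = g t z)"
      using g t unfolding cont_data_def by blast
    have "P t = P s" if s: "s \<in> {a..b}" "dist s t < min d e" for s
    proof -
      have ds: "\<gamma> s \<in> ball (\<gamma> t) (R t)" "\<And>z. z \<in> ball (\<gamma> s) (R s) \<inter> ball (\<gamma> t) (R t) \<Longrightarrow> f s z = f t z"
        "\<gamma> s \<in> ball (\<gamma> t) (Q t)" "\<And>z. z \<in> ball (\<gamma> s) (Q s) \<inter> ball (\<gamma> t) (Q t) \<Longrightarrow> g s z = g t z"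
        using d(2)[OF s(1)] e(2)[OF s(1)] s(2) by (auto simp: dist_real_def)
      have pos: "R s > 0" "Q s > 0" "R t > 0" "Q t > 0" using f g s(1) t by (auto simp: cont_data_def)
      define m where "m = min (R t) (Q t)"
      have "eventually (\<lambda>z. z \<in> ball (\<gamma> s) (R s) \<inter> ball (\<gamma> t) (R t)) (nhds (\<gamma> s))"
           "eventually (\<lambda>z. z \<in> ball (\<gamma> s) (Q s) \<inter> ball (\<gamma> t) (Q t)) (nhds (\<gamma> s))"
        by (intro eventually_nhds_in_open open_Int open_ball; use ds pos in simp)+
      then have "eventually (\<lambda>z. (f s z = g s z) = (f t z = g t z)) (nhds (\<gamma> s))"
        by eventually_elim (use ds in auto)
      then have "P s \<longleftrightarrow> eventually (\<lambda>w. f t w = g t w) (nhds (\<gamma> s))"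
        unfolding P_def by (rule eventually_subst)
      also have "\<dots> \<longleftrightarrow> P t"
      proof -
        have hol: "f t holomorphic_on ball (\<gamma> t) m" "g t holomorphic_on ball (\<gamma> t) m"
        proof -
          have "f t holomorphic_on ball (\<gamma> t) (R t)" "g t holomorphic_on ball (\<gamma> t) (Q t)"
            using f g t by (auto simp: cont_data_def)
          then show "f t holomorphic_on ball (\<gamma> t) m" "g t holomorphic_on ball (\<gamma> t) m"
            by (auto intro: holomorphic_on_subset simp: m_def)
        qed
        have in_m: "\<gamma> s \<in> ball (\<gamma> t) m" "\<gamma> t \<in> ball (\<gamma> t) m" using ds pos by (auto simp: m_def)
        have "eventually (\<lambda>w. f t w = g t w) (nhds y)"
          if "x \<in> ball (\<gamma> t) m" "y \<in> ball (\<gamma> t) m" "eventually (\<lambda>w. f t w = g t w) (nhds x)" for x y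
          using eventually_agree_imp_agree_ball[OF hol that(1,3)] that(2)
          by (intro eventually_nhds_in_open[of "ball (\<gamma> t) m", THEN eventually_mono]) auto
        then show ?thesis unfolding P_def using in_m by blast
      qed
      finally show ?thesis by simp
    qed
    then show ?thesis
      unfolding eventually_at using d(1) e(1) by (intro exI[of _ "min d e"]) auto
  qed
  then have "P t = P u"
    using connected_local_const[of "{a..b}" t u P] assms by auto
  then show ?thesis using eq by (simp add: P_def)
qed

text \<open>The radius at \<open>t\<close> is the distance from \<open>\<gamma> t\<close> to the
  boundary circle, so every disc stays inside the given one.\<close>

lemma cont_data_constant:
  assumes g: "g holomorphic_on ball z r" and lip: "1-lipschitz_on {a..b} \<gamma>"
    and sub: "\<And>t. t \<in> {a..b} \<Longrightarrow> \<gamma> t \<in> ball z r"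
  shows "cont_data \<gamma> a b (\<lambda>_. g) (\<lambda>t. r - cmod (\<gamma> t - z))"
  unfolding cont_data_def
proof (intro conjI ballI)
  fix t assume t: "t \<in> {a..b}"
  show pos: "r - cmod (\<gamma> t - z) > 0" using sub[OF t] by (simp add: dist_norm norm_minus_commute)
  have "ball (\<gamma> t) (r - cmod (\<gamma> t - z)) \<subseteq> ball z r"
    by (auto simp: dist_norm) (metis add.commute dist_norm dist_triangle_lt less_diff_eq norm_minus_commute)
  then show "g holomorphic_on ball (\<gamma> t) (r - cmod (\<gamma> t - z))" using g holomorphic_on_subset by blast
  show "\<exists>d>0. \<forall>s\<in>{a..b}. \<bar>s - t\<bar> < d \<longrightarrow> \<gamma> s \<in> ball (\<gamma> t) (r - cmod (\<gamma> t - z)) \<and>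
        (\<forall>w\<in>ball (\<gamma> s) (r - cmod (\<gamma> s - z)) \<inter> ball (\<gamma> t) (r - cmod (\<gamma> t - z)). g w = g w)"
  proof (intro exI[of _ "r - cmod (\<gamma> t - z)"] conjI pos ballI impI refl)
    fix s assume "s \<in> {a..b}" "\<bar>s - t\<bar> < r - cmod (\<gamma> t - z)"
    then show "\<gamma> s \<in> ball (\<gamma> t) (r - cmod (\<gamma> t - z))"
      using lipschitz_onD[OF lip t, of s] by (simp add: dist_real_def abs_minus_commute)
  qed
qed

section \<open>Unit-speed paths and their extension by straight segments\<close>

definition ray :: "complex \<Rightarrow> complex \<Rightarrow> real \<Rightarrow> complex" where
  "ray z p t = z + t *\<^sub>R sgn (p - z)"

lemma ray_0 [simp]: "ray z p 0 = z" and ray_end [simp]: "ray z p (cmod (p - z)) = p"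
  by (auto simp: ray_def sgn_div_norm) (cases "p = z"; simp)

lemma norm_ray: "p \<noteq> z \<Longrightarrow> cmod (ray z p t - ray z p s) = \<bar>t - s\<bar>"
  by (simp add: ray_def norm_sgn flip: scaleR_diff_left)

lemma norm_ray': "p \<noteq> z \<Longrightarrow> cmod (ray z p t - z) = \<bar>t\<bar>"
  by (simp add: ray_def norm_sgn)

lemma ray_lipschitz: "p \<noteq> z \<Longrightarrow> 1-lipschitz_on S (\<lambda>t. ray z p (t - c))"
  by (intro lipschitz_onI) (simp_all add: dist_norm norm_ray)

lemma ray_in_segment:
  assumes "t \<in> {0..cmod (p - z)}" shows "ray z p t \<in> closed_segment z p"
proof (cases "p = z")
  case False
  then show ?thesis
    using assms by (auto simp: in_segment ray_def sgn_div_norm algebra_simps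
        intro!: exI[of _ "t / cmod (p - z)"]) (simp add: field_simps)
qed (use assms in auto)

text \<open>Besides bounding the length, this makes the supremum in \<open>path_length\<close> one
  of a set bounded above.\<close>

lemma lipschitz_partition_sum_le:
  assumes "C-lipschitz_on {0..1} \<gamma>"
    and "p \<in> {(n, t). t 0 = 0 \<and> t n = (1::real) \<and> (\<forall>i<n. t i \<le> t (Suc i))}"
  shows "(\<Sum>i<fst p. cmod (\<gamma> (snd p (Suc i)) - \<gamma> (snd p i))) \<le> C"
proof -
  obtain n t where p: "p = (n, t)" "t 0 = 0" "t n = 1" "\<And>i. i < n \<Longrightarrow> t i \<le> t (Suc i)" using assms(2) by auto
  have mono: "t i \<le> t j" if "i \<le> j" "j \<le> n" for i j
    using that by (induction j rule: dec_induct) (use p(4) in \<open>auto intro: order_trans\<close>)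
  have range: "t i \<in> {0..1}" if "i \<le> n" for i
    using mono[of 0 i] mono[of i n] that p(2,3) by auto
  have "(\<Sum>i<n. cmod (\<gamma> (t (Suc i)) - \<gamma> (t i))) \<le> (\<Sum>i<n. C * (t (Suc i) - t i))"
  proof (rule sum_mono)
    fix i assume "i \<in> {..<n}"
    then show "cmod (\<gamma> (t (Suc i)) - \<gamma> (t i)) \<le> C * (t (Suc i) - t i)"
      using lipschitz_on_normD[OF assms(1) range range, of "Suc i" i] p(4)[of i] by simp
  qed
  also have "\<dots> = C" by (simp add: sum_lessThan_telescope p flip: sum_distrib_left)
  finally show ?thesis by (simp add: p(1))
qed

lemma path_length_le:
  assumes "C-lipschitz_on {0..1} \<gamma>"
  shows "path_length \<gamma> \<le> C"
  unfolding path_length_def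
proof (rule cSUP_least)
  have "(1, real) \<in> {(n, t). t 0 = 0 \<and> t n = 1 \<and> (\<forall>i<n. t i \<le> t (Suc i))}" by simp
  then show "{(n, t). t 0 = 0 \<and> t n = (1::real) \<and> (\<forall>i<n. t i \<le> t (Suc i))} \<noteq> {}" by blast
qed (rule lipschitz_partition_sum_le[OF assms])

locale path_continuation =
  fixes a :: "complex fps" and F :: "complex set" and L :: real
  assumes cont: "\<And>\<gamma> C. C-lipschitz_on {0..1} \<gamma> \<Longrightarrow> path_length \<gamma> < L \<Longrightarrow> \<gamma> 0 = 0 \<Longrightarrow>
      \<gamma> ` {0<..1} \<subseteq> - F \<Longrightarrow> continuable_along a \<gamma>"
begin

text \<open>Rescaling to the unit interval gives an \<open>l\<close>-Lipschitz path, whose length is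
  therefore at most \<open>l\<close>.\<close>

lemma cont_unit_speed:
  assumes l: "0 < l" "l < L" and lip: "1-lipschitz_on {0..l} \<gamma>" and "\<gamma> 0 = 0" "\<gamma> ` {0<..l} \<subseteq> - F"
  shows "\<exists>f R. cont_data \<gamma> 0 l f R \<and> eventually (\<lambda>w. f 0 w = eval_fps a w) (nhds 0)"
proof -
  let ?\<gamma> = "\<lambda>t. \<gamma> (l * t)"
  have lip': "l-lipschitz_on {0..1} ?\<gamma>"
  proof (rule lipschitz_onI)
    fix x y :: real assume "x \<in> {0..1}" "y \<in> {0..1}"
    then show "dist (?\<gamma> x) (?\<gamma> y) \<le> l * dist x y"
      using lipschitz_onD[OF lip, of "l * x" "l * y"] l
      by (simp add: dist_real_def abs_mult flip: right_diff_distrib)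
  qed (use l in auto)
  from path_length_le[OF this] have "path_length ?\<gamma> < L" using l by simp
  moreover have "?\<gamma> ` {0<..1} \<subseteq> - F"
  proof
    fix w assume "w \<in> ?\<gamma> ` {0<..1}"
    then obtain t where t: "t \<in> {0<..1}" "w = \<gamma> (l * t)" by auto
    then have "l * t \<in> {0<..l}" using l by (auto simp: mult_left_le)
    then show "w \<in> - F" using assms(5) t by blast
  qed
  ultimately have "continuable_along a ?\<gamma>"
    using cont[OF lip'] assms(4) by simp
  then obtain f R where fR: "cont_data ?\<gamma> 0 1 f R" "\<exists>\<rho>>0. \<forall>z\<in>ball 0 \<rho>. f 0 z = eval_fps a z"
    unfolding continuable_along_def cont_data_def by auto
  have "cont_data \<gamma> 0 l (\<lambda>t. f (t / l)) (\<lambda>t. R (t / l))"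
    unfolding cont_data_def
  proof (intro conjI ballI)
    fix t assume t: "t \<in> {0..l}"
    have t': "t / l \<in> {0..1}" "l * (t / l) = t" using t l by auto
    then show "R (t / l) > 0" "f (t / l) holomorphic_on ball (\<gamma> t) (R (t / l))"
      using fR(1) l unfolding cont_data_def by force+
    obtain d where d: "d > 0" "\<And>s. s \<in> {0..1} \<Longrightarrow> \<bar>s - t / l\<bar> < d \<Longrightarrow> \<gamma> (l * s) \<in> ball (\<gamma> (l * (t / l))) (R (t / l)) \<and>
        (\<forall>z\<in>ball (\<gamma> (l * s)) (R s) \<inter> ball (\<gamma> (l * (t / l))) (R (t / l)). f s z = f (t / l) z)"
      using fR(1) t'(1) unfolding cont_data_def by blast
    show "\<exists>d>0. \<forall>s\<in>{0..l}. \<bar>s - t\<bar> < d \<longrightarrow> \<gamma> s \<in> ball (\<gamma> t) (R (t / l)) \<and>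
        (\<forall>z\<in>ball (\<gamma> s) (R (s / l)) \<inter> ball (\<gamma> t) (R (t / l)). f (s / l) z = f (t / l) z)"
    proof (intro exI[of _ "d * l"] conjI ballI impI)
      show "d * l > 0" using d l by simp
      fix s assume s: "s \<in> {0..l}" "\<bar>s - t\<bar> < d * l"
      have "\<bar>s / l - t / l\<bar> = \<bar>s - t\<bar> / l" using l by (simp flip: diff_divide_distrib)
      then have *: "s / l \<in> {0..1}" "\<bar>s / l - t / l\<bar> < d" "l * (s / l) = s"
        using s l by (auto simp: pos_divide_less_eq)
      show "\<gamma> s \<in> ball (\<gamma> t) (R (t / l))"
        using d(2)[OF *(1,2)] unfolding *(3) t'(2) by blast
      show "f (s / l) z = f (t / l) z" if "z \<in> ball (\<gamma> s) (R (s / l)) \<inter> ball (\<gamma> t) (R (t / l))" for z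
        using d(2)[OF *(1,2)] that unfolding *(3) t'(2) by blast
    qed
  qed
  moreover obtain \<rho> where "\<rho> > 0" "\<forall>z\<in>ball 0 \<rho>. f 0 z = eval_fps a z" using fR(2) by blast
  then have "eventually (\<lambda>w. f (0 / l) w = eval_fps a w) (nhds 0)"
    using eventually_nhds_in_open[of "ball 0 \<rho>" "0::complex"] by (auto elim: eventually_mono)
  ultimately show ?thesis
    by (intro exI[of _ "\<lambda>t. f (t / l)"] exI[of _ "\<lambda>t. R (t / l)"]) auto
qed

text \<open>Paths are parametrised on \<open>{0..l}\<close> with speed at most 1, so \<open>l\<close> bounds their length.\<close>
definition reach :: "real \<Rightarrow> complex \<Rightarrow> (complex \<Rightarrow> complex) \<Rightarrow> bool" where
  "reach l z g \<longleftrightarrow> 0 < l \<and> (\<exists>\<gamma> f R. 1-lipschitz_on {0..l} \<gamma> \<and> \<gamma> 0 = 0 \<and> \<gamma> l = z \<and> \<gamma> ` {0<..l} \<subseteq> - F \<and>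
     cont_data \<gamma> 0 l f R \<and> eventually (\<lambda>w. f 0 w = eval_fps a w) (nhds 0) \<and>
     eventually (\<lambda>w. f l w = g w) (nhds z))"

lemma reach_cong:
  assumes "reach l z g" "eventually (\<lambda>w. g' w = g w) (nhds z)"
  shows "reach l z g'"
proof -
  obtain \<gamma> f R where 1: "0 < l" "1-lipschitz_on {0..l} \<gamma>" "\<gamma> 0 = 0" "\<gamma> l = z" "\<gamma> ` {0<..l} \<subseteq> - F"
     "cont_data \<gamma> 0 l f R" "eventually (\<lambda>w. f 0 w = eval_fps a w) (nhds 0)"
     "eventually (\<lambda>w. f l w = g w) (nhds z)"
    using assms(1) unfolding reach_def by blast
  have "eventually (\<lambda>w. f l w = g' w) (nhds z)"
    using 1(8) assms(2) by eventually_elim simp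
  then show ?thesis unfolding reach_def using 1 by blast
qed

text \<open>The path prolonged by a segment is admissible, so a continuation along it exists. By
  uniqueness it agrees with the old one up to \<open>z\<close> and then with \<open>g\<close>. The
  case \<open>cmod (p - z) = r\<close> is included because \<open>reach_ball\<close> extends to
  points on a circle.\<close>

lemma reach_extend:
  assumes reach: "reach l z g" and g: "g holomorphic_on ball z r" and "r > 0"
    and p: "p \<noteq> z" "cmod (p - z) \<le> r" and F: "closed_segment z p \<inter> F = {}" and len: "l + cmod (p - z) < L"
  shows "\<exists>g' Q. Q > 0 \<and> g' holomorphic_on ball p Q \<and> (\<forall>w\<in>ball p Q \<inter> ball z r. g' w = g w) \<and>
     reach (l + cmod (p - z)) p g'"
proof -
  obtain \<gamma> f R where \<gamma>: "0 < l" "1-lipschitz_on {0..l} \<gamma>" "\<gamma> 0 = 0" "\<gamma> l = z" "\<gamma> ` {0<..l} \<subseteq> - F"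
     and f: "cont_data \<gamma> 0 l f R" "eventually (\<lambda>w. f 0 w = eval_fps a w) (nhds 0)"
     "eventually (\<lambda>w. f l w = g w) (nhds z)"
    using reach unfolding reach_def by blast
  define d where "d = cmod (p - z)"
  have d: "d > 0" "d \<le> r" using p by (auto simp: d_def)
  define \<beta> where "\<beta> t = (if t \<le> l then \<gamma> t else ray z p (t - l))" for t
  have lip: "1-lipschitz_on {0..l + d} \<beta>"
    unfolding \<beta>_def by (rule lipschitz_on_concat[OF \<gamma>(2) ray_lipschitz[OF p(1)]]) (simp add: \<gamma>(4))
  have \<beta>_ray: "\<beta> t = ray z p (t - l)" if "t \<ge> l" for t
    using that \<gamma>(4) by (auto simp: \<beta>_def)
  have \<beta>_0: "\<beta> 0 = 0" and \<beta>_end: "\<beta> (l + d) = p" and \<beta>_l: "\<beta> l = z"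
    using \<gamma> d by (auto simp: \<beta>_def d_def)
  have avoid: "\<beta> ` {0<..l + d} \<subseteq> - F"
  proof
    fix w assume "w \<in> \<beta> ` {0<..l + d}"
    then obtain t where t: "t \<in> {0<..l + d}" "w = \<beta> t" by auto
    show "w \<in> - F"
    proof (cases "t \<le> l")
      case True
      then have "w \<in> \<gamma> ` {0<..l}" using t by (simp add: \<beta>_def)
      then show ?thesis using \<gamma>(5) by blast
    next
      case False
      then have "w \<in> closed_segment z p"
        using t ray_in_segment[of "t - l" p z] by (auto simp: \<beta>_def d_def)
      then show ?thesis using F by auto
    qed
  qed
  obtain h Q where h: "cont_data \<beta> 0 (l + d) h Q" "eventually (\<lambda>w. h 0 w = eval_fps a w) (nhds 0)"
  proof -
    have "0 < l + d" "l + d < L" using \<gamma>(1) d(1) len unfolding d_def by linarith+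
    from cont_unit_speed[OF this lip \<beta>_0 avoid] show thesis using that by blast
  qed
  have "cont_data \<beta> 0 l f R"
    by (rule cont_data_subset[OF f(1)]) (auto simp: \<beta>_def)
  moreover have "cont_data \<beta> 0 l h Q"
    by (rule cont_data_subset[OF h(1)]) (use d in auto)
  moreover have "eventually (\<lambda>w. f 0 w = h 0 w) (nhds (\<beta> 0))"
    using f(2) h(2) unfolding \<beta>_0 by eventually_elim simp
  ultimately have "eventually (\<lambda>w. f l w = h l w) (nhds (\<beta> l))"
    using cont_data_unique[of \<beta> 0 l f R h Q 0 l] \<gamma>(1) by simp
  with f(3) have hl: "eventually (\<lambda>w. h l w = g w) (nhds z)"
    unfolding \<beta>_l by eventually_elim simp
  \<comment> \<open>The endpoint is left out, as it may lie on the boundary circle, where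
    \<open>g\<close> is not controlled.\<close>
  have h_eq: "eventually (\<lambda>w. h t w = g w) (nhds (\<beta> t))" if t: "l \<le> t" "t < l + d" for t
  proof -
    have in_r: "\<beta> u \<in> ball z r" if "u \<in> {l..t}" for u
      using that t d norm_ray'[OF p(1), of "u - l"] by (simp add: \<beta>_ray dist_norm norm_minus_commute)
    have "cont_data \<beta> l t (\<lambda>_. g) (\<lambda>u. r - cmod (\<beta> u - z))"
      by (rule cont_data_constant[OF g _ in_r]) (use lip t \<gamma>(1) in \<open>auto elim!: lipschitz_on_subset\<close>)
    moreover have "cont_data \<beta> l t h Q"
      by (rule cont_data_subset[OF h(1)]) (use t \<gamma>(1) in auto)
    ultimately show ?thesis
      using cont_data_unique[of \<beta> l t h Q "\<lambda>_. g" "\<lambda>u. r - cmod (\<beta> u - z)" l t] hl \<beta>_l t by simp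
  qed
  let ?T = "l + d"
  have T: "?T \<in> {0..?T}" using \<gamma>(1) d by auto
  have Q: "Q ?T > 0" "h ?T holomorphic_on ball p (Q ?T)"
    using h(1) T unfolding cont_data_def \<beta>_end[symmetric] by blast+
  obtain e where e: "e > 0" "\<And>s. s \<in> {0..?T} \<Longrightarrow> \<bar>s - ?T\<bar> < e \<Longrightarrow> \<beta> s \<in> ball p (Q ?T) \<and>
      (\<forall>w\<in>ball (\<beta> s) (Q s) \<inter> ball p (Q ?T). h s w = h ?T w)"
    using h(1) T unfolding cont_data_def \<beta>_end[symmetric] by blast
  \<comment> \<open>A parameter just before the end, whose germ agrees with the final one and, by
    \<open>h_eq\<close>, with \<open>g\<close>.\<close>
  define s where "s = ?T - min (e / 2) (d / 2)"
  have s: "s \<in> {0..?T}" "\<bar>s - ?T\<bar> < e" "l \<le> s" "s < ?T"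
    using e(1) d \<gamma>(1) by (auto simp: s_def min_def)
  have \<beta>s: "\<beta> s \<in> ball z r"
    using s d norm_ray'[OF p(1), of "s - l"] by (simp add: \<beta>_ray dist_norm norm_minus_commute)
  have "Q s > 0" using h(1) s(1) by (simp add: cont_data_def)
  then have "eventually (\<lambda>w. w \<in> ball (\<beta> s) (Q s) \<inter> ball p (Q ?T)) (nhds (\<beta> s))"
    using e(2)[OF s(1,2)] by (intro eventually_nhds_in_open) auto
  then have "eventually (\<lambda>w. h ?T w = g w) (nhds (\<beta> s))"
    using h_eq[OF s(3,4)] by eventually_elim (use e(2)[OF s(1,2)] in auto)
  then obtain U where U: "open U" "\<beta> s \<in> U" "\<And>w. w \<in> U \<Longrightarrow> h ?T w = g w"
    by (auto simp: eventually_nhds)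
  have "h ?T w = g w" if "w \<in> ball p (Q ?T) \<inter> ball z r" for w
    by (rule holomorphic_agree_Int_balls[OF Q(2) g, of "U \<inter> (ball p (Q ?T) \<inter> ball z r)"])
       (use U that e(2)[OF s(1,2)] \<beta>s in auto)
  moreover have "reach ?T p (h ?T)"
    unfolding reach_def
    by (intro conjI exI[of _ \<beta>] exI[of _ h] exI[of _ Q]) (use lip \<beta>_0 \<beta>_end avoid h \<gamma>(1) d in auto)
  ultimately show ?thesis using Q unfolding d_def by blast
qed

end

context path_continuation
begin

text \<open>
  If the radius of convergence at \<open>z\<close> were some \<open>c < r\<close>, the continuations along all rays to the circle
  of radius \<open>c\<close> could be glued to a holomorphic function on a larger disc.
\<close>
lemma reach_ball:
  assumes reach: "reach l z g" and "r > 0" and F: "ball z r \<inter> F = {}" and len: "l + r \<le> L"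
  shows "\<exists>g'. g' holomorphic_on ball z r \<and> eventually (\<lambda>w. g' w = g w) (nhds z)"
proof -
  obtain \<gamma> f R where f: "0 < l" "cont_data \<gamma> 0 l f R" "\<gamma> l = z" "eventually (\<lambda>w. f l w = g w) (nhds z)"
    using reach unfolding reach_def by blast
  have R: "R l > 0" "f l holomorphic_on ball z (R l)"
    using f by (auto simp: cont_data_def)
  define A where "A = fps_expansion (f l) z"
  define G where "G w = eval_fps A (w - z)" for w
  have A_R: "ereal (R l) \<le> fps_conv_radius A"
    unfolding A_def using R(2) by (intro conv_radius_fps_expansion) simp
  have G_f: "G w = f l w" if "w \<in> ball z (R l)" for w
    unfolding G_def A_def using eval_fps_expansion[of "f l" z "ereal (R l)" w] R(2) that by simp
  then have "eventually (\<lambda>w. G w = f l w) (nhds z)"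
    using eventually_nhds_in_open[of "ball z (R l)" z] R(1) by (auto elim: eventually_mono)
  then have G_g: "eventually (\<lambda>w. G w = g w) (nhds z)"
    using f(4) by eventually_elim simp
  have G_hol: "G holomorphic_on ball z c" if "ereal c \<le> fps_conv_radius A" for c
    unfolding G_def
    by (rule holomorphic_on_compose_gen[OF _ eval_fps_holomorphic_ball[OF that], unfolded o_def])
       (auto simp: dist_norm norm_minus_commute intro!: holomorphic_intros)
  show ?thesis
  proof (cases "ereal r \<le> fps_conv_radius A")
    case True
    then show ?thesis using G_hol G_g by blast
  next
    case False
    then obtain c where c: "fps_conv_radius A = ereal c" "c < r"
      using A_R by (cases "fps_conv_radius A") auto
    have c0: "c > 0" using A_R R(1) c by simp
    have Gc: "G holomorphic_on ball z c" by (rule G_hol) (simp add: c)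
    have reachG: "reach l z G" using reach_cong[OF reach G_g] .
    have "\<exists>h Q. Q > 0 \<and> h holomorphic_on ball p Q \<and> (\<forall>w\<in>ball p Q \<inter> ball z c. h w = G w)"
      if p: "p \<in> sphere z c" for p
    proof -
      have "closed_segment z p \<subseteq> ball z r"
        using p c(2) \<open>r > 0\<close> by (intro closed_segment_subset_ball) auto
      then have seg: "closed_segment z p \<inter> F = {}" using F by blast
      have "p \<noteq> z" "cmod (p - z) \<le> c" "l + cmod (p - z) < L"
        using p c0 c(2) len by (auto simp: dist_norm norm_minus_commute)
      from reach_extend[OF reachG Gc c0 this(1,2) seg this(3)] show ?thesis by blast
    qed
    then obtain h Q where h: "\<And>p. p \<in> sphere z c \<Longrightarrow> Q p > 0" "\<And>p. p \<in> sphere z c \<Longrightarrow> h p holomorphic_on ball p (Q p)"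
      "\<And>p w. p \<in> sphere z c \<Longrightarrow> w \<in> ball p (Q p) \<inter> ball z c \<Longrightarrow> h p w = G w"
      by metis
    \<comment> \<open>With halved radii, the centre of the smaller disc lies in the larger disc. As
      it is on the circle, both discs meet inside \<open>ball z c\<close>, where both functions
      equal \<open>G\<close>.\<close>
    have agree: "h p w = h q w" if p: "p \<in> sphere z c" and q: "q \<in> sphere z c" and le: "Q q \<le> Q p"
      and w: "w \<in> ball p (Q p / 2) \<inter> ball q (Q q / 2)" for p q w
    proof (rule holomorphic_agree_Int_balls[OF h(2)[OF p] h(2)[OF q]])
      let ?U = "ball p (Q p) \<inter> ball q (Q q) \<inter> ball z c"
      show "open ?U" by auto
      show "?U \<subseteq> ball p (Q p) \<inter> ball q (Q q)" by auto
      show "h p x = h q x" if "x \<in> ?U" for x using h(3)[OF p, of x] h(3)[OF q, of x] that by auto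
      show "w \<in> ball p (Q p) \<inter> ball q (Q q)" using w h(1)[OF p] h(1)[OF q] by auto
      have "dist p q \<le> dist p w + dist w q" by (rule dist_triangle)
      then have "q \<in> ball p (Q p)" using w le by (auto simp: dist_commute)
      moreover have "q \<in> closure (ball z c)" using q c0 by (simp add: dist_norm)
      ultimately have "ball z c \<inter> (ball p (Q p) \<inter> ball q (Q q)) \<noteq> {}"
        using h(1)[OF q] open_Int_closure_eq_empty[OF open_Int[OF open_ball open_ball], of p "Q p" q "Q q" "ball z c"]
        by (metis IntI Int_commute centre_in_ball empty_iff)
      then show "?U \<noteq> {}" by blast
    qed
    define H where "H w = (if w \<in> ball z c then G w
        else h (SOME p. p \<in> sphere z c \<and> w \<in> ball p (Q p / 2)) w)" for w
    have H_h: "H w = h p w" if p: "p \<in> sphere z c" "w \<in> ball p (Q p / 2)" for p w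
    proof (cases "w \<in> ball z c")
      case True
      then show ?thesis using h(1)[OF p(1)] h(3)[OF p(1), of w] p(2) by (auto simp: H_def)
    next
      case False
      define q where "q = (SOME p. p \<in> sphere z c \<and> w \<in> ball p (Q p / 2))"
      have q: "q \<in> sphere z c \<and> w \<in> ball q (Q q / 2)"
        unfolding q_def by (rule someI[of _ p]) (use p in auto)
      have "h p w = h q w"
        using agree[of p q w] agree[of q p w] p q by (cases "Q q \<le> Q p") auto
      then show ?thesis using False by (simp add: H_def q_def)
    qed
    define S where "S = ball z c \<union> (\<Union>p\<in>sphere z c. ball p (Q p / 2))"
    have "H holomorphic_on (\<Union>p\<in>sphere z c. ball p (Q p / 2))"
    proof (rule holomorphic_on_UN_open)
      fix p assume p: "p \<in> sphere z c"
      have "h p holomorphic_on ball p (Q p / 2)"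
        using h(2)[OF p] h(1)[OF p] by (auto elim!: holomorphic_on_subset)
      then show "H holomorphic_on ball p (Q p / 2)"
        by (rule holomorphic_transform[OF _ H_h[OF p, symmetric]])
    qed auto
    moreover have "H holomorphic_on ball z c"
      by (rule holomorphic_transform[OF Gc]) (simp add: H_def)
    ultimately have H_S: "H holomorphic_on S"
      unfolding S_def by (intro holomorphic_on_Un) auto
    have "cball z c \<subseteq> S"
    proof
      fix w assume "w \<in> cball z c"
      then have "w \<in> ball z c \<or> w \<in> sphere z c" by auto
      then show "w \<in> S" unfolding S_def using h(1) by force
    qed
    moreover have "open S" unfolding S_def by auto
    \<comment> \<open>By compactness \<open>S\<close> contains a uniform neighbourhood of the closed
      disc, so \<open>H\<close> is holomorphic on a disc of radius \<open>c + e\<close> and the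
      radius of convergence exceeds \<open>c\<close>.\<close>
    ultimately obtain e where e: "e > 0" "(\<Union>x\<in>cball z c. ball x e) \<subseteq> S"
      using compact_subset_open_imp_ball_epsilon_subset[OF compact_cball] by metis
    have "ball z (c + e) \<subseteq> S"
    proof
      fix w assume w: "w \<in> ball z (c + e)"
      show "w \<in> S"
      proof (cases "w \<in> cball z c")
        case True
        then show ?thesis using \<open>cball z c \<subseteq> S\<close> by blast
      next
        case False
        define x where "x = ray z w c"
        have wz: "w \<noteq> z" using False c0 by auto
        have "x \<in> cball z c"
          using norm_ray'[OF wz, of c] c0 by (simp add: x_def dist_norm norm_minus_commute)
        moreover have "cmod (w - x) = \<bar>cmod (w - z) - c\<bar>"
          using norm_ray[OF wz, of "cmod (w - z)" c] by (simp add: x_def)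
        then have "w \<in> ball x e"
          using w False by (simp add: dist_norm norm_minus_commute)
        ultimately show ?thesis using e(2) by blast
      qed
    qed
    then have "H holomorphic_on eball z (ereal (c + e))"
      using H_S by (auto elim: holomorphic_on_subset)
    then have "ereal (c + e) \<le> fps_conv_radius (fps_expansion H z)"
      by (rule conv_radius_fps_expansion)
    moreover have "fps_expansion H z = A"
      unfolding A_def
    proof (rule fps_expansion_cong)
      have "eventually (\<lambda>w. w \<in> ball z c \<and> w \<in> ball z (R l)) (nhds z)"
        using c0 R(1) eventually_nhds_in_open[OF open_Int[OF open_ball open_ball], of z z c z "R l"] by simp
      then show "eventually (\<lambda>w. H w = f l w) (nhds z)"
        by eventually_elim (use G_f in \<open>auto simp: H_def\<close>)
    qed
    ultimately have False using c e(1) by simp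
    then show ?thesis ..
  qed
qed

lemma reach_ray:
  assumes "p \<noteq> 0" "cmod p < r" "ereal r \<le> fps_conv_radius a" "F \<inter> ball 0 r \<subseteq> {0}"
  shows "reach (cmod p) p (eval_fps a)"
proof -
  have lip: "1-lipschitz_on {0..cmod p} (ray 0 p)"
    using ray_lipschitz[OF assms(1), of _ 0] by simp
  have norm: "cmod (ray 0 p t) = \<bar>t\<bar>" for t using norm_ray'[OF assms(1), of t] by simp
  have "cont_data (ray 0 p) 0 (cmod p) (\<lambda>_. eval_fps a) (\<lambda>t. r - cmod (ray 0 p t - 0))"
    by (rule cont_data_constant[OF eval_fps_holomorphic_ball[OF assms(3)] lip])
       (use norm assms(2) in auto)
  moreover have "ray 0 p ` {0<..cmod p} \<subseteq> - F"
  proof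
    fix w assume "w \<in> ray 0 p ` {0<..cmod p}"
    then obtain t where t: "0 < t" "t \<le> cmod p" "w = ray 0 p t" by auto
    then have "w \<noteq> 0" "w \<in> ball 0 r" using norm[of t] assms(2) by auto
    then show "w \<in> - F" using assms(4) by blast
  qed
  moreover have "ray 0 p (cmod p) = p" using ray_end[of 0 p] by simp
  ultimately show ?thesis
    unfolding reach_def using lip assms(1)
    by (intro conjI exI[of _ "ray 0 p"] exI[of _ "\<lambda>_. eval_fps a"] exI) auto
qed

text \<open>
  As long as the chain is shorter than \<open>2 * \<rho>\<close> it may touch \<open>0 \<in> F\<close>, but there the germ is the original
  one; the first vertex beyond that length is reached from \<open>0\<close> by a straight segment instead.
\<close>
lemma chain_continuation:
  assumes \<rho>: "\<rho> > 0" and F0: "0 \<in> F" "F \<inter> ball 0 (4 * \<rho>) \<subseteq> {0}" and rad: "ereal (4 * \<rho>) \<le> fps_conv_radius a"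
    and R: "0 < R" "R < \<delta>" "R \<le> \<rho>" and clear: "clear_chain F (2 * \<rho>) \<delta> x K"
    and steps: "\<And>j. j < K \<Longrightarrow> cmod (x (Suc j) - x j) < R" and len: "chain_length x K + R < L"
  shows "\<exists>p. chain_cont (eval_fps a) x K R p"
proof -
  have x0: "x 0 = 0" using clear by (simp add: clear_chain_def)
  have hol: "eval_fps a holomorphic_on ball 0 (4 * \<rho>)" using rad by (rule eval_fps_holomorphic_ball)
  have small: "ball (x j) R \<subseteq> ball 0 (4 * \<rho>)" if "chain_length x j < 3 * \<rho>" for j
  proof
    fix w assume "w \<in> ball (x j) R"
    moreover have "cmod (x j) < 3 * \<rho>" using norm_le_chain_length[of x j] x0 that by simp
    moreover have "cmod w \<le> cmod (x j) + cmod (w - x j)"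
      using norm_triangle_ineq[of "x j" "w - x j"] by simp
    ultimately show "w \<in> ball 0 (4 * \<rho>)" using R(3) by (simp add: dist_norm norm_minus_commute)
  qed
  have away: "ball (x j) R \<inter> F = {}" if "j \<le> K" "2 * \<rho> \<le> chain_length x j" for j
    using clear that R(2) unfolding clear_chain_def by (force simp: dist_norm)
  \<comment> \<open>Beyond length \<open>2 * \<rho>\<close> the invariant records a path no longer
    than the chain that avoids \<open>F\<close> and leads to the germ, as needed to apply
    \<open>reach_extend\<close> and \<open>reach_ball\<close>.\<close>
  have "\<exists>p. chain_cont (eval_fps a) x k R p \<and> (chain_length x k < 2 * \<rho> \<longrightarrow> p k = eval_fps a) \<and>
      (2 * \<rho> \<le> chain_length x k \<longrightarrow> (\<exists>l\<le>chain_length x k. reach l (x k) (p k)))" if "k \<le> K" for k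
    using that
  proof (induction k)
    case 0
    have "eval_fps a holomorphic_on ball (x 0) R"
      using holomorphic_on_subset[OF hol small[of 0]] \<rho> by simp
    then show ?case using \<rho> by (intro exI[of _ "\<lambda>_. eval_fps a"]) (simp add: chain_cont_def)
  next
    case (Suc k)
    then obtain p where p: "chain_cont (eval_fps a) x k R p" "chain_length x k < 2 * \<rho> \<Longrightarrow> p k = eval_fps a"
      "2 * \<rho> \<le> chain_length x k \<Longrightarrow> \<exists>l\<le>chain_length x k. reach l (x k) (p k)" by auto
    have k: "k < K" "Suc k \<le> K" using Suc.prems by auto
    have lenS: "chain_length x (Suc k) + R < L" using chain_length_mono[OF k(2), of x] len by linarith
    have pk: "p k holomorphic_on ball (x k) R" using p(1) by (simp add: chain_cont_def)
    have near: "x (Suc k) \<in> ball (x k) R" using steps[OF k(1)] by (simp add: dist_norm norm_minus_commute)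
    have "\<exists>g. g holomorphic_on ball (x (Suc k)) R \<and> eventually (\<lambda>w. g w = p k w) (nhds (x (Suc k))) \<and>
       (chain_length x (Suc k) < 2 * \<rho> \<longrightarrow> g = eval_fps a) \<and>
       (2 * \<rho> \<le> chain_length x (Suc k) \<longrightarrow> (\<exists>l\<le>chain_length x (Suc k). reach l (x (Suc k)) g))"
    proof -
      consider "chain_length x (Suc k) < 2 * \<rho>"
        | "chain_length x k < 2 * \<rho>" "2 * \<rho> \<le> chain_length x (Suc k)"
        | "2 * \<rho> \<le> chain_length x k" by linarith
      then show ?thesis
      proof cases
        case 1
        moreover have "chain_length x k \<le> chain_length x (Suc k)" by (rule chain_length_mono) simp
        ultimately have "p k = eval_fps a" using p(2) by linarith
        moreover have "eval_fps a holomorphic_on ball (x (Suc k)) R"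
          using holomorphic_on_subset[OF hol small] 1 \<rho> by auto
        ultimately show ?thesis using 1 by auto
      next
        case 2
        \<comment> \<open>The first vertex past \<open>2 * \<rho>\<close> is still in the disc that
          contains no point of \<open>F\<close> other than 0.\<close>
        then have lt: "chain_length x (Suc k) < 3 * \<rho>" using steps[OF k(1)] R(3) by simp
        have norm: "cmod (x (Suc k)) \<le> chain_length x (Suc k)"
          using norm_le_chain_length[of x "Suc k"] x0 by simp
        have "x (Suc k) \<noteq> 0"
        proof
          assume "x (Suc k) = 0"
          then have "0 \<in> ball (x (Suc k)) R \<inter> F" using F0(1) R(1) by simp
          then show False using away[OF k(2) 2(2)] by blast
        qed
        then have reach: "reach (cmod (x (Suc k))) (x (Suc k)) (eval_fps a)"
          by (rule reach_ray[OF _ _ rad F0(2)]) (use norm lt \<rho> in linarith)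
        obtain g where g: "g holomorphic_on ball (x (Suc k)) R"
          "eventually (\<lambda>w. g w = eval_fps a w) (nhds (x (Suc k)))"
          using reach_ball[OF reach R(1) away[OF k(2) 2(2)]] norm lenS by auto
        show ?thesis
          using g p(2)[OF 2(1)] reach_cong[OF reach g(2)] norm 2(2) by (intro exI[of _ g]) auto
      next
        case 3
        then obtain l where l: "l \<le> chain_length x k" "reach l (x k) (p k)" using p(3) by blast
        have len2: "2 * \<rho> \<le> chain_length x (Suc k)" using 3 by (simp add: add_increasing2)
        have "\<exists>g' l'. eventually (\<lambda>w. g' w = p k w) (nhds (x (Suc k))) \<and> l' \<le> chain_length x (Suc k) \<and>
            reach l' (x (Suc k)) g'"
        proof (cases "x (Suc k) = x k")
          case True
          then show ?thesis using l by (intro exI[of _ "p k"] exI[of _ l]) auto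
        next
          case False
          have "closed_segment (x k) (x (Suc k)) \<subseteq> ball (x k) R"
            using near R(1) by (intro closed_segment_subset_ball) auto
          then have seg: "closed_segment (x k) (x (Suc k)) \<inter> F = {}"
            using away[OF _ 3] k(1) by auto
          obtain g' Q where g': "Q > 0" "\<forall>w\<in>ball (x (Suc k)) Q \<inter> ball (x k) R. g' w = p k w"
             "reach (l + cmod (x (Suc k) - x k)) (x (Suc k)) g'"
          proof -
            have "cmod (x (Suc k) - x k) \<le> R" using steps[OF k(1)] by simp
            moreover have "l + cmod (x (Suc k) - x k) < L" using l(1) lenS R(1) by simp
            ultimately show thesis
              using reach_extend[OF l(2) pk R(1) False _ seg] that by blast
          qed
          have "eventually (\<lambda>w. w \<in> ball (x (Suc k)) Q \<inter> ball (x k) R) (nhds (x (Suc k)))"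
            using near g'(1) by (intro eventually_nhds_in_open) auto
          then have "eventually (\<lambda>w. g' w = p k w) (nhds (x (Suc k)))"
            by eventually_elim (use g'(2) in auto)
          then show ?thesis using g'(3) l(1)
            by (intro exI[of _ g'] exI[of _ "l + cmod (x (Suc k) - x k)"]) auto
        qed
        then obtain g' l' where g': "eventually (\<lambda>w. g' w = p k w) (nhds (x (Suc k)))"
          "l' \<le> chain_length x (Suc k)" "reach l' (x (Suc k)) g'" by blast
        \<comment> \<open>\<open>reach_extend\<close> gives no control of the radius;
          \<open>reach_ball\<close> restores the radius \<open>R\<close>.\<close>
        obtain g where g: "g holomorphic_on ball (x (Suc k)) R"
          "eventually (\<lambda>w. g w = g' w) (nhds (x (Suc k)))"
          using reach_ball[OF g'(3) R(1) away[OF k(2) len2]] g'(2) lenS by auto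
        have "eventually (\<lambda>w. g w = p k w) (nhds (x (Suc k)))"
          using g(2) g'(1) by eventually_elim simp
        then show ?thesis
          using g(1) reach_cong[OF g'(3) g(2)] g'(2) len2 by (intro exI[of _ g]) auto
      qed
    qed
    then obtain g where g: "g holomorphic_on ball (x (Suc k)) R" "eventually (\<lambda>w. g w = p k w) (nhds (x (Suc k)))"
       "chain_length x (Suc k) < 2 * \<rho> \<longrightarrow> g = eval_fps a"
       "2 * \<rho> \<le> chain_length x (Suc k) \<longrightarrow> (\<exists>l\<le>chain_length x (Suc k). reach l (x (Suc k)) g)" by blast
    obtain U where U: "open U" "x (Suc k) \<in> U" "\<And>w. w \<in> U \<Longrightarrow> g w = p k w"
      using g(2) by (auto simp: eventually_nhds)
    have agree: "p k w = g w" if "w \<in> ball (x k) R \<inter> ball (x (Suc k)) R" for w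
      by (rule holomorphic_agree_Int_balls[OF pk g(1), of "U \<inter> (ball (x k) R \<inter> ball (x (Suc k)) R)"])
         (use U that near R(1) in auto)
    define p' where "p' = p(Suc k := g)"
    have "chain_cont (eval_fps a) x (Suc k) R p'"
      unfolding chain_cont_def
    proof (intro conjI allI impI ballI)
      show "p' j holomorphic_on ball (x j) R" if "j \<le> Suc k" for j
        using that p(1) g(1) by (auto simp: p'_def chain_cont_def le_Suc_eq)
      show "p' j w = p' (Suc j) w" if "j < Suc k" "w \<in> ball (x j) R \<inter> ball (x (Suc j)) R" for j w
        using that p(1) agree[of w] by (cases "j = k") (auto simp: p'_def chain_cont_def)
      show "p' 0 w = eval_fps a w" if "w \<in> ball (x 0) R" for w
        using that p(1) by (auto simp: p'_def chain_cont_def)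
    qed
    moreover have "p' (Suc k) = g" by (simp add: p'_def)
    ultimately show ?case using g(3,4) by (intro exI[of _ p']) simp
  qed
  then show ?thesis by blast
qed

end

text \<open>Each germ is bounded on the closed disc of half the radius by compactness, and a chain
  has finitely many vertices.\<close>

lemma chain_cont_bounded:
  assumes "chain_cont u x K R p" "R > 0"
  shows "\<exists>A. \<forall>j\<le>K. \<forall>w\<in>ball (x j) (R / 2). cmod (p j w) \<le> A"
proof -
  have "\<exists>A. \<forall>w\<in>ball (x j) (R / 2). cmod (p j w) \<le> A" if "j \<le> K" for j
  proof -
    have "continuous_on (cball (x j) (R / 2)) (p j)"
      using assms that by (intro holomorphic_on_imp_continuous_on[OF holomorphic_on_subset[of _ "ball (x j) R"]])
        (auto simp: chain_cont_def)
    then have "bounded (p j ` cball (x j) (R / 2))"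
      by (intro compact_imp_bounded compact_continuous_image) auto
    then obtain A where "\<forall>v\<in>p j ` cball (x j) (R / 2). cmod v \<le> A" by (auto simp: bounded_iff)
    then show ?thesis by (intro exI[of _ A]) auto
  qed
  then obtain A where A: "\<And>j w. j \<le> K \<Longrightarrow> w \<in> ball (x j) (R / 2) \<Longrightarrow> cmod (p j w) \<le> A j" by metis
  have "cmod (p j w) \<le> (\<Sum>j\<le>K. \<bar>A j\<bar>)" if "j \<le> K" "w \<in> ball (x j) (R / 2)" for j w
    using A[OF that] member_le_sum[of j "{..K}" "\<lambda>j. \<bar>A j\<bar>"] that by force
  then show ?thesis by blast
qed

section \<open>Substitution into a convergent series\<close>

lemma chain_length_le_path_length:
  assumes "C-lipschitz_on {0..1} \<gamma>" "K > 0"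
  shows "chain_length (\<lambda>j. \<gamma> (real j / real K)) K \<le> path_length \<gamma>"
proof -
  let ?P = "{(n, t). t 0 = 0 \<and> t n = (1::real) \<and> (\<forall>i<n. t i \<le> t (Suc i))}"
  have "bdd_above ((\<lambda>p. \<Sum>i<fst p. cmod (\<gamma> (snd p (Suc i)) - \<gamma> (snd p i))) ` ?P)"
    by (rule bdd_aboveI2[OF lipschitz_partition_sum_le[OF assms(1)]])
  moreover have "(K, \<lambda>i. real i / real K) \<in> ?P"
    using assms(2) by (auto simp: divide_right_mono)
  ultimately have "(\<Sum>i<fst (K, \<lambda>i. real i / real K). cmod (\<gamma> (snd (K, \<lambda>i. real i / real K) (Suc i))
      - \<gamma> (snd (K, \<lambda>i. real i / real K) i))) \<le> path_length \<gamma>"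
    unfolding path_length_def by (intro cSUP_upper)
  then show ?thesis by (simp add: chain_length_def)
qed

text \<open>At time \<open>t\<close> the germ at the last vertex up to \<open>t\<close> is used. The
  path moves at most \<open>R / 4\<close> within one mesh interval, so the disc of radius
  \<open>R / 2\<close> about \<open>\<gamma> t\<close> lies in the disc of that vertex.\<close>

lemma continuable_along_chain:
  assumes lip: "C-lipschitz_on {0..1} \<gamma>" and K: "K > 0" "C / real K \<le> R / 4" and R: "R > 0" and "\<gamma> 0 = 0"
    and H: "chain_cont (eval_fps a) (\<lambda>j. \<gamma> (real j / real K)) K R H"
  shows "continuable_along a \<gamma>"
proof -
  define J where "J t = nat \<lfloor>t * real K\<rfloor>" for t
  let ?z = "\<lambda>j. \<gamma> (real j / real K)"
  have C: "C \<ge> 0" using lip by (rule lipschitz_on_nonneg)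
  have J: "J t \<le> K" "real (J t) \<le> t * real K" "t * real K < real (J t) + 1" if "t \<in> {0..1}" for t
  proof -
    have "t * real K \<ge> 0" "t * real K \<le> real K" using that K by (auto simp: mult_left_le_one_le)
    then show "J t \<le> K" "real (J t) \<le> t * real K" "t * real K < real (J t) + 1"
      unfolding J_def by linarith+
  qed
  have near: "ball (\<gamma> t) (R / 2) \<subseteq> ball (?z (J t)) R" if t: "t \<in> {0..1}" for t
  proof
    fix w assume w: "w \<in> ball (\<gamma> t) (R / 2)"
    have "\<bar>real (J t) / real K - t\<bar> \<le> 1 / real K"
    proof -
      have "real (J t) / real K - t = (real (J t) - t * real K) / real K" using K by (simp add: field_simps)
      moreover have "\<bar>real (J t) - t * real K\<bar> \<le> 1" using J[OF t] by linarith
      ultimately show ?thesis using K by (simp add: divide_right_mono)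
    qed
    moreover have "real (J t) / real K \<in> {0..1}" using J(1)[OF t] K by auto
    ultimately have "dist (?z (J t)) (\<gamma> t) \<le> C * (1 / real K)"
      using lipschitz_onD[OF lip, of "real (J t) / real K" t] t
        mult_left_mono[OF _ C, of "\<bar>real (J t) / real K - t\<bar>" "1 / real K"]
      unfolding dist_real_def by linarith
    then have "dist (?z (J t)) (\<gamma> t) \<le> R / 4" unfolding times_divide_eq_right mult_1_right using K(2) by linarith
    moreover have "dist (?z (J t)) w \<le> dist (?z (J t)) (\<gamma> t) + dist (\<gamma> t) w" by (rule dist_triangle)
    ultimately show "w \<in> ball (?z (J t)) R" using w R by simp
  qed
  have H_hol: "H j holomorphic_on ball (?z j) R" if "j \<le> K" for j using H that by (simp add: chain_cont_def)
  have H_step: "H j w = H (Suc j) w" if "j < K" "w \<in> ball (?z j) R" "w \<in> ball (?z (Suc j)) R" for j w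
    using H that unfolding chain_cont_def by blast
  show ?thesis unfolding continuable_along_def
  proof (intro exI[of _ "\<lambda>t. H (J t)"] exI[of _ "\<lambda>t. R / 2"] conjI ballI)
    show "R / 2 > 0" using R by simp
    show "H (J t) holomorphic_on ball (\<gamma> t) (R / 2)" if "t \<in> {0..1}" for t
      using H_hol[OF J(1)[OF that]] near[OF that] by (rule holomorphic_on_subset)
    show "\<exists>\<rho>>0. \<forall>z\<in>ball 0 \<rho>. H (J 0) z = eval_fps a z"
      using H R \<open>\<gamma> 0 = 0\<close> by (intro exI[of _ R]) (simp add: chain_cont_def J_def)
    fix t :: real assume t: "t \<in> {0..1}"
    show "\<exists>\<delta>>0. \<forall>s\<in>{0..1}. \<bar>s - t\<bar> < \<delta> \<longrightarrow> \<gamma> s \<in> ball (\<gamma> t) (R / 2) \<and>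
        (\<forall>z\<in>ball (\<gamma> s) (R / 2) \<inter> ball (\<gamma> t) (R / 2). H (J s) z = H (J t) z)"
    \<comment> \<open>Parameters closer than one mesh width have equal or adjacent vertex
      indices.\<close>
    proof (intro exI[of _ "1 / real K"] conjI ballI impI)
      show "1 / real K > 0" using K by simp
      fix s :: real assume s: "s \<in> {0..1}" "\<bar>s - t\<bar> < 1 / real K"
      have "dist (\<gamma> t) (\<gamma> s) \<le> C * (1 / real K)"
        using lipschitz_onD[OF lip t s(1)] s(2) mult_left_mono[OF _ C, of "\<bar>s - t\<bar>" "1 / real K"]
        unfolding dist_real_def abs_minus_commute[of t s] by linarith
      then have "dist (\<gamma> t) (\<gamma> s) \<le> R / 4" unfolding times_divide_eq_right mult_1_right using K(2) by linarith
      then show "\<gamma> s \<in> ball (\<gamma> t) (R / 2)" using R by simp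
      fix w assume w: "w \<in> ball (\<gamma> s) (R / 2) \<inter> ball (\<gamma> t) (R / 2)"
      then have w': "w \<in> ball (?z (J s)) R" "w \<in> ball (?z (J t)) R" using near s(1) t by blast+
      have "\<bar>s * real K - t * real K\<bar> < 1"
        using s(2) K by (simp add: abs_mult pos_less_divide_eq flip: left_diff_distrib)
      then consider "J s = J t" | "J t = Suc (J s)" | "J s = Suc (J t)"
        using J[OF s(1)] J[OF t] by linarith
      then show "H (J s) w = H (J t) w"
      proof cases
        case 2
        then show ?thesis using H_step[of "J s" w] w' J(1)[OF t] by simp
      next
        case 3
        then show ?thesis using H_step[of "J t" w] w' J(1)[OF s(1)] by simp
      qed simp
    qed
  qed
qed

section \<open>Monomials as words, grouped by total degree\<close>

definition monomial_word :: "nat \<Rightarrow> (nat \<Rightarrow> nat) \<Rightarrow> nat list" where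
  "monomial_word r k = concat (map (\<lambda>i. replicate (k i) i) [0..<r])"

lemma set_monomial_word: "set (monomial_word r k) \<subseteq> {..<r}"
  by (auto simp: monomial_word_def)

lemma length_monomial_word: "length (monomial_word r k) = (\<Sum>i<r. k i)"
  by (induction r) (auto simp: monomial_word_def)

lemma prod_list_monomial_word:
  fixes \<phi> :: "nat \<Rightarrow> 'a::comm_monoid_mult"
  shows "prod_list (map \<phi> (monomial_word r k)) = (\<Prod>i<r. \<phi> i ^ k i)"
  by (induction r) (auto simp: monomial_word_def)

lemma fps_nth_prod_list_eq_0:
  fixes fs :: "complex fps list"
  assumes "\<And>f. f \<in> set fs \<Longrightarrow> fps_nth f 0 = 0" "n < length fs"
  shows "fps_nth (prod_list fs) n = 0"
  using assms
proof (induction fs arbitrary: n)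
  case (Cons f fs)
  have "fps_nth f i * fps_nth (prod_list fs) (n - i) = 0" if "i \<in> {0..n}" for i
    using Cons.IH[of "n - i"] Cons.prems that by (cases "i = 0") auto
  then have "fps_nth (f * prod_list fs) n = 0"
    unfolding fps_mult_nth by (intro sum.neutral ballI)
  then show ?case by simp
qed simp

definition degree_set :: "nat \<Rightarrow> nat \<Rightarrow> (nat \<Rightarrow> nat) set" where
  "degree_set r m = {k \<in> multi_idx r. (\<Sum>i<r. k i) = m}"

lemma finite_degree_set: "finite (degree_set r m)"
proof (rule finite_subset)
  show "degree_set r m \<subseteq> {k. \<forall>i. (i \<in> {..<r} \<longrightarrow> k i \<in> {..m}) \<and> (i \<notin> {..<r} \<longrightarrow> k i = 0)}"
  proof
    fix k assume k: "k \<in> degree_set r m"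
    have "k i \<le> m" if "i < r" for i
      using member_le_sum[of i "{..<r}" k] k that by (auto simp: degree_set_def)
    then show "k \<in> {k. \<forall>i. (i \<in> {..<r} \<longrightarrow> k i \<in> {..m}) \<and> (i \<notin> {..<r} \<longrightarrow> k i = 0)}"
      using k by (auto simp: degree_set_def multi_idx_def)
  qed
qed (rule finite_set_of_finite_funs; simp)

text \<open>Monomials of degree above \<open>n\<close> vanish in coefficient \<open>n\<close>, so
  the unordered sum is finite and any cutoff \<open>N > n\<close> will do. The form matches the
  partial sums of the analytic series.\<close>

lemma fps_subst_multi_nth:
  assumes "\<And>i. i < r \<Longrightarrow> fps_nth (\<phi> i) 0 = 0" "n < N"
  shows "fps_nth (fps_subst_multi r c \<phi>) n =
    (\<Sum>m<N. \<Sum>k\<in>degree_set r m. c k * fps_nth (prod_list (map \<phi> (monomial_word r k))) n)"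
proof -
  let ?g = "\<lambda>k. c k * fps_nth (prod_list (map \<phi> (monomial_word r k))) n"
  let ?U = "\<Union>m<N. degree_set r m"
  have zero: "?g k = 0" if "k \<in> multi_idx r - ?U" for k
  proof -
    have "\<not> (\<Sum>i<r. k i) < N" using that by (auto simp: degree_set_def)
    then have "n < length (map \<phi> (monomial_word r k))" using assms(2) by (simp add: length_monomial_word)
    then have "fps_nth (prod_list (map \<phi> (monomial_word r k))) n = 0"
      using set_monomial_word[of r k] assms(1) by (intro fps_nth_prod_list_eq_0) auto
    then show ?thesis by simp
  qed
  have "fps_nth (fps_subst_multi r c \<phi>) n = infsum ?g (multi_idx r)"
    by (simp add: fps_subst_multi_def prod_list_monomial_word)
  also have "\<dots> = infsum ?g ?U"
    by (rule infsum_cong_neutral) (use zero in \<open>auto simp: degree_set_def\<close>)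
  also have "\<dots> = sum ?g ?U" by (simp add: finite_degree_set)
  also have "\<dots> = (\<Sum>m<N. sum ?g (degree_set r m))"
    by (rule sum.UNION_disjoint) (auto simp: finite_degree_set, auto simp: degree_set_def)
  finally show ?thesis .
qed

text \<open>Nonnegative terms may be grouped by degree, which turns the unordered sum into an
  ordinary series fit for the Weierstrass test.\<close>

lemma summable_degree_sums:
  assumes "(\<lambda>k. cmod (c k) * \<theta> ^ (\<Sum>i<r. k i)) summable_on multi_idx r" "\<theta> > 0"
  shows "summable (\<lambda>m. \<Sum>k\<in>degree_set r m. cmod (c k) * \<theta> ^ m)"
proof (rule summableI_nonneg_bounded)
  let ?g = "\<lambda>k. cmod (c k) * \<theta> ^ (\<Sum>i<r. k i)"
  show "0 \<le> (\<Sum>k\<in>degree_set r m. cmod (c k) * \<theta> ^ m)" for m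
    using assms(2) by (intro sum_nonneg) auto
  fix N
  have "(\<Sum>m<N. \<Sum>k\<in>degree_set r m. cmod (c k) * \<theta> ^ m) = (\<Sum>m<N. sum ?g (degree_set r m))"
    by (intro sum.cong refl) (simp add: degree_set_def)
  also have "\<dots> = sum ?g (\<Union>m<N. degree_set r m)"
    by (rule sum.UNION_disjoint[symmetric]) (auto simp: finite_degree_set, auto simp: degree_set_def)
  also have "\<dots> \<le> infsum ?g (multi_idx r)"
    by (rule finite_sum_le_infsum[OF assms(1)])
       (use assms(2) in \<open>auto simp: finite_degree_set, auto simp: degree_set_def\<close>)
  finally show "(\<Sum>m<N. \<Sum>k\<in>degree_set r m. cmod (c k) * \<theta> ^ m) \<le> infsum ?g (multi_idx r)" .
qed

section \<open>Borel germs of words and their sum\<close>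

definition word_germ :: "(nat \<Rightarrow> complex fps) \<Rightarrow> nat list \<Rightarrow> complex \<Rightarrow> complex" where
  "word_germ \<phi> w = eval_fps (Defs.borel (prod_list (map \<phi> w)))"

lemma conv_radius_word:
  assumes "\<And>i. i \<in> I \<Longrightarrow> ereal R \<le> fps_conv_radius (Defs.borel (\<phi> i))" "R > 0"
    and "\<And>i. i \<in> I \<Longrightarrow> fps_nth (\<phi> i) 0 = 0" and "w \<noteq> []" "set w \<subseteq> I"
  shows "ereal R \<le> fps_conv_radius (Defs.borel (prod_list (map \<phi> w)))"
  using assms(4,5)
proof (induction w rule: list_nonempty_induct)
  case (single i)
  then show ?case using assms(1) by simp
next
  case (cons i w)
  have "fps_nth (prod_list (map \<phi> w)) 0 = 0"
    using cons assms(3) by (intro fps_nth_0_prod_list) auto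
  then show ?case
    using borel_mult(1)[OF assms(1)[of i] cons.IH assms(2) assms(3)[of i]] cons.prems by simp
qed

lemma word_germ_Cons:
  assumes "\<And>i. i \<in> I \<Longrightarrow> ereal R \<le> fps_conv_radius (Defs.borel (\<phi> i))" "R > 0"
    and "\<And>i. i \<in> I \<Longrightarrow> fps_nth (\<phi> i) 0 = 0" and "w \<noteq> []" "set w \<subseteq> I" "i \<in> I" "\<zeta> \<in> ball 0 R"
  shows "word_germ \<phi> (i # w) \<zeta> = conv (word_germ \<phi> [i]) (word_germ \<phi> w) \<zeta>"
proof -
  have "fps_nth (prod_list (map \<phi> w)) 0 = 0"
    using assms(3-5) by (intro fps_nth_0_prod_list) auto
  then show ?thesis
    using borel_mult(2)[OF assms(1)[OF assms(6)] conv_radius_word[OF assms(1-5)] assms(2) assms(3)[OF assms(6)] _ assms(7)]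
    by (simp add: word_germ_def)
qed

text \<open>The bounds \<open>C * \<theta> ^ length w\<close> are summable against the coefficients,
  so the series of germs converges uniformly on every disc of the chain. Derivatives at 0 pass to
  the limit and identify \<open>H 0\<close> with the Borel transform of the substituted
  series.\<close>

lemma chain_cont_fps_subst_multi:
  assumes \<phi>0: "\<And>i. i < r \<Longrightarrow> fps_nth (\<phi> i) 0 = 0"
    and rad: "\<And>i. i < r \<Longrightarrow> ereal \<rho> \<le> fps_conv_radius (Defs.borel (\<phi> i))" and "\<rho> > 0"
    and c: "(\<lambda>k. cmod (c k) * \<theta> ^ (\<Sum>i<r. k i)) summable_on multi_idx r" and \<theta>: "\<theta> > 0"
    and R: "R > 0" and z0: "z 0 = 0"
    and words: "\<And>w. w \<noteq> [] \<Longrightarrow> set w \<subseteq> {..<r} \<Longrightarrow> \<exists>f. chain_cont (word_germ \<phi> w) z K R f \<and>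
      (\<forall>j\<le>K. \<forall>\<zeta>\<in>ball (z j) R. cmod (f j \<zeta>) \<le> C * \<theta> ^ length w)"
  shows "\<exists>H. chain_cont (eval_fps (Defs.borel (fps_subst_multi r c \<phi>))) z K R H"
    and "ereal R \<le> fps_conv_radius (Defs.borel (fps_subst_multi r c \<phi>))"
proof -
  let ?b = "Defs.borel (fps_subst_multi r c \<phi>)"
  let ?P = "\<lambda>k. Defs.borel (prod_list (map \<phi> (monomial_word r k)))"
  \<comment> \<open>The empty word stands for the constant monomial; its germ is 0, so
    \<open>words\<close> can leave it out.\<close>
  have borel_1: "Defs.borel 1 = 0" by (rule fps_ext) (simp add: borel_def)
  have "\<exists>f. chain_cont (word_germ \<phi> w) z K R f \<and>
      (\<forall>j\<le>K. \<forall>\<zeta>\<in>ball (z j) R. cmod (f j \<zeta>) \<le> \<bar>C\<bar> * \<theta> ^ length w)" if "set w \<subseteq> {..<r}" for w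
  proof (cases "w = []")
    case True
    then show ?thesis
      by (intro exI[of _ "\<lambda>_ _. 0"]) (simp add: chain_cont_def word_germ_def borel_1 eval_fps_def)
  next
    case False
    have "C * \<theta> ^ length w \<le> \<bar>C\<bar> * \<theta> ^ length w" using \<theta> by (intro mult_right_mono) auto
    then show ?thesis using words[OF False that] by (meson order_trans)
  qed
  then obtain f where f: "\<And>w. set w \<subseteq> {..<r} \<Longrightarrow> chain_cont (word_germ \<phi> w) z K R (f w)"
    "\<And>w j \<zeta>. set w \<subseteq> {..<r} \<Longrightarrow> j \<le> K \<Longrightarrow> \<zeta> \<in> ball (z j) R \<Longrightarrow> cmod (f w j \<zeta>) \<le> \<bar>C\<bar> * \<theta> ^ length w"
    by metis
  define g where "g k = f (monomial_word r k)" for k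
  have g: "chain_cont (word_germ \<phi> (monomial_word r k)) z K R (g k)" for k
    unfolding g_def by (rule f(1)[OF set_monomial_word])
  define T where "T m j \<zeta> = (\<Sum>k\<in>degree_set r m. c k * g k j \<zeta>)" for m j \<zeta>
  define M where "M m = \<bar>C\<bar> * (\<Sum>k\<in>degree_set r m. cmod (c k) * \<theta> ^ m)" for m
  have M: "summable M"
    unfolding M_def by (intro summable_mult summable_degree_sums[OF c \<theta>])
  have T_M: "cmod (T m j \<zeta>) \<le> M m" if "j \<le> K" "\<zeta> \<in> ball (z j) R" for m j \<zeta>
    unfolding T_def M_def sum_distrib_left
  proof (intro order_trans[OF norm_sum] sum_mono)
    fix k assume "k \<in> degree_set r m"
    then have "length (monomial_word r k) = m" by (simp add: length_monomial_word degree_set_def)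
    then have "cmod (g k j \<zeta>) \<le> \<bar>C\<bar> * \<theta> ^ m"
      using f(2)[OF set_monomial_word that, of k] by (simp add: g_def)
    then have "cmod (c k) * cmod (g k j \<zeta>) \<le> cmod (c k) * (\<bar>C\<bar> * \<theta> ^ m)" by (intro mult_left_mono) auto
    then show "cmod (c k * g k j \<zeta>) \<le> \<bar>C\<bar> * (cmod (c k) * \<theta> ^ m)"
      by (simp add: norm_mult algebra_simps)
  qed
  define H where "H j \<zeta> = (\<Sum>m. T m j \<zeta>)" for j \<zeta>
  define S where "S N j \<zeta> = (\<Sum>m<N. T m j \<zeta>)" for N j \<zeta>
  have lim: "uniform_limit (ball (z j) R) (\<lambda>N. S N j) (H j) sequentially" if "j \<le> K" for j
    using Weierstrass_m_test[of "ball (z j) R" "\<lambda>m. T m j" M] T_M[OF that] M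
    unfolding S_def[abs_def] H_def[abs_def] by simp
  have g_hol: "g k j holomorphic_on ball (z j) R" if "j \<le> K" for k j
    using g[of k] that by (simp add: chain_cont_def)
  have S_hol: "S N j holomorphic_on ball (z j) R" if "j \<le> K" for N j
    unfolding S_def[abs_def] T_def using g_hol[OF that] by (intro holomorphic_intros)
  have H_hol: "H j holomorphic_on ball (z j) R" if "j \<le> K" for j
  proof (rule holomorphic_uniform_sequence[OF open_ball S_hol[OF that]])
    fix x assume "x \<in> ball (z j) R"
    then obtain d where "d > 0" "cball x d \<subseteq> ball (z j) R" using open_contains_cball open_ball by blast
    then show "\<exists>d>0. cball x d \<subseteq> ball (z j) R \<and> uniform_limit (cball x d) (\<lambda>N. S N j) (H j) sequentially"
      using uniform_limit_on_subset[OF lim[OF that]] by blast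
  qed
  have fps_S: "S N 0 has_fps_expansion (\<Sum>m<N. \<Sum>k\<in>degree_set r m. fps_const (c k) * ?P k)" for N
    unfolding S_def[abs_def] T_def
  proof (intro has_fps_expansion_sum has_fps_expansion_cmult_left)
    fix k
    have "word_germ \<phi> (monomial_word r k) has_fps_expansion ?P k"
      unfolding word_germ_def
    proof (rule eval_fps_has_fps_expansion)
      show "0 < fps_conv_radius (?P k)"
      proof (cases "monomial_word r k = []")
        case False
        have "0 < ereal \<rho>" using \<open>\<rho> > 0\<close> by simp
        also have "\<dots> \<le> fps_conv_radius (?P k)"
          by (rule conv_radius_word[of "{..<r}"]) (use rad \<phi>0 \<open>\<rho> > 0\<close> False set_monomial_word in auto)
        finally show ?thesis .
      qed (simp add: borel_1)
    qed
    moreover have "eventually (\<lambda>w. w \<in> ball 0 R) (nhds (0::complex))"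
      using R by (intro eventually_nhds_in_open) auto
    then have "eventually (\<lambda>w. g k 0 w = word_germ \<phi> (monomial_word r k) w) (nhds 0)"
      by eventually_elim (use g[of k] z0 in \<open>simp add: chain_cont_def\<close>)
    ultimately show "g k 0 has_fps_expansion ?P k"
      using has_fps_expansion_cong by blast
  qed
  have deriv_H: "(deriv ^^ n) (H 0) 0 / fact n = fps_nth ?b n" for n
  proof -
    have "(\<lambda>N. (deriv ^^ n) (S N 0) 0) \<longlonglongrightarrow> (deriv ^^ n) (H 0) 0"
      by (rule higher_deriv_complex_uniform_limit[OF lim])
         (use S_hol[of 0] z0 R in auto)
    then have "(\<lambda>N. (deriv ^^ n) (S N 0) 0 / fact n) \<longlonglongrightarrow> (deriv ^^ n) (H 0) 0 / fact n"
      by (intro tendsto_intros) auto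
    \<comment> \<open>Coefficient \<open>n\<close> of a Borel transform comes from coefficient
      \<open>Suc n\<close>, and the cutoff must satisfy \<open>Suc n < N\<close>.\<close>
    moreover have "(deriv ^^ n) (S N 0) 0 / fact n = fps_nth ?b n" if "N \<ge> n + 2" for N
    proof -
      have "(deriv ^^ n) (S N 0) 0 / fact n
          = (\<Sum>m<N. \<Sum>k\<in>degree_set r m. c k * fps_nth (prod_list (map \<phi> (monomial_word r k))) (Suc n) / fact n)"
        using fps_nth_fps_expansion[OF fps_S[of N], of n, symmetric]
        by (simp add: fps_sum_nth borel_def)
      also have "\<dots> = fps_nth (fps_subst_multi r c \<phi>) (Suc n) / fact n"
        using fps_subst_multi_nth[of r \<phi> "Suc n" N c] \<phi>0 that by (simp add: sum_divide_distrib)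
      finally show ?thesis by (simp add: borel_def)
    qed
    then have "eventually (\<lambda>N. (deriv ^^ n) (S N 0) 0 / fact n = fps_nth ?b n) sequentially"
      by (auto simp: eventually_sequentially)
    then have "(\<lambda>N. (deriv ^^ n) (S N 0) 0 / fact n) \<longlonglongrightarrow> fps_nth ?b n"
      by (rule tendsto_eventually)
    ultimately show ?thesis by (rule LIMSEQ_unique)
  qed
  have exp: "fps_expansion (H 0) 0 = ?b"
    by (rule fps_ext) (simp add: fps_expansion_def deriv_H)
  have H0: "H 0 holomorphic_on eball 0 (ereal R)" using H_hol[of 0] z0 by simp
  show "ereal R \<le> fps_conv_radius ?b"
    using conv_radius_fps_expansion[OF H0] unfolding exp .
  have "chain_cont (eval_fps ?b) z K R H"
    unfolding chain_cont_def
  proof (intro conjI allI impI ballI)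
    show "H j holomorphic_on ball (z j) R" if "j \<le> K" for j using H_hol[OF that] .
    show "H j w = H (Suc j) w" if j: "j < K" and w: "w \<in> ball (z j) R \<inter> ball (z (Suc j)) R" for j w
    proof -
      have "g k j w = g k (Suc j) w" for k using g[of k] j w unfolding chain_cont_def by blast
      then show ?thesis by (simp add: H_def T_def)
    qed
    show "H 0 w = eval_fps ?b w" if "w \<in> ball (z 0) R" for w
      using eval_fps_expansion'[OF H0, of w] that z0 unfolding exp by simp
  qed
  then show "\<exists>H. chain_cont (eval_fps ?b) z K R H" by blast
qed

theorem theorem1p3:
  fixes r :: nat and c :: "(nat \<Rightarrow> nat) \<Rightarrow> complex" and \<phi> :: "nat \<Rightarrow> complex fps"
  assumes "r \<ge> 1"
    and "conv_multi_series r c"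
    and "\<And>i. i < r \<Longrightarrow> resurgent (\<phi> i)"
    and "\<And>i. i < r \<Longrightarrow> fps_nth (\<phi> i) 0 = 0"
  shows "resurgent (fps_subst_multi r c \<phi>)"
proof -
  let ?b = "Defs.borel (fps_subst_multi r c \<phi>)"
  obtain \<theta> where \<theta>: "\<theta> > 0" "(\<lambda>k. cmod (c k) * \<theta> ^ (\<Sum>i<r. k i)) summable_on multi_idx r"
    using assms(2) unfolding conv_multi_series_def by blast
  have main: "ereal 0 < fps_conv_radius ?b \<and> (\<exists>\<Omega>. finite \<Omega> \<and>
      (\<forall>\<gamma> C. C-lipschitz_on {0..1} \<gamma> \<longrightarrow> path_length \<gamma> < L \<longrightarrow> \<gamma> 0 = 0 \<longrightarrow>
         \<gamma> ` {0<..1} \<subseteq> - \<Omega> \<longrightarrow> continuable_along ?b \<gamma>))" if L: "L > 0" for L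
  proof -
    \<comment> \<open>Length \<open>L + 1\<close> leaves room for a disc of radius less than 1 at
      the end of a chain, as \<open>chain_continuation\<close> requires.\<close>
    have "\<exists>F. finite F \<and> (\<forall>\<gamma>. (\<exists>C. C-lipschitz_on {0..1} \<gamma>) \<and> path_length \<gamma> < L + 1 \<and> \<gamma> 0 = 0 \<and>
        \<gamma> ` {0<..1} \<subseteq> - F \<longrightarrow> continuable_along (Defs.borel (\<phi> i)) \<gamma>)" if "i < r" for i
      using assms(3)[OF that] L unfolding resurgent_def endlessly_continuable_def by simp
    then obtain G where G: "\<And>i. i < r \<Longrightarrow> finite (G i)"
      "\<And>i \<gamma> C. i < r \<Longrightarrow> C-lipschitz_on {0..1} \<gamma> \<Longrightarrow> path_length \<gamma> < L + 1 \<Longrightarrow> \<gamma> 0 = 0 \<Longrightarrow>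
        \<gamma> ` {0<..1} \<subseteq> - G i \<Longrightarrow> continuable_along (Defs.borel (\<phi> i)) \<gamma>" by metis
    define F where "F = insert 0 (\<Union>i<r. G i)"
    have F: "finite F" "0 \<in> F" using G(1) by (auto simp: F_def)
    have "\<exists>d>0. ereal d \<le> fps_conv_radius (Defs.borel (\<phi> i))" if "i < r" for i
    proof -
      have "fps_conv_radius (Defs.borel (\<phi> i)) > 0"
        using assms(3)[OF that] by (simp add: resurgent_def endlessly_continuable_def)
      then obtain d where "ereal d < fps_conv_radius (Defs.borel (\<phi> i))" "0 < ereal d"
        using ereal_dense2 by blast
      then show ?thesis by (intro exI[of _ d]) auto
    qed
    then obtain d where d: "\<And>i. i < r \<Longrightarrow> d i > 0 \<and> ereal (d i) \<le> fps_conv_radius (Defs.borel (\<phi> i))" by metis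
    obtain e where e: "e > 0" "\<And>w. w \<in> F \<Longrightarrow> w \<noteq> 0 \<Longrightarrow> e \<le> dist 0 w"
      using finite_set_avoid[OF F(1), of 0] by auto
    \<comment> \<open>On the disc of radius \<open>4 * \<rho>\<close> all given Borel transforms
      converge and no point of \<open>F\<close> other than 0 occurs.\<close>
    define \<rho> where "\<rho> = Min (insert e (d ` {..<r})) / 4"
    have \<rho>: "\<rho> > 0" "4 * \<rho> \<le> e" "\<And>i. i < r \<Longrightarrow> 4 * \<rho> \<le> d i"
      using e(1) d by (auto simp: \<rho>_def)
    have rad: "ereal (4 * \<rho>) \<le> fps_conv_radius (Defs.borel (\<phi> i))" if "i < r" for i
      using \<rho>(3)[OF that] d[OF that] by (meson ereal_less_eq(3) order_trans)
    have F_ball: "F \<inter> ball 0 (4 * \<rho>) \<subseteq> {0}" using e(2) \<rho>(2) by force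
    have path: "path_continuation (Defs.borel (\<phi> i)) F (L + 1)" if "i < r" for i
    proof
      fix \<gamma> C assume "C-lipschitz_on {0..1} \<gamma>" "path_length \<gamma> < L + 1" "\<gamma> 0 = 0" "\<gamma> ` {0<..1} \<subseteq> - F"
      moreover have "- F \<subseteq> - G i" using that by (auto simp: F_def)
      ultimately show "continuable_along (Defs.borel (\<phi> i)) \<gamma>" using G(2)[OF that] by blast
    qed
    interpret continuable_words "{..<r}" "word_germ \<phi>" F \<rho> L \<theta>
    proof
      fix i assume "i \<in> {..<r}"
      then have "eval_fps (Defs.borel (\<phi> i)) holomorphic_on ball 0 (4 * \<rho>)"
        using rad by (intro eval_fps_holomorphic_ball) auto
      then show "word_germ \<phi> [i] holomorphic_on ball 0 (2 * \<rho>)"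
        using \<rho>(1) by (auto simp: word_germ_def elim!: holomorphic_on_subset)
    next
      fix i w and \<zeta> :: complex assume *: "i \<in> {..<r}" "set w \<subseteq> {..<r}" "w \<noteq> []" "\<zeta> \<in> ball 0 \<rho>"
      show "word_germ \<phi> (i # w) \<zeta> = conv (word_germ \<phi> [i]) (word_germ \<phi> w) \<zeta>"
        by (rule word_germ_Cons[of "{..<r}" "4 * \<rho>"]) (use rad \<rho>(1) assms(4) * in auto)
    next
      fix \<delta> :: real assume \<delta>: "\<delta> > 0"
      define R where "R = min (\<delta> / 2) (min (1 / 2) \<rho>)"
      have R: "0 < R" "R < \<delta>" "R \<le> \<rho>" "R < 1" using \<delta> \<rho>(1) by (auto simp: R_def)
      show "\<exists>s>0. \<exists>R>0. \<forall>x K. clear_chain F (2 * \<rho>) \<delta> x K \<and>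
        (\<forall>j<K. cmod (x (Suc j) - x j) \<le> s) \<and> chain_length x K < L \<longrightarrow>
        (\<exists>A. \<forall>i\<in>{..<r}. \<exists>p. chain_cont (word_germ \<phi> [i]) x K R p \<and>
           (\<forall>j\<le>K. \<forall>w\<in>ball (x j) R. cmod (p j w) \<le> A))"
      \<comment> \<open>The first \<open>R / 2\<close> makes steps strictly shorter than
        \<open>R\<close>; the second is the radius on which \<open>chain_cont_bounded\<close> gives
        bounds.\<close>
      proof (rule exI[of _ "R / 2"], rule conjI, use R in simp, rule exI[of _ "R / 2"], rule conjI, use R in simp,
          intro allI impI, elim conjE)
        fix x K assume x: "clear_chain F (2 * \<rho>) \<delta> x K" "\<forall>j<K. cmod (x (Suc j) - x j) \<le> R / 2" "chain_length x K < L"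
        have "\<exists>p A. chain_cont (word_germ \<phi> [i]) x K (R / 2) p \<and>
           (\<forall>j\<le>K. \<forall>w\<in>ball (x j) (R / 2). cmod (p j w) \<le> A)" if i: "i < r" for i
        proof -
          interpret path_continuation "Defs.borel (\<phi> i)" F "L + 1" by (rule path[OF i])
          have "cmod (x (Suc j) - x j) < R" if "j < K" for j
            using x(2) that R(1) by force
          then obtain p where p: "chain_cont (eval_fps (Defs.borel (\<phi> i))) x K R p"
            using chain_continuation[OF \<rho>(1) F(2) F_ball rad[OF i] R(1-3) x(1)] x(3) R(4) by force
          have "chain_cont (word_germ \<phi> [i]) x K (R / 2) p"
            using chain_cont_subset[OF p, of "R / 2"] R(1) by (simp add: word_germ_def)
          then show ?thesis using chain_cont_bounded[OF p R(1)] by blast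
        qed
        then obtain p A where pA: "\<And>i. i < r \<Longrightarrow> chain_cont (word_germ \<phi> [i]) x K (R / 2) (p i) \<and>
           (\<forall>j\<le>K. \<forall>w\<in>ball (x j) (R / 2). cmod (p i j w) \<le> A i)" by metis
        have "A i \<le> (\<Sum>i<r. \<bar>A i\<bar>)" if "i < r" for i
          using member_le_sum[of i "{..<r}" "\<lambda>i. \<bar>A i\<bar>"] that by force
        then show "\<exists>A. \<forall>i\<in>{..<r}. \<exists>p. chain_cont (word_germ \<phi> [i]) x K (R / 2) p \<and>
           (\<forall>j\<le>K. \<forall>w\<in>ball (x j) (R / 2). cmod (p j w) \<le> A)"
          using pA by (intro exI[of _ "\<Sum>i<r. \<bar>A i\<bar>"]) (meson lessThan_iff order_trans)
      qed
    qed (use F \<rho> \<theta> in auto)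
    \<comment> \<open>For this \<open>N\<close> the length restriction in
      \<open>bounded_continuation N\<close> is just \<open>L\<close>, and \<open>sumset N\<close>
      becomes the finite set to be avoided.\<close>
    obtain N :: nat where "L / \<rho> < real N" using reals_Archimedean2 by blast
    then have N: "L < real N * \<rho>" using \<rho>(1) by (simp add: pos_divide_less_eq)
    have cont: "\<exists>s>0. \<exists>R>0. \<forall>z K. clear_chain (sumset N) \<rho> \<delta> z K \<longrightarrow> (\<forall>j<K. cmod (z (Suc j) - z j) \<le> s) \<longrightarrow>
       chain_length z K < L \<longrightarrow> (\<exists>H. chain_cont (eval_fps ?b) z K R H) \<and> ereal R \<le> fps_conv_radius ?b"
      if \<delta>: "\<delta> > 0" for \<delta>
    proof -
      obtain s R where sR: "s > 0" "R > 0" and words: "\<forall>z K. clear_chain (sumset N) \<rho> \<delta> z K \<and>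
         (\<forall>j<K. cmod (z (Suc j) - z j) \<le> s) \<and> chain_length z K < min (real N * \<rho>) L \<longrightarrow>
         (\<exists>C. \<forall>w. w \<noteq> [] \<and> set w \<subseteq> {..<r} \<longrightarrow> (\<exists>f. chain_cont (word_germ \<phi> w) z K R f \<and>
            (\<forall>j\<le>K. \<forall>\<zeta>\<in>ball (z j) R. cmod (f j \<zeta>) \<le> C * \<theta> ^ length w)))"
        using bounded_continuation[of N, unfolded bounded_continuation_def, THEN spec, THEN mp, OF \<delta>]
        by (elim exE conjE) (rule that)
      have "(\<exists>H. chain_cont (eval_fps ?b) z K R H) \<and> ereal R \<le> fps_conv_radius ?b"
        if z: "clear_chain (sumset N) \<rho> \<delta> z K" "\<forall>j<K. cmod (z (Suc j) - z j) \<le> s" "chain_length z K < L" for z K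
      proof -
        have "chain_length z K < min (real N * \<rho>) L" using z(3) N by simp
        then obtain C where C: "\<And>w. w \<noteq> [] \<Longrightarrow> set w \<subseteq> {..<r} \<Longrightarrow> \<exists>f. chain_cont (word_germ \<phi> w) z K R f \<and>
            (\<forall>j\<le>K. \<forall>\<zeta>\<in>ball (z j) R. cmod (f j \<zeta>) \<le> C * \<theta> ^ length w)"
          using words z(1,2) by meson
        have "z 0 = 0" using z(1) by (simp add: clear_chain_def)
        then show ?thesis
          using chain_cont_fps_subst_multi[OF assms(4) rad _ \<theta>(2,1) sR(2) _ C] \<rho>(1) by simp
      qed
      then show ?thesis using sR by blast
    qed
    have radius: "0 < fps_conv_radius ?b"
    proof -
      obtain s R where "R > 0" and R: "\<forall>z K. clear_chain (sumset N) \<rho> 1 z K \<longrightarrow>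
          (\<forall>j<K. cmod (z (Suc j) - z j) \<le> s) \<longrightarrow> chain_length z K < L \<longrightarrow>
          (\<exists>H. chain_cont (eval_fps ?b) z K R H) \<and> ereal R \<le> fps_conv_radius ?b"
        using cont[OF zero_less_one] by (elim exE conjE) (rule that)
      \<comment> \<open>The chain consisting of the origin alone already bounds the radius of
        convergence from below.\<close>
      have "clear_chain (sumset N) \<rho> 1 (\<lambda>_. 0) 0" using \<rho>(1) by (simp add: clear_chain_def)
      then have "ereal R \<le> fps_conv_radius ?b" using R L by force
      moreover have "0 < ereal R" using \<open>R > 0\<close> by simp
      ultimately show ?thesis by (rule less_le_trans[rotated])
    qed
    have "continuable_along ?b \<gamma>"
      if \<gamma>: "C-lipschitz_on {0..1} \<gamma>" "path_length \<gamma> < L" "\<gamma> 0 = 0" "\<gamma> ` {0<..1} \<subseteq> - sumset N" for \<gamma> C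
    proof -
      define B where "B = max C 1"
      have B: "B > 0" by (simp add: B_def)
      have lip: "B-lipschitz_on {0..1} \<gamma>" using \<gamma>(1) by (rule lipschitz_on_mono) (auto simp: B_def)
      \<comment> \<open>Before \<open>t0\<close> the path is shorter than \<open>\<rho>\<close>, so
        only the compact remainder, which misses \<open>sumset N\<close>, needs a uniform distance
        \<open>\<delta>\<close>.\<close>
      define t0 where "t0 = min 1 (\<rho> / B)"
      have t0: "t0 > 0" "t0 \<le> 1" "t0 \<le> \<rho> / B" using \<rho>(1) B by (auto simp: t0_def)
      have "compact (\<gamma> ` {t0..1})"
        by (intro compact_continuous_image continuous_on_subset[OF lipschitz_on_continuous_on[OF lip]])
           (use t0 in auto)
      moreover have "closed (sumset N)" using finite_sumset by (rule finite_imp_closed)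
      moreover have "\<gamma> ` {t0..1} \<inter> sumset N = {}"
      proof -
        have "\<gamma> ` {t0..1} \<subseteq> \<gamma> ` {0<..1}" using t0 by (intro image_mono) auto
        then show ?thesis using \<gamma>(4) by blast
      qed
      ultimately obtain \<delta> where \<delta>: "\<delta> > 0" "\<And>t w. t \<in> {t0..1} \<Longrightarrow> w \<in> sumset N \<Longrightarrow> \<delta> \<le> dist (\<gamma> t) w"
        using separate_compact_closed[of "\<gamma> ` {t0..1}" "sumset N"] by blast
      obtain s R where sR: "s > 0" "R > 0" and ch: "\<And>z K. clear_chain (sumset N) \<rho> \<delta> z K \<Longrightarrow>
          (\<forall>j<K. cmod (z (Suc j) - z j) \<le> s) \<Longrightarrow> chain_length z K < L \<Longrightarrow> \<exists>H. chain_cont (eval_fps ?b) z K R H"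
        using cont[OF \<delta>(1)] by blast
      \<comment> \<open>The mesh must meet the step bound \<open>s\<close> and the bound
        \<open>R / 4\<close> of \<open>continuable_along_chain\<close>.\<close>
      obtain K :: nat where K: "max (B / s) (4 * B / R) < real K" using reals_Archimedean2 by blast
      have K0: "K > 0"
      proof -
        have "B / s > 0" using B sR by simp
        then show ?thesis using K by simp
      qed
      have K_le: "B / real K \<le> s" "B / real K \<le> R / 4"
        using K K0 sR by (auto simp: field_simps)
      let ?z = "\<lambda>j. \<gamma> (real j / real K)"
      have step: "cmod (?z (Suc j) - ?z j) \<le> B / real K" if "j < K" for j
      proof -
        have "cmod (?z (Suc j) - ?z j) \<le> B * norm (real (Suc j) / real K - real j / real K)"
          by (rule lipschitz_on_normD[OF lip]) (use that in auto)
        also have "real (Suc j) / real K - real j / real K = 1 / real K" by (simp flip: diff_divide_distrib)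
        finally show ?thesis by simp
      qed
      have len: "chain_length ?z j \<le> B * (real j / real K)" if "j \<le> K" for j
        using that
      proof (induction j)
        case (Suc j)
        then show ?case using step[of j] by (simp add: field_simps)
      qed simp
      have "clear_chain (sumset N) \<rho> \<delta> ?z K"
        unfolding clear_chain_def
      proof (intro conjI allI impI ballI)
        fix j w assume j: "j \<le> K" "\<rho> \<le> chain_length ?z j" and w: "w \<in> sumset N"
        have "\<rho> / B \<le> real j / real K" using len[OF j(1)] j(2) B by (simp add: pos_divide_le_eq mult.commute)
        then have "real j / real K \<in> {t0..1}" using t0(3) j(1) K0 by auto
        from \<delta>(2)[OF this w] show "\<delta> \<le> cmod (?z j - w)" by (simp add: dist_norm)
      qed (use \<gamma>(3) in simp)
      moreover have "\<forall>j<K. cmod (?z (Suc j) - ?z j) \<le> s" using step K_le(1) by (meson order_trans)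
      moreover have "chain_length ?z K < L"
        using chain_length_le_path_length[OF lip K0] \<gamma>(2) by linarith
      ultimately obtain H where "chain_cont (eval_fps ?b) ?z K R H" using ch[of ?z K] by blast
      then show ?thesis by (rule continuable_along_chain[OF lip K0 K_le(2) sR(2) \<gamma>(3)])
    qed
    then show ?thesis using radius finite_sumset[of N] by (auto simp: zero_ereal_def)
  qed
  show ?thesis
    unfolding resurgent_def endlessly_continuable_def
  proof (intro conjI allI impI)
    show "0 < fps_conv_radius ?b" using main[of 1] by (simp add: zero_ereal_def)
    show "\<exists>F. finite F \<and> (\<forall>\<gamma>. (\<exists>C. C-lipschitz_on {0..1} \<gamma>) \<and> path_length \<gamma> < L \<and> \<gamma> 0 = 0 \<and>
       \<gamma> ` {0<..1} \<subseteq> - F \<longrightarrow> continuable_along ?b \<gamma>)" if "L > 0" for L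
      using main[OF that] by blast
  qed
qed

end
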